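(* Let $A$ be a continuous inverse algebra over $\mathbb{K}\in\{\mathbb{R},\mathbb{C}\}$ such that for each continuous seminorm $p$ on $A$, there exist a continuous seminorm $q$ on $A$ and $r>0$ (which may depend on $p$ and $q$) such that $\sum_{n=1}^\infty r^n\|\mu_n\|_{p,q}<\infty$. (a) If $A$ is sequentially complete, then $A^\times$ is strongly $C^0$-regular and the map $\operatorname{Evol}\colon C^0([0,1],A)\to C^1([0,1],A^\times)$ is $\mathbb{K}$-analytic. (b) If $A$ is Mackey-complete, then $A^\times$ is $C^0$-regular and strongly $C^1$-regular. Further, each $\gamma\in\operatorname{Lip}([0,1],A)$ has an evolution $\operatorname{Evol}(\gamma)\in C^1([0,1],A^\times)$, and $\operatorname{Evol}\colon(\operatorname{Lip}([0,1],A),\mathcal{O}_{C^0})\to C^1([0,1],A^\times)$ is $\mathbb{K}$-analytic.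
   Context: All locally convex spaces are Hausdorff. A locally convex, unital, associative topological algebra $A$ over $\mathbb{K}$ (multiplication jointly continuous) is a continuous inverse algebra if its group $A^\times$ of invertible elements is open in $A$ and inversion $A^\times\to A$, $x\mapsto x^{-1}$ is continuous. Then $A^\times$, as an open subset of $A$, is a ($\mathbb{K}$-analytic) Lie group modelled on $A$; its tangent bundle is identified with $A^\times\times A$ and its Lie algebra with $A$. For $n\in\mathbb{N}=\{1,2,\dots\}$, $\mu_n\colon A^n\to A$, $\mu_n(x_1,\dots,x_n):=x_1x_2\cdots x_n$. For seminorms $p,q$ on $A$, \[ \|\mu_n\|_{p,q}:=\sup\{p(\mu_n(x_1,\dots,x_n)) : x_1,\dots,x_n\in A,\ q(x_j)\le 1 \text{ for all } j\}\in[0,\infty]. \] For a locally convex space $E$, a function $\gamma\colon[0,1]\to E$ is a Lipschitz curve if $\{\frac{\gamma(t)-\gamma(s)}{t-s}: s\neq t\in[0,1]\}$ is bounded in $E$; $\operatorname{Lip}([0,1],E)$ is the space of all of these. $E$ is Mackey-complete if every Lipschitz curve in $E$ admits a Riemann integral in $E$; equivalently, every Mackey-Cauchy sequence converges, i.e. every sequence $(x_n)$ for which there are a bounded set $B\subseteq E$ and reals $r_{n,m}\ge0$ with $x_n-x_m\in r_{n,m}B$ and $r_{n,m}\to0$ as both $n,m\to\infty$. Smooth maps: for locally convex spaces $E,F$ (regarded as real spaces), $U\subseteq E$ open and $r\in\mathbb{N}_0\cup\{\infty\}$, $f\colon U\to F$ is $C^r$ if it is continuous, the iterated directional derivatives $d^{(k)}f(x,y_1,\dots,y_k):=(D_{y_k}\cdots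 D_{y_1}f)(x)$ exist for all $k\in\mathbb{N}$, $k\le r$, and define continuous maps $d^{(k)}f\colon U\times E^k\to F$. Smooth means $C^\infty$. Analytic maps: if $E,F$ are complex locally convex spaces, a continuous homogeneous polynomial of degree $n\in\mathbb{N}_0$ is a map $p\colon E\to F$, $p(x)=\beta(x,\dots,x)$ with $\beta\colon E^n\to F$ continuous $n$-linear (a constant map if $n=0$). A map $f\colon U\to F$ on an open set $U\subseteq E$ is $\mathbb{C}$-analytic if it is continuous and for each $x\in U$ there are a $0$-neighbourhood $Y\subseteq E$ with $x+Y\subseteq U$ and continuous homogeneous polynomials $p_n\colon E\to F$ of degree $n$ with $f(x+y)=\sum_{n=0}^\infty p_n(y)$ for all $y\in Y$. If $E,F$ are real locally convex spaces, $f\colon U\to F$ on an open set $U\subseteq E$ is $\mathbb{R}$-analytic if it extends to a $\mathbb{C}$-analytic map $V\to F_{\mathbb{C}}$ on some open subset $V\subseteq E_{\mathbb{C}}$ of the complexification with $U\subseteq V$. Function spaces: for $r\in\mathbb{N}_0\cup\{\infty\}$, $C^r([0,1],E)$ is the space of $C^r$-curves $[0,1]\to E$ with the locally convex topology given by the seminorms $\|\gamma\|_{C^k,p}:=\max_{0\le j\le k}\max_{t\in[0,1]}p(\gamma^{(j)}(t))$, for $k\in\mathbb{N}_0$ with $k\le r$ and continuous seminorms $p$ on $E$. $\mathcal{O}_{C^k}$ denotes the topology induced by $C^k([0,1],E)$ on a vector subspace of it (such as $C^\infty([0,1],E)$, or $\operatorname{Lip}([0,1],E)$ if $k=0$). $C^1([0,1],A^\times)$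 is the open subset of $C^1([0,1],A)$ of curves with values in $A^\times$, and analyticity of maps into it means analyticity as maps into $C^1([0,1],A)$. Regularity: let $G$ be a Lie group modelled on a locally convex space, with identity element $1$ and Lie algebra $\mathfrak{g}=T_1G$; for $g\in G$, $v\in T_1G$ let $gv:=T_1(\lambda_g)(v)$, where $\lambda_g(x)=gx$. For continuous $\gamma\colon[0,1]\to\mathfrak{g}$ there is at most one $C^1$-map $\eta\colon[0,1]\to G$ with $\eta(0)=1$ and $\eta'(t)=\eta(t)\gamma(t)$ for all $t\in[0,1]$; if it exists, $\operatorname{Evol}(\gamma):=\eta$ is called the evolution of $\gamma$. (For $G=A^\times$, $\eta\colon[0,1]\to A^\times\subseteq A$ is a $C^1$-curve and $\eta(t)\gamma(t)$ is the product in $A$.) Let $k\in\mathbb{N}_0\cup\{\infty\}$. $G$ is strongly $C^k$-regular if every $\gamma\in C^k([0,1],\mathfrak{g})$ has an evolution $\operatorname{Evol}(\gamma)\in C^1([0,1],G)$ and the map $\operatorname{evol}\colon C^k([0,1],\mathfrak{g})\to G$, $\gamma\mapsto\operatorname{Evol}(\gamma)(1)$ is smooth. $G$ is $C^k$-regular if each $\gamma\in C^\infty([0,1],\mathfrak{g})$ has an evolution and the map $\operatorname{evol}\colon(C^\infty([0,1],\mathfrak{g}),\mathcal{O}_{C^k})\to G$, $\gamma\mapsto\operatorname{Evol}(\gamma)(1)$ is smooth. *)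

theory Defs
  imports "HOL-Analysis.Analysis" "HOL-Library.Function_Algebras"
begin

text \<open>
  Conventions.

  \<^item> The ground field is a set \<open>K :: complex set\<close>, which is \<open>\<real>\<close> or \<open>UNIV\<close>. The underlying real vector
    space structure is that of the class \<open>real_vector\<close>; the \<open>K\<close>-structure is an operation
    \<open>cs :: complex \<Rightarrow> 'a \<Rightarrow> 'a\<close> that extends \<open>scaleR\<close> and about which nothing is ever assumed or
    used outside \<open>K\<close>.

  \<^item> The space \<open>A\<close> is a whole type with its class topology. The function spaces on \<open>[0,1]\<close> carry
    several topologies, so analyticity and smoothness are defined for explicit topologies
    \<open>T :: 'e topology\<close> with \<open>topspace T\<close> a vector subspace of \<open>'e\<close>.

  \<^item> A curve \<open>[0,1] \<rightarrow> A\<close> is a function \<open>real \<Rightarrow> 'a\<close> that vanishes outside \<open>[0,1]\<close>; with pointwise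
    operations these form a vector subspace of \<open>real \<Rightarrow> 'a\<close>.
\<close>

instantiation "fun" :: (type, real_vector) real_vector
begin

definition scaleR_fun :: "real \<Rightarrow> ('a \<Rightarrow> 'b) \<Rightarrow> 'a \<Rightarrow> 'b"
  where "scaleR_fun c f = (\<lambda>x. c *\<^sub>R f x)"

instance
  by standard (auto simp: scaleR_fun_def fun_eq_iff scaleR_add_right scaleR_add_left)

end


section \<open>Locally convex spaces and continuous inverse algebras\<close>

locale locally_convex_space =
  fixes K :: "complex set"
    and cs :: "complex \<Rightarrow> 'a::{real_vector,t2_space} \<Rightarrow> 'a"
  assumes cs_of_real: "cs (of_real r) x = r *\<^sub>R x"
    and cs_add_right: "c \<in> K \<Longrightarrow> cs c (x + y) = cs c x + cs c y"
    and cs_add_left: "c \<in> K \<Longrightarrow> d \<in> K \<Longrightarrow> cs (c + d) x = cs c x + cs d x"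
    and cs_mult: "c \<in> K \<Longrightarrow> d \<in> K \<Longrightarrow> cs (c * d) x = cs c (cs d x)"
    and continuous_add: "continuous_on UNIV (\<lambda>(x, y). x + y :: 'a)"
    and continuous_cs: "continuous_on (K \<times> UNIV) (\<lambda>(c, x). cs c x)"
    and locally_convex: "open U \<Longrightarrow> (0::'a) \<in> U \<Longrightarrow>
          \<exists>C V. convex C \<and> open V \<and> 0 \<in> V \<and> V \<subseteq> C \<and> C \<subseteq> U"

text \<open>The sort below does not include \<open>zero_neq_one\<close>, so that the zero algebra is allowed.\<close>

definition unit_group :: "'a::{times,one} set" where
  "unit_group = {x. \<exists>y. x * y = 1 \<and> y * x = 1}"

definition unit_inverse :: "'a::{times,one} \<Rightarrow> 'a" where
  "unit_inverse x = (THE y. x * y = 1 \<and> y * x = 1)"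

locale continuous_inverse_algebra = locally_convex_space K cs
  for K :: "complex set"
    and cs :: "complex \<Rightarrow> 'a::{real_algebra,monoid_mult,t2_space} \<Rightarrow> 'a" +
  assumes cs_mult_left: "c \<in> K \<Longrightarrow> cs c x * y = cs c (x * y)"
    and cs_mult_right: "c \<in> K \<Longrightarrow> x * cs c y = cs c (x * y)"
    and continuous_mult: "continuous_on UNIV (\<lambda>(x, y). x * y :: 'a)"
    and open_unit_group: "open (unit_group :: 'a set)"
    and continuous_unit_inverse: "continuous_on unit_group (unit_inverse :: 'a \<Rightarrow> 'a)"

definition continuous_seminorm ::
    "complex set \<Rightarrow> (complex \<Rightarrow> 'a \<Rightarrow> 'a) \<Rightarrow> ('a::{real_vector,t2_space} \<Rightarrow> real) \<Rightarrow> bool" where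
  "continuous_seminorm K cs p \<longleftrightarrow>
     (\<forall>x y. p (x + y) \<le> p x + p y) \<and>
     (\<forall>c\<in>K. \<forall>x. p (cs c x) = cmod c * p x) \<and>
     continuous_on UNIV p"

text \<open>\<open>mu_norm n p q\<close> is \<open>\<parallel>\<mu>\<^sub>n\<parallel>\<close> with respect to \<open>p\<close> and \<open>q\<close>.\<close>

definition mu_norm ::
    "nat \<Rightarrow> ('a::monoid_mult \<Rightarrow> real) \<Rightarrow> ('a \<Rightarrow> real) \<Rightarrow> ennreal" where
  "mu_norm n p q =
     (SUP xs\<in>{xs. length xs = n \<and> (\<forall>x\<in>set xs. q x \<le> 1)}. ennreal (p (prod_list xs)))"


section \<open>Completeness\<close>

definition sequentially_complete :: "'a::{real_vector,t2_space} itself \<Rightarrow> bool" where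
  "sequentially_complete _ \<longleftrightarrow>
     (\<forall>X :: nat \<Rightarrow> 'a.
        (\<forall>U. open U \<and> 0 \<in> U \<longrightarrow> (\<exists>N. \<forall>m\<ge>N. \<forall>n\<ge>N. X m - X n \<in> U)) \<longrightarrow> convergent X)"

definition lcs_bounded ::
    "complex set \<Rightarrow> (complex \<Rightarrow> 'a \<Rightarrow> 'a) \<Rightarrow> 'a::{real_vector,t2_space} set \<Rightarrow> bool" where
  "lcs_bounded K cs B \<longleftrightarrow> (\<forall>p. continuous_seminorm K cs p \<longrightarrow> bdd_above (p ` B))"

definition Lip ::
    "complex set \<Rightarrow> (complex \<Rightarrow> 'a \<Rightarrow> 'a) \<Rightarrow> (real \<Rightarrow> 'a::{real_vector,t2_space}) set" where
  "Lip K cs =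
     {\<gamma>. (\<forall>t. t \<notin> {0..1} \<longrightarrow> \<gamma> t = 0) \<and>
         lcs_bounded K cs {(\<gamma> t - \<gamma> s) /\<^sub>R (t - s) |s t. s \<in> {0..1} \<and> t \<in> {0..1} \<and> s \<noteq> t}}"

text \<open>The Riemann integral: limit of Riemann sums over all tagged divisions as the mesh tends to 0.\<close>

definition has_riemann_integral :: "(real \<Rightarrow> 'a::{real_vector,t2_space}) \<Rightarrow> 'a \<Rightarrow> bool" where
  "has_riemann_integral \<gamma> I \<longleftrightarrow>
     (\<forall>U. open U \<and> I \<in> U \<longrightarrow>
        (\<exists>\<delta>>0. \<forall>\<D>. \<D> tagged_division_of {0..1} \<and> (\<forall>(t, J)\<in>\<D>. diameter J < \<delta>) \<longrightarrow>
           (\<Sum>(t, J)\<in>\<D>. measure lborel J *\<^sub>R \<gamma> t) \<in> U))"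

definition mackey_complete ::
    "complex set \<Rightarrow> (complex \<Rightarrow> 'a \<Rightarrow> 'a::{real_vector,t2_space}) \<Rightarrow> bool" where
  "mackey_complete K cs \<longleftrightarrow> (\<forall>\<gamma>\<in>Lip K cs. \<exists>I. has_riemann_integral \<gamma> I)"


section \<open>Smooth maps\<close>

definition has_dir_deriv ::
    "'f::real_vector topology \<Rightarrow> 'e::real_vector \<Rightarrow> ('e \<Rightarrow> 'f) \<Rightarrow> 'e \<Rightarrow> 'f \<Rightarrow> bool" where
  "has_dir_deriv TF y f x l \<longleftrightarrow>
     limitin TF (\<lambda>t::real. (f (x + t *\<^sub>R y) - f x) /\<^sub>R t) l (at 0)"

definition dir_deriv ::
    "'f::real_vector topology \<Rightarrow> 'e::real_vector \<Rightarrow> ('e \<Rightarrow> 'f) \<Rightarrow> 'e \<Rightarrow> 'f" where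
  "dir_deriv TF y f x = (THE l. has_dir_deriv TF y f x l)"

text \<open>\<open>iter_dir_deriv TF f [y\<^sub>1, \<dots>, y\<^sub>k]\<close> differentiates in direction \<open>y\<^sub>1\<close> first and \<open>y\<^sub>k\<close> last.\<close>

definition iter_dir_deriv ::
    "'f::real_vector topology \<Rightarrow> ('e::real_vector \<Rightarrow> 'f) \<Rightarrow> 'e list \<Rightarrow> 'e \<Rightarrow> 'f" where
  "iter_dir_deriv TF f ys = foldl (\<lambda>g y. dir_deriv TF y g) f ys"

definition C_map ::
    "enat \<Rightarrow> 'e::real_vector topology \<Rightarrow> 'f::real_vector topology \<Rightarrow> 'e set \<Rightarrow> ('e \<Rightarrow> 'f) \<Rightarrow> bool"
  where
  "C_map r TE TF U f \<longleftrightarrow>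
     openin TE U \<and>
     continuous_map (subtopology TE U) TF f \<and>
     (\<forall>ys y. set ys \<subseteq> topspace TE \<and> y \<in> topspace TE \<and> enat (Suc (length ys)) \<le> r \<longrightarrow>
        (\<forall>x\<in>U. \<exists>l. has_dir_deriv TF y (iter_dir_deriv TF f ys) x l)) \<and>
     (\<forall>k\<ge>1. enat k \<le> r \<longrightarrow>
        continuous_map (prod_topology (subtopology TE U) (product_topology (\<lambda>_. TE) {..<k})) TF
          (\<lambda>(x, y). iter_dir_deriv TF f (map y [0..<k]) x))"

abbreviation smooth_map ::
    "'e::real_vector topology \<Rightarrow> 'f::real_vector topology \<Rightarrow> 'e set \<Rightarrow> ('e \<Rightarrow> 'f) \<Rightarrow> bool" where
  "smooth_map \<equiv> C_map \<infinity>"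


section \<open>Analytic maps\<close>

text \<open>
  A point of \<open>E\<^sup>n\<close> is an element of \<open>{..<n} \<rightarrow>\<^sub>E E\<close>. For \<open>n = 0\<close> this set is a singleton and the
  homogeneous polynomials of degree 0 are exactly the constants.
\<close>

definition continuous_multilinear ::
    "nat \<Rightarrow> (complex \<Rightarrow> 'e \<Rightarrow> 'e) \<Rightarrow> 'e::real_vector topology \<Rightarrow>
     (complex \<Rightarrow> 'f \<Rightarrow> 'f) \<Rightarrow> 'f::real_vector topology \<Rightarrow> ((nat \<Rightarrow> 'e) \<Rightarrow> 'f) \<Rightarrow> bool" where
  "continuous_multilinear n sE TE sF TF \<beta> \<longleftrightarrow>
     continuous_map (product_topology (\<lambda>_. TE) {..<n}) TF \<beta> \<and>
     (\<forall>i<n. \<forall>x\<in>{..<n} \<rightarrow>\<^sub>E topspace TE. \<forall>a\<in>topspace TE.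
        (\<forall>b\<in>topspace TE. \<beta> (x(i := a + b)) = \<beta> (x(i := a)) + \<beta> (x(i := b))) \<and>
        (\<forall>c. \<beta> (x(i := sE c a)) = sF c (\<beta> (x(i := a)))))"

definition homogeneous_polynomial ::
    "nat \<Rightarrow> (complex \<Rightarrow> 'e \<Rightarrow> 'e) \<Rightarrow> 'e::real_vector topology \<Rightarrow>
     (complex \<Rightarrow> 'f \<Rightarrow> 'f) \<Rightarrow> 'f::real_vector topology \<Rightarrow> ('e \<Rightarrow> 'f) \<Rightarrow> bool" where
  "homogeneous_polynomial n sE TE sF TF p \<longleftrightarrow>
     (\<exists>\<beta>. continuous_multilinear n sE TE sF TF \<beta> \<and>
          (\<forall>x\<in>topspace TE. p x = \<beta> (\<lambda>i\<in>{..<n}. x)))"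

definition complex_analytic_map ::
    "(complex \<Rightarrow> 'e \<Rightarrow> 'e) \<Rightarrow> 'e::real_vector topology \<Rightarrow>
     (complex \<Rightarrow> 'f \<Rightarrow> 'f) \<Rightarrow> 'f::real_vector topology \<Rightarrow> 'e set \<Rightarrow> ('e \<Rightarrow> 'f) \<Rightarrow> bool" where
  "complex_analytic_map sE TE sF TF U f \<longleftrightarrow>
     openin TE U \<and>
     continuous_map (subtopology TE U) TF f \<and>
     (\<forall>x\<in>U. \<exists>Y p.
        (\<exists>V. openin TE V \<and> 0 \<in> V \<and> V \<subseteq> Y) \<and> Y \<subseteq> topspace TE \<and> (\<forall>y\<in>Y. x + y \<in> U) \<and>
        (\<forall>n. homogeneous_polynomial n sE TE sF TF (p n)) \<and>
        (\<forall>y\<in>Y. limitin TF (\<lambda>N. \<Sum>n<N. p n y) (f (x + y)) sequentially))"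

text \<open>Scalar multiplication on the complexification, \<open>(x, y)\<close> standing for \<open>x + i y\<close>.\<close>

definition complexification_scale :: "complex \<Rightarrow> 'e::real_vector \<times> 'e \<Rightarrow> 'e \<times> 'e" where
  "complexification_scale c =
     (\<lambda>(x, y). (Re c *\<^sub>R x - Im c *\<^sub>R y, Im c *\<^sub>R x + Re c *\<^sub>R y))"

definition real_analytic_map ::
    "'e::real_vector topology \<Rightarrow> 'f::real_vector topology \<Rightarrow> 'e set \<Rightarrow> ('e \<Rightarrow> 'f) \<Rightarrow> bool" where
  "real_analytic_map TE TF U f \<longleftrightarrow>
     openin TE U \<and>
     (\<exists>V g. (\<forall>x\<in>U. (x, 0) \<in> V \<and> g (x, 0) = (f x, 0)) \<and>
        complex_analytic_map complexification_scale (prod_topology TE TE)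
          complexification_scale (prod_topology TF TF) V g)"

definition analytic_map ::
    "complex set \<Rightarrow> (complex \<Rightarrow> 'e \<Rightarrow> 'e) \<Rightarrow> 'e::real_vector topology \<Rightarrow>
     (complex \<Rightarrow> 'f \<Rightarrow> 'f) \<Rightarrow> 'f::real_vector topology \<Rightarrow> 'e set \<Rightarrow> ('e \<Rightarrow> 'f) \<Rightarrow> bool" where
  "analytic_map K sE TE sF TF U f \<longleftrightarrow>
     (if K = UNIV then complex_analytic_map sE TE sF TF U f else real_analytic_map TE TF U f)"


section \<open>Spaces of curves\<close>

text \<open>Derivatives at the endpoints of \<open>[0,1]\<close> are one-sided.\<close>

definition has_curve_deriv ::
    "(real \<Rightarrow> 'a::{real_vector,t2_space}) \<Rightarrow> 'a \<Rightarrow> real \<Rightarrow> bool" where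
  "has_curve_deriv \<gamma> v t \<longleftrightarrow> ((\<lambda>s. (\<gamma> s - \<gamma> t) /\<^sub>R (s - t)) \<longlongrightarrow> v) (at t within {0..1})"

definition curve_deriv ::
    "(real \<Rightarrow> 'a::{real_vector,t2_space}) \<Rightarrow> real \<Rightarrow> 'a" where
  "curve_deriv \<gamma> t = (if t \<in> {0..1} then THE v. has_curve_deriv \<gamma> v t else 0)"

definition C_curves :: "enat \<Rightarrow> (real \<Rightarrow> 'a::{real_vector,t2_space}) set" where
  "C_curves r =
     {\<gamma>. (\<forall>t. t \<notin> {0..1} \<longrightarrow> \<gamma> t = 0) \<and>
         (\<forall>j. enat (Suc j) \<le> r \<longrightarrow> (\<forall>t\<in>{0..1}. \<exists>v. has_curve_deriv ((curve_deriv ^^ j) \<gamma>) v t)) \<and>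
         (\<forall>j. enat j \<le> r \<longrightarrow> continuous_on {0..1} ((curve_deriv ^^ j) \<gamma>))}"

definition C_curves_into :: "enat \<Rightarrow> 'a set \<Rightarrow> (real \<Rightarrow> 'a::{real_vector,t2_space}) set" where
  "C_curves_into r G = {\<gamma>\<in>C_curves r. \<gamma> ` {0..1} \<subseteq> G}"

definition curve_seminorm ::
    "nat \<Rightarrow> ('a \<Rightarrow> real) \<Rightarrow> (real \<Rightarrow> 'a::{real_vector,t2_space}) \<Rightarrow> real" where
  "curve_seminorm k p \<gamma> = (MAX j\<in>{..k}. SUP t\<in>{0..1}. p ((curve_deriv ^^ j) \<gamma> t))"

definition C_topology ::
    "complex set \<Rightarrow> (complex \<Rightarrow> 'a \<Rightarrow> 'a) \<Rightarrow> enat \<Rightarrow> (real \<Rightarrow> 'a::{real_vector,t2_space}) topology"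
  where
  "C_topology K cs r = topology_generated_by
     {{\<eta>\<in>C_curves r. curve_seminorm k p (\<eta> - \<gamma>) < \<epsilon>} |\<gamma> k p \<epsilon>.
        \<gamma> \<in> C_curves r \<and> enat k \<le> r \<and> continuous_seminorm K cs p \<and> \<epsilon> > 0}"

definition pointwise_scale :: "(complex \<Rightarrow> 'a \<Rightarrow> 'a) \<Rightarrow> complex \<Rightarrow> (real \<Rightarrow> 'a) \<Rightarrow> real \<Rightarrow> 'a" where
  "pointwise_scale cs c \<gamma> = (\<lambda>t. cs c (\<gamma> t))"


section \<open>Evolutions and regularity\<close>

text \<open>
  We consider Lie groups whose underlying manifold is an open subset \<open>G\<close> of the modelling space,
  with multiplication \<open>mul\<close> and identity \<open>e\<close>. All tangent spaces are identified with the modelling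
  space, so that \<open>g v = T\<^sub>1(\<lambda>\<^sub>g)(v)\<close> is the directional derivative of \<open>mul g\<close> at \<open>e\<close>. For
  \<open>G = unit_group\<close> and \<open>mul = times\<close> it is the product \<open>g * v\<close>.
\<close>

definition is_evolution ::
    "'a set \<Rightarrow> ('a \<Rightarrow> 'a \<Rightarrow> 'a) \<Rightarrow> 'a \<Rightarrow> (real \<Rightarrow> 'a::{real_vector,t2_space}) \<Rightarrow> (real \<Rightarrow> 'a) \<Rightarrow> bool"
  where
  "is_evolution G mul e \<gamma> \<eta> \<longleftrightarrow>
     \<eta> \<in> C_curves_into 1 G \<and> \<eta> 0 = e \<and>
     (\<forall>t\<in>{0..1}. curve_deriv \<eta> t = dir_deriv euclidean (\<gamma> t) (mul (\<eta> t)) e)"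

definition Evol ::
    "'a set \<Rightarrow> ('a \<Rightarrow> 'a \<Rightarrow> 'a) \<Rightarrow> 'a \<Rightarrow> (real \<Rightarrow> 'a::{real_vector,t2_space}) \<Rightarrow> real \<Rightarrow> 'a" where
  "Evol G mul e \<gamma> = (THE \<eta>. is_evolution G mul e \<gamma> \<eta>)"

definition strongly_regular ::
    "complex set \<Rightarrow> (complex \<Rightarrow> 'a \<Rightarrow> 'a) \<Rightarrow> enat \<Rightarrow>
     'a::{real_vector,t2_space} set \<Rightarrow> ('a \<Rightarrow> 'a \<Rightarrow> 'a) \<Rightarrow> 'a \<Rightarrow> bool" where
  "strongly_regular K cs k G mul e \<longleftrightarrow>
     (\<forall>\<gamma>\<in>C_curves k. \<exists>\<eta>. is_evolution G mul e \<gamma> \<eta>) \<and>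
     smooth_map (C_topology K cs k) euclidean (C_curves k) (\<lambda>\<gamma>. Evol G mul e \<gamma> 1)"

definition regular ::
    "complex set \<Rightarrow> (complex \<Rightarrow> 'a \<Rightarrow> 'a) \<Rightarrow> enat \<Rightarrow>
     'a::{real_vector,t2_space} set \<Rightarrow> ('a \<Rightarrow> 'a \<Rightarrow> 'a) \<Rightarrow> 'a \<Rightarrow> bool" where
  "regular K cs k G mul e \<longleftrightarrow>
     (\<forall>\<gamma>\<in>C_curves \<infinity>. \<exists>\<eta>. is_evolution G mul e \<gamma> \<eta>) \<and>
     smooth_map (subtopology (C_topology K cs k) (C_curves \<infinity>)) euclidean
       (C_curves \<infinity>) (\<lambda>\<gamma>. Evol G mul e \<gamma> 1)"

end

theory Submission
  imports Defs
begin

text \<open>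
  The hypothesis on \<open>\<mu>\<^sub>n\<close> says that every continuous seminorm \<open>p\<close> is dominated by a continuous
  seminorm \<open>p'\<close> with \<open>p'(x y) \<le> p'(x) q'(y)\<close> for some continuous seminorm \<open>q'\<close>. Hence the linear
  equation \<open>x' = x \<gamma> + w\<close>, \<open>x(0) = 0\<close> obeys Gronwall estimates with respect to \<open>p'\<close>, weighted by
  \<open>e\<^sup>\<lambda>\<^sup>t\<close>, and Picard iteration converges so fast that Mackey completeness suffices. The solution
  operator \<open>T\<^sub>\<gamma> w\<close> depends continuously on \<open>(\<gamma>, w)\<close>. The evolution \<open>\<eta>\<close> of \<open>\<gamma>\<close> has the expansion
  \<open>Evol(\<gamma> + \<delta>) = \<Sum>\<^sub>n x\<^sub>n\<close> with \<open>x\<^sub>0 = \<eta>\<close>, \<open>x\<^sub>n\<^sub>+\<^sub>1 = T\<^sub>\<gamma>(x\<^sub>n \<delta>)\<close>, because the remainder after \<open>x\<^sub>N\<close> is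
  \<open>T\<^sub>\<gamma>\<^sub>+\<^sub>\<delta>(x\<^sub>N \<delta>)\<close>; directional derivatives are iterated \<open>T\<^sub>\<gamma>\<close>'s in the same way. Over the reals the same
  argument applies to the complexified algebra and provides the complex analytic extension. The
  values of \<open>\<eta>\<close> are invertible because reversing time yields a two-sided inverse.
\<close>

section \<open>Seminorms on locally convex spaces\<close>

text \<open>In a Mackey-complete algebra Cauchy sequences may diverge and only Lipschitz curves are
  known to be integrable, so limits in spaces of curves do not come for free. The Picard series is
  therefore summed pointwise, each sum being read off from the integral of one specially built
  Lipschitz curve, and the resulting curve must be shown to be Lipschitz before it can be
  differentiated. From then on completeness enters only through solvability of the linear equation:
  the remainder and the difference quotients of the evolution map are themselves solutions of such
  equations, so convergence and differentiability follow from continuous dependence. As the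
  expansion is valid for every increment, no radius of convergence has to be tracked. All of this is
  done once, for a space \<open>X\<close> of curves that stands for continuous curves, for Lipschitz
  curves, or for pairs of either. Seminorms are homogeneous over the reals only, which frees the
  analysis from the ground field; complex scalars return in the linearity of the Taylor
  terms.\<close>

definition cseminorm :: "('b::{real_vector,t2_space} \<Rightarrow> real) \<Rightarrow> bool" where
  "cseminorm p \<longleftrightarrow> (\<forall>x y. p (x + y) \<le> p x + p y) \<and> (\<forall>r x. p (r *\<^sub>R x) = \<bar>r\<bar> * p x) \<and>
     continuous_on UNIV p"

lemma cseminormD:
  assumes "cseminorm p"
  shows cseminorm_add: "p (x + y) \<le> p x + p y"
    and cseminorm_scale: "p (r *\<^sub>R x) = \<bar>r\<bar> * p x"
    and cseminorm_cont: "continuous_on UNIV p"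
    and cseminorm_zero: "p 0 = 0"
    and cseminorm_minus: "p (- x) = p x"
    and cseminorm_nonneg: "0 \<le> p x"
    and cseminorm_diff: "p (x - y) \<le> p x + p y"
    and cseminorm_commute: "p (x - y) = p (y - x)"
    and cseminorm_triangle: "p (x - z) \<le> p (x - y) + p (y - z)"
proof -
  have add: "p (x + y) \<le> p x + p y" and sc: "p (r *\<^sub>R x) = \<bar>r\<bar> * p x" for x y r
    using assms by (auto simp: cseminorm_def)
  show "p (x + y) \<le> p x + p y" and "p (r *\<^sub>R x) = \<bar>r\<bar> * p x" by (fact add, fact sc)
  show "continuous_on UNIV p" using assms by (auto simp: cseminorm_def)
  show 0: "p 0 = 0" using sc[of 0 0] by simp
  have m: "p (- x) = p x" for x using sc[of "-1" x] by simp
  then show "p (- x) = p x" .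
  show "0 \<le> p x" using add[of x "-x"] 0 m[of x] by simp
  show "p (x - y) \<le> p x + p y" using add[of x "-y"] m[of y] by simp
  show "p (x - y) = p (y - x)" using m[of "x - y"] by simp
  show "p (x - z) \<le> p (x - y) + p (y - z)" using add[of "x - y" "y - z"] by simp
qed

lemma cseminorm_sum_le:
  assumes "cseminorm p"
  shows "p (\<Sum>i\<in>I. f i) \<le> (\<Sum>i\<in>I. p (f i))"
proof (induction I rule: infinite_finite_induct)
  case (insert i I)
  then show ?case using cseminorm_add[OF assms, of "f i" "sum f I"] by simp
qed (simp_all add: cseminorm_zero[OF assms])

lemma cseminorm_plus:
  assumes "cseminorm p" "cseminorm q"
  shows "cseminorm (\<lambda>x. p x + q x)"
  unfolding cseminorm_def
proof (intro conjI allI)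
  show "p (x + y) + q (x + y) \<le> p x + q x + (p y + q y)" for x y
    using cseminorm_add[OF assms(1), of x y] cseminorm_add[OF assms(2), of x y] by simp
  show "p (r *\<^sub>R x) + q (r *\<^sub>R x) = \<bar>r\<bar> * (p x + q x)" for r x
    using assms by (simp add: cseminorm_scale distrib_left)
  show "continuous_on UNIV (\<lambda>x. p x + q x)"
    using assms by (intro continuous_on_add cseminorm_cont)
qed

lemma cseminorm_mult:
  assumes "cseminorm p" "c \<ge> 0"
  shows "cseminorm (\<lambda>x. c * p x)"
  using assms unfolding cseminorm_def
  by (auto intro!: continuous_intros simp flip: distrib_left intro: mult_left_mono)

lemma cseminorm_null: "cseminorm (\<lambda>_. 0)"
  by (auto simp: cseminorm_def)

text \<open>No scalar multiplication over K is recorded. The type of pairs is therefore again an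
  instance, although its complex scalars are a different operation.\<close>

locale seminormed_space =
  fixes T :: "'b::{real_vector,t2_space} itself"
  assumes continuous_translation: "continuous_on UNIV (\<lambda>y::'b. y + x)"
    and open_contains_seminorm_ball:
      "open U \<Longrightarrow> (x::'b) \<in> U \<Longrightarrow> \<exists>p. cseminorm p \<and> (\<forall>y. p (y - x) < 1 \<longrightarrow> y \<in> U)"
begin

lemma tendsto_iff_cseminorm:
  fixes f :: "'c \<Rightarrow> 'b"
  shows "(f \<longlongrightarrow> l) F \<longleftrightarrow> (\<forall>p. cseminorm p \<longrightarrow> ((\<lambda>x. p (f x - l)) \<longlongrightarrow> 0) F)"
proof (intro iffI allI impI)
  fix p :: "'b \<Rightarrow> real"
  assume f: "(f \<longlongrightarrow> l) F" and p: "cseminorm p"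
  have "continuous_on UNIV (\<lambda>y::'b. p (y + - l))"
    by (rule continuous_on_compose2[OF cseminorm_cont[OF p] continuous_translation]) auto
  then have "isCont (\<lambda>y::'b. p (y - l)) l"
    by (auto simp: continuous_on_eq_continuous_at)
  from isCont_tendsto_compose[OF this f] show "((\<lambda>x. p (f x - l)) \<longlongrightarrow> 0) F"
    by (simp add: cseminorm_zero[OF p])
next
  assume *: "\<forall>p. cseminorm p \<longrightarrow> ((\<lambda>x. p (f x - l)) \<longlongrightarrow> 0) F"
  show "(f \<longlongrightarrow> l) F"
  proof (rule topological_tendstoI)
    fix S :: "'b set"
    assume "open S" "l \<in> S"
    then obtain p where p: "cseminorm p" "\<And>y. p (y - l) < 1 \<Longrightarrow> y \<in> S"
      using open_contains_seminorm_ball by blast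
    have "\<forall>\<^sub>F x in F. p (f x - l) < 1"
      using * p(1) order_tendstoD(2)[of "\<lambda>x. p (f x - l)" 0 F 1] by auto
    then show "\<forall>\<^sub>F x in F. f x \<in> S"
      by eventually_elim (rule p(2))
  qed
qed

lemma tendsto_cseminorm_comp:
  fixes f :: "'c \<Rightarrow> 'b"
  assumes "(f \<longlongrightarrow> l) F" "cseminorm p"
  shows "((\<lambda>x. p (f x)) \<longlongrightarrow> p l) F"
  using assms isCont_tendsto_compose[of l p f F] cseminorm_cont[OF assms(2)]
  by (auto simp: continuous_on_eq_continuous_at)

text \<open>The Hausdorff property enters here: the complement of \<open>x\<close> is open, so for
  nonzero \<open>x\<close> some seminorm ball around 0 misses \<open>x\<close>.\<close>

lemma eq_zero_if_cseminorm_le: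
  assumes "\<And>p. cseminorm p \<Longrightarrow> p (x::'b) \<le> 0"
  shows "x = 0"
proof (rule ccontr)
  assume "x \<noteq> 0"
  then obtain p :: "'b \<Rightarrow> real" where p: "cseminorm p" "\<And>y. p (y - 0) < 1 \<Longrightarrow> y \<in> - {x}"
    using open_contains_seminorm_ball[of "- {x}" 0] by auto
  have "p (x - 0) < 1" using assms[OF p(1)] by simp
  then show False using p(2) by blast
qed

lemma tendsto_add_seminormed:
  fixes f g :: "'c \<Rightarrow> 'b"
  assumes "(f \<longlongrightarrow> a) F" "(g \<longlongrightarrow> b) F"
  shows "((\<lambda>x. f x + g x) \<longlongrightarrow> a + b) F"
  unfolding tendsto_iff_cseminorm
proof (intro allI impI)
  fix p :: "'b \<Rightarrow> real" assume p: "cseminorm p"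
  have "((\<lambda>x. p (f x - a) + p (g x - b)) \<longlongrightarrow> 0 + 0) F"
    using assms p by (intro tendsto_add) (auto simp: tendsto_iff_cseminorm)
  then have lim: "((\<lambda>x. p (f x - a) + p (g x - b)) \<longlongrightarrow> 0) F" by simp
  have "norm (p (f x + g x - (a + b))) \<le> p (f x - a) + p (g x - b)" for x
    using cseminorm_add[OF p, of "f x - a" "g x - b"] cseminorm_nonneg[OF p]
    by (simp add: algebra_simps)
  then show "((\<lambda>x. p (f x + g x - (a + b))) \<longlongrightarrow> 0) F"
    by (intro Lim_null_comparison[OF always_eventually lim] allI)
qed

lemma tendsto_scaleR_seminormed:
  fixes f :: "'c \<Rightarrow> 'b"
  assumes "(f \<longlongrightarrow> a) F"
  shows "((\<lambda>x. r *\<^sub>R f x) \<longlongrightarrow> r *\<^sub>R a) F"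
  unfolding tendsto_iff_cseminorm
proof (intro allI impI)
  fix p :: "'b \<Rightarrow> real" assume p: "cseminorm p"
  have "((\<lambda>x. \<bar>r\<bar> * p (f x - a)) \<longlongrightarrow> \<bar>r\<bar> * 0) F"
    using assms p by (intro tendsto_mult_left) (auto simp: tendsto_iff_cseminorm)
  then show "((\<lambda>x. p (r *\<^sub>R f x - r *\<^sub>R a)) \<longlongrightarrow> 0) F"
    by (simp add: cseminorm_scale[OF p] flip: scaleR_diff_right)
qed

lemma continuous_on_iff_cseminorm:
  fixes f :: "'c::topological_space \<Rightarrow> 'b"
  shows "continuous_on S f \<longleftrightarrow>
    (\<forall>x\<in>S. \<forall>p. cseminorm p \<longrightarrow> ((\<lambda>y. p (f y - f x)) \<longlongrightarrow> 0) (at x within S))"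
  by (auto simp: continuous_on_def tendsto_iff_cseminorm)

lemma continuous_on_curve_iff:
  fixes f :: "real \<Rightarrow> 'b"
  shows "continuous_on S f \<longleftrightarrow>
    (\<forall>x\<in>S. \<forall>p e. cseminorm p \<and> e > 0 \<longrightarrow> (\<exists>d>0. \<forall>y\<in>S. \<bar>y - x\<bar> < d \<longrightarrow> p (f y - f x) < e))"
    (is "?L \<longleftrightarrow> ?R")
proof
  assume L: ?L
  show ?R
  proof (intro ballI allI impI)
    fix x p e assume "x \<in> S" and p: "cseminorm (p::'b \<Rightarrow> real) \<and> (e::real) > 0"
    then have "((\<lambda>y. p (f y - f x)) \<longlongrightarrow> 0) (at x within S)"
      using L by (auto simp: continuous_on_iff_cseminorm)
    then have "\<forall>\<^sub>F y in at x within S. p (f y - f x) < e"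
      using p by (intro order_tendstoD) auto
    then obtain d where "d > 0" "\<And>y. y \<in> S \<Longrightarrow> y \<noteq> x \<Longrightarrow> \<bar>y - x\<bar> < d \<Longrightarrow> p (f y - f x) < e"
      by (auto simp: eventually_at dist_real_def)
    moreover have "p (f x - f x) < e" using p by (simp add: cseminorm_zero)
    ultimately show "\<exists>d>0. \<forall>y\<in>S. \<bar>y - x\<bar> < d \<longrightarrow> p (f y - f x) < e" by metis
  qed
next
  assume R: ?R
  show ?L
    unfolding continuous_on_iff_cseminorm
  proof (intro ballI allI impI)
    fix x p assume x: "x \<in> S" and p: "cseminorm (p::'b \<Rightarrow> real)"
    show "((\<lambda>y. p (f y - f x)) \<longlongrightarrow> 0) (at x within S)"
      unfolding tendsto_iff eventually_at dist_real_def
      using R x p cseminorm_nonneg[OF p] by (auto) (meson)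
  qed
qed

lemma open_cseminorm_ball:
  assumes "cseminorm p"
  shows "open {y::'b. p (y - x) < e}"
proof -
  have "continuous_on UNIV (\<lambda>y::'b. p (y + - x))"
    by (rule continuous_on_compose2[OF cseminorm_cont[OF assms] continuous_translation]) auto
  then show ?thesis
    using open_Collect_less[of "\<lambda>y. p (y - x)" "\<lambda>_. e"] by (simp add: continuous_on_const)
qed

text \<open>Continuity comes from \<open>|P y - P x| \<le> q (y - x)\<close>. It is meant for
  suprema of infinitely many continuous seminorms, to which the continuity of the members does not
  pass on.\<close>

lemma cseminorm_dominated:
  fixes P :: "'b \<Rightarrow> real"
  assumes "\<And>x y. P (x + y) \<le> P x + P y" "\<And>r x. P (r *\<^sub>R x) = \<bar>r\<bar> * P x"
    and q: "cseminorm q" and le: "\<And>x. P x \<le> q x"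
  shows "cseminorm P"
proof -
  have "((\<lambda>y. P y) \<longlongrightarrow> P x) (at x)" for x
  proof -
    have "((\<lambda>y::'b. y) \<longlongrightarrow> x) (at x)" by (rule tendsto_ident_at)
    then have q0: "((\<lambda>y. q (y - x)) \<longlongrightarrow> 0) (at x)"
      using q by (simp add: tendsto_iff_cseminorm)
    have "\<bar>P y - P x\<bar> \<le> q (y - x)" for y
      using assms(1)[of "y - x" x] assms(1)[of "x - y" y] assms(2)[of "-1" "y - x"] le[of "y - x"]
      by (simp add: abs_le_iff)
    then have "\<forall>\<^sub>F y in at x. norm (P y - P x) \<le> q (y - x)" by simp
    then have "((\<lambda>y. P y - P x) \<longlongrightarrow> 0) (at x)"
      using q0 by (rule Lim_null_comparison)
    then show ?thesis by (simp add: LIM_zero_iff)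
  qed
  then have "continuous_on UNIV P" by (auto simp: continuous_on_def)
  then show ?thesis using assms by (auto simp: cseminorm_def)
qed

end


subsection \<open>Minkowski functionals\<close>

lemma continuous_seminorm_imp_cseminorm:
  assumes "locally_convex_space K cs" "\<real> \<subseteq> K" "continuous_seminorm K cs p"
  shows "cseminorm p"
proof -
  interpret locally_convex_space K cs by fact
  have "p (r *\<^sub>R x) = \<bar>r\<bar> * p x" for r x
  proof -
    have "of_real r \<in> K" using assms(2) by auto
    then have "p (cs (of_real r) x) = cmod (of_real r) * p x"
      using assms(3) unfolding continuous_seminorm_def by blast
    then show ?thesis by (simp add: cs_of_real)
  qed
  then show ?thesis using assms(3) by (auto simp: cseminorm_def continuous_seminorm_def)
qed

context locally_convex_space
begin

lemma tendsto_add_lcs: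
  fixes f g :: "'c \<Rightarrow> 'a"
  assumes "(f \<longlongrightarrow> a) F" "(g \<longlongrightarrow> b) F"
  shows "((\<lambda>x. f x + g x) \<longlongrightarrow> a + b) F"
proof -
  have "isCont (\<lambda>(x, y). x + y :: 'a) (a, b)"
    using continuous_add by (simp add: continuous_on_eq_continuous_at)
  from isCont_tendsto_compose[OF this tendsto_Pair[OF assms]] show ?thesis by simp
qed

lemma continuous_translation_lcs: "continuous_on UNIV (\<lambda>y::'a. y + x)"
  unfolding continuous_on_def by (auto intro!: tendsto_add_lcs tendsto_ident_at tendsto_const)

lemma continuous_on_cs:
  assumes "c \<in> K"
  shows "continuous_on UNIV (cs c)"
proof -
  have "continuous_on UNIV (\<lambda>x::'a. (c, x))"
    by (intro continuous_on_Pair continuous_on_const continuous_on_id)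
  then have "continuous_on UNIV (\<lambda>x. (\<lambda>(c, x). cs c x) (c, x))"
    by (rule continuous_on_compose2[OF continuous_cs]) (use assms in auto)
  then show ?thesis by simp
qed

lemma continuous_on_scaleR_right:
  assumes "\<real> \<subseteq> K"
  shows "continuous_on UNIV (\<lambda>x::'a. r *\<^sub>R x)"
proof -
  have "of_real r \<in> K" using assms by auto
  from continuous_on_cs[OF this] show ?thesis by (simp add: cs_of_real)
qed

lemma continuous_on_scaleR_left:
  assumes "\<real> \<subseteq> K"
  shows "continuous_on UNIV (\<lambda>r. r *\<^sub>R (x::'a))"
proof -
  have "continuous_on UNIV (\<lambda>r. (\<lambda>(c, x). cs c x) (complex_of_real r, x))"
    by (rule continuous_on_compose2[OF continuous_cs])
       (use assms in \<open>auto intro!: continuous_intros\<close>)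
  then show ?thesis by (simp add: cs_of_real)
qed

text \<open>\<open>D\<close> keeps the points whose multiples by scalars of modulus at most 1 all
  stay in the convex set \<open>C\<close>, which makes it balanced and leaves it convex. That it
  still contains a neighbourhood of 0 is joint continuity of the scalar multiplication at
  \<open>(0, 0)\<close>.\<close>

lemma balanced_convex_nbhd:
  assumes K: "K = \<real> \<or> K = UNIV" and U: "open U" "(0::'a) \<in> U"
  obtains D W where "convex D" "open W" "0 \<in> W" "W \<subseteq> D" "D \<subseteq> U"
    "\<And>c x. c \<in> K \<Longrightarrow> cmod c \<le> 1 \<Longrightarrow> x \<in> D \<Longrightarrow> cs c x \<in> D"
proof -
  have RK: "\<real> \<subseteq> K" and Kmult: "\<And>c d. c \<in> K \<Longrightarrow> d \<in> K \<Longrightarrow> c * d \<in> K" and K1: "1 \<in> K" "0 \<in> K"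
    using K by auto
  obtain C V where C: "convex C" "open V" "0 \<in> V" "V \<subseteq> C" "C \<subseteq> U"
    using locally_convex[OF U] by blast
  define D where "D = {x. \<forall>c\<in>K. cmod c \<le> 1 \<longrightarrow> cs c x \<in> C}"
  have cs1: "cs 1 x = x" for x using cs_of_real[of 1 x] by simp
  have cs0: "cs c 0 = 0" if "c \<in> K" for c
    using cs_add_right[OF that, of 0 0] by simp
  have csR: "cs c (r *\<^sub>R x) = r *\<^sub>R cs c x" if "c \<in> K" for c r x
  proof -
    have "of_real r \<in> K" using RK by auto
    then show ?thesis
      using cs_mult[of c "of_real r" x] cs_mult[of "of_real r" c x] that
      by (simp add: cs_of_real mult.commute)
  qed
  have "convex D"
    unfolding convex_def D_def using C(1)
    by (auto simp: cs_add_right csR convex_def)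
  moreover have "D \<subseteq> U" using C(5) K1 cs1 by (force simp: D_def)
  moreover have "cs c x \<in> D" if "c \<in> K" "cmod c \<le> 1" "x \<in> D" for c x
    unfolding D_def
  proof (intro CollectI ballI impI)
    fix d assume d: "d \<in> K" "cmod d \<le> 1"
    have "cmod (d * c) \<le> 1" using d that by (simp add: norm_mult mult_le_one)
    then show "cs d (cs c x) \<in> C" using that d Kmult[of d c] cs_mult[of d c x]
      by (auto simp: D_def)
  qed
  moreover obtain W where "open W" "0 \<in> W" "W \<subseteq> D"
  proof -
    have "((\<lambda>(c, x). cs c x) \<longlongrightarrow> cs 0 0) (at (0, 0) within K \<times> UNIV)"
      using continuous_cs K1 by (auto simp: continuous_on_def)
    then have ev: "\<forall>\<^sub>F z in at (0, 0) within K \<times> UNIV. (case z of (c, x) \<Rightarrow> cs c x) \<in> V"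
      using C(2,3) cs0[OF K1(2)] by (intro topological_tendstoD) auto
    then obtain S where S0: "open S" "(0, 0) \<in> S"
      "\<forall>z\<in>S. z \<noteq> (0, 0) \<longrightarrow> z \<in> K \<times> UNIV \<longrightarrow> (case z of (c, x) \<Rightarrow> cs c x) \<in> V"
      unfolding eventually_at_topological by (elim exE conjE)
    have S: "cs c x \<in> V" if "(c, x) \<in> S" "(c, x) \<noteq> (0, 0)" "c \<in> K" for c x
      using S0(3)[rule_format, OF that(1)] that by simp
    obtain A B where AB: "open A" "open B" "(0, 0) \<in> A \<times> B" "A \<times> B \<subseteq> S"
      using open_prod_elim[OF S0(1,2)] by metis
    then obtain e where e: "e > 0" "ball 0 e \<subseteq> A" by (meson mem_Sigma_iff openE)
    \<comment> \<open>A scalar of modulus at most 1 need not lie in \<open>A\<close>. Multiplied by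
      \<open>e / 2\<close> it does, and the vector is stretched by \<open>2 / e\<close> in
      compensation.\<close>
    define W where "W = {x. (2 / e) *\<^sub>R x \<in> B}"
    have "continuous_on UNIV (\<lambda>x::'a. (2 / e) *\<^sub>R x)"
      by (rule continuous_on_scaleR_right[OF RK])
    then have "open W" using AB(2) unfolding W_def
      using open_vimage[of B] by (simp add: vimage_def)
    moreover have "0 \<in> W" using AB by (auto simp: W_def)
    moreover have "W \<subseteq> D"
      unfolding D_def
    proof (intro subsetI CollectI ballI impI)
      fix x c assume x: "x \<in> W" and c: "c \<in> K" "cmod c \<le> 1"
      let ?d = "c * of_real (e / 2)"
      have eK: "of_real (e / 2) \<in> K" using RK by auto
      then have dK: "?d \<in> K" using c Kmult by blast
      have "cmod ?d < e" using e c by (simp add: norm_mult)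
      then have "?d \<in> A" using e by auto
      then have "(?d, (2 / e) *\<^sub>R x) \<in> S" using AB x by (auto simp: W_def)
      then have "cs ?d ((2 / e) *\<^sub>R x) \<in> V"
        using S dK C(3) cs0[OF dK] by (cases "(?d, (2 / e) *\<^sub>R x) = (0, 0)") auto
      moreover have "cs ?d ((2 / e) *\<^sub>R x) = cs c x"
        using e cs_mult[OF c(1) eK, of "(2 / e) *\<^sub>R x"] cs_of_real[of "e / 2"] by simp
      ultimately show "cs c x \<in> C" using C(4) by auto
    qed
    ultimately show ?thesis using that by blast
  qed
  ultimately show ?thesis using that by blast
qed

text \<open>\<open>p\<close> is the gauge of a balanced convex neighbourhood of 0 inside
  \<open>U - x0\<close>: convexity yields the triangle inequality, balancedness the homogeneity over
  K, and absorption keeps the infimum from ranging over the empty set.\<close>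

lemma minkowski_seminorm:
  assumes K: "K = \<real> \<or> K = UNIV" and U: "open U" "(x0::'a) \<in> U"
  obtains p where "continuous_seminorm K cs p" "\<And>y. p (y - x0) < 1 \<Longrightarrow> y \<in> U"
proof -
  have RK: "\<real> \<subseteq> K" and Kdiv: "\<And>c d. c \<in> K \<Longrightarrow> d \<in> \<real> \<Longrightarrow> c / d \<in> K"
    and Kinv: "\<And>c. c \<in> K \<Longrightarrow> inverse c \<in> K"
    using K by auto
  have cs1: "cs 1 x = x" for x using cs_of_real[of 1 x] by simp
  have cs0: "cs 0 x = 0" for x using cs_of_real[of 0 x] by simp
  have "open ((\<lambda>y. y + x0) -` U)"
    using continuous_translation_lcs U(1) by (intro open_vimage)
  then obtain D W where D: "convex D" "open W" "0 \<in> W" "W \<subseteq> D" "D \<subseteq> (\<lambda>y. y + x0) -` U"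
    and bal: "\<And>c x. c \<in> K \<Longrightarrow> cmod c \<le> 1 \<Longrightarrow> x \<in> D \<Longrightarrow> cs c x \<in> D"
    using balanced_convex_nbhd[OF K, of "(\<lambda>y. y + x0) -` U"] U(2) by auto
  define p where "p x = Inf {t. t > 0 \<and> x /\<^sub>R t \<in> D}" for x
  have bdd: "bdd_below {t. t > 0 \<and> x /\<^sub>R t \<in> D}" for x by (intro bdd_belowI[of _ 0]) auto
  have nonempty: "\<exists>t>0. x /\<^sub>R t \<in> D" for x
  proof -
    have "open ((\<lambda>r. r *\<^sub>R x) -` W)"
      using continuous_on_scaleR_left[OF RK] D(2) by (intro open_vimage)
    moreover have "0 \<in> (\<lambda>r. r *\<^sub>R x) -` W" using D(3) by simp
    ultimately obtain e where e: "e > 0" "ball 0 e \<subseteq> (\<lambda>r. r *\<^sub>R x) -` W"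
      by (meson openE)
    have "e / 2 \<in> ball 0 e" using e by simp
    then have "(e / 2) *\<^sub>R x \<in> D" using e D(4) by blast
    then show ?thesis using e by (intro exI[of _ "2 / e"]) auto
  qed
  \<comment> \<open>Shrinking by the real factor \<open>t / s\<close> is a special case of
    balancedness, so the admissible parameters form an upward closed set.\<close>
  have up: "x /\<^sub>R s \<in> D" if "x /\<^sub>R t \<in> D" "0 < t" "t \<le> s" for x s t
  proof -
    have "cs (of_real (t / s)) (x /\<^sub>R t) \<in> D"
      using that RK by (intro bal) (auto simp: norm_divide simp del: of_real_divide)
    then have "(t / s) *\<^sub>R (x /\<^sub>R t) \<in> D" by (simp only: cs_of_real)
    then show ?thesis using that by (simp add: field_simps)
  qed
  have less: "x /\<^sub>R s \<in> D" if ps: "p x < s" for x s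
  proof -
    have "{t. t > 0 \<and> x /\<^sub>R t \<in> D} \<noteq> {}" using nonempty[of x] by blast
    from cInf_less_iff[OF this bdd, of s] obtain t where "t > 0" "x /\<^sub>R t \<in> D" "t < s"
      using ps unfolding p_def by blast
    then show ?thesis using up by auto
  qed
  have le: "p x \<le> s" if "s > 0" "x /\<^sub>R s \<in> D" for x s
    unfolding p_def using that bdd by (intro cInf_lower) auto
  have nonneg: "p x \<ge> 0" for x
    unfolding p_def using nonempty[of x] by (intro cInf_greatest) auto
  have add: "p (x + y) \<le> p x + p y" for x y
  proof (rule field_le_epsilon)
    fix e :: real assume "e > 0"
    define s t where "s = p x + e / 2" and "t = p y + e / 2"
    have st: "s > 0" "t > 0" using \<open>e > 0\<close> nonneg[of x] nonneg[of y] by (auto simp: s_def t_def)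
    have "x /\<^sub>R s \<in> D" "y /\<^sub>R t \<in> D" using \<open>e > 0\<close> by (auto simp: s_def t_def intro!: less)
    then have "(s / (s + t)) *\<^sub>R (x /\<^sub>R s) + (t / (s + t)) *\<^sub>R (y /\<^sub>R t) \<in> D"
      using st D(1) by (intro convexD) (simp_all flip: add_divide_distrib)
    moreover have "(s / (s + t)) *\<^sub>R (x /\<^sub>R s) + (t / (s + t)) *\<^sub>R (y /\<^sub>R t) = (x + y) /\<^sub>R (s + t)"
      using st by (simp add: scaleR_add_right inverse_eq_divide)
    ultimately have "p (x + y) \<le> s + t" using st by (intro le) auto
    then show "p (x + y) \<le> p x + p y + e" by (simp add: s_def t_def)
  qed
  \<comment> \<open>The phase \<open>c / |c|\<close> is absorbed because \<open>D\<close> is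
    balanced; only the positive factor \<open>|c|\<close> changes the scaling parameter. The reverse
    inequality follows by applying this to \<open>inverse c\<close>.\<close>
  have hom1: "p (cs c x) \<le> cmod c * p x" if c: "c \<in> K" "c \<noteq> 0" for c x
  proof -
    have "p (cs c x) \<le> cmod c * s" if "s > p x" for s
    proof -
      have s: "s > 0" using that nonneg[of x] by linarith
      have m: "complex_of_real (cmod c) \<in> \<real>" by auto
      have "cs (c / of_real (cmod c)) (x /\<^sub>R s) \<in> D"
        using c s that Kdiv[OF c(1) m] less by (intro bal) (auto simp: norm_divide)
      also have "cs (c / of_real (cmod c)) (x /\<^sub>R s) = (cs c x) /\<^sub>R (cmod c * s)"
      proof -
        have r: "of_real (inverse (cmod c * s)) \<in> K" "of_real (inverse s) \<in> K"
          "c / of_real (cmod c) \<in> K"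
          using RK Kdiv[OF c(1) m] by auto
        have "cs (c / of_real (cmod c)) (x /\<^sub>R s) = cs (c / of_real (cmod c) * of_real (inverse s)) x"
          using cs_mult[OF r(3) r(2)] by (simp only: cs_of_real)
        also have "c / of_real (cmod c) * of_real (inverse s) = of_real (inverse (cmod c * s)) * c"
          using c s by (simp add: field_simps)
        also have "cs \<dots> x = (cs c x) /\<^sub>R (cmod c * s)"
          using cs_mult[OF r(1) c(1)] by (simp only: cs_of_real)
        finally show ?thesis .
      qed
      finally show ?thesis using c s by (intro le) auto
    qed
    then have "p (cs c x) / cmod c \<le> s" if "s > p x" for s
      using that c by (simp add: field_simps)
    then have "p (cs c x) / cmod c \<le> p x" by (rule dense_ge)
    then show ?thesis using c by (simp add: field_simps)
  qed
  have hom: "p (cs c x) = cmod c * p x" if c: "c \<in> K" for c x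
  proof (cases "c = 0")
    case True
    have "p 0 \<le> s" if "s > 0" for s using that D(3,4) by (intro le) auto
    then have "p 0 \<le> 0" by (rule dense_ge)
    then show ?thesis using True cs0 nonneg[of 0] by simp
  next
    case False
    have "p x = p (cs (inverse c) (cs c x))"
      using cs_mult[OF Kinv[OF c] c, of x] False cs1 by simp
    also have "\<dots> \<le> cmod (inverse c) * p (cs c x)"
      using Kinv[OF c] False by (intro hom1) auto
    finally have "cmod c * p x \<le> p (cs c x)" using False by (simp add: norm_inverse norm_divide field_simps)
    then show ?thesis using hom1[OF c False, of x] by simp
  qed
  have "(p \<longlongrightarrow> p x) (at x)" for x
  proof (rule tendstoI)
    fix e :: real assume e: "e > 0"
    let ?f = "\<lambda>y. (2 / e) *\<^sub>R (y + - x)"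
    have "continuous_on UNIV ?f"
      by (rule continuous_on_compose2[OF continuous_on_scaleR_right[OF RK] continuous_translation_lcs]) auto
    then have "open (?f -` W)" using D(2) by (intro open_vimage)
    moreover have "x \<in> ?f -` W" using D(3) by simp
    moreover have "dist (p y) (p x) < e" if "y \<in> ?f -` W" for y
    proof -
      have "(y - x) /\<^sub>R (e / 2) \<in> D" using that D(4) by auto
      then have "p (y - x) \<le> e / 2" using e by (intro le) auto
      moreover have "p (x - y) = p (y - x)"
      proof -
        have m: "of_real (- 1) \<in> K" using RK Reals_of_real by (rule subsetD)
        have "p ((- 1) *\<^sub>R (y - x)) = cmod (of_real (- 1)) * p (y - x)"
          using hom[OF m, of "y - x"] unfolding cs_of_real .
        then show ?thesis unfolding norm_of_real by simp
      qed
      ultimately have "p y \<le> e / 2 + p x" "p x \<le> e / 2 + p y"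
        using add[of "y - x" x] add[of "x - y" y] by simp_all
      then show ?thesis using e unfolding dist_real_def by linarith
    qed
    ultimately show "\<forall>\<^sub>F y in at x. dist (p y) (p x) < e"
      unfolding eventually_at_topological by blast
  qed
  then have "continuous_on UNIV p" by (auto simp: continuous_on_def)
  then have "continuous_seminorm K cs p" using add hom by (auto simp: continuous_seminorm_def)
  moreover have "y \<in> U" if "p (y - x0) < 1" for y
    using less[OF that] D(5) by auto
  ultimately show ?thesis using that by blast
qed

lemma seminormed_space:
  assumes K: "K = \<real> \<or> K = UNIV"
  shows "seminormed_space TYPE('a)"
proof
  show "continuous_on UNIV (\<lambda>y::'a. y + x)" for x by (rule continuous_translation_lcs)
  fix U :: "'a set" and x assume "open U" "x \<in> U"
  then obtain p where "continuous_seminorm K cs p" "\<And>y. p (y - x) < 1 \<Longrightarrow> y \<in> U"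
    using minkowski_seminorm[OF K] by blast
  moreover from this have "cseminorm p"
    using K continuous_seminorm_imp_cseminorm[OF locally_convex_space_axioms] by auto
  ultimately show "\<exists>p. cseminorm p \<and> (\<forall>y. p (y - x) < 1 \<longrightarrow> y \<in> U)" by blast
qed

text \<open>The gauge built from the unit ball of \<open>p\<close> lies above \<open>p\<close>. This
  links the hypotheses and definitions stated for K-homogeneous seminorms with the real-homogeneous
  seminorms of the analysis.\<close>

lemma cseminorm_le_continuous_seminorm:
  assumes K: "K = \<real> \<or> K = UNIV" and p: "cseminorm (p :: 'a \<Rightarrow> real)"
  obtains P where "continuous_seminorm K cs P" "\<And>x. p x \<le> P x"
proof -
  have "open {x. p x < 1}"
    using cseminorm_cont[OF p] by (intro open_Collect_less) (auto intro: continuous_intros)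
  moreover have "0 \<in> {x. p x < 1}" by (simp add: cseminorm_zero[OF p])
  ultimately obtain P where P: "continuous_seminorm K cs P" "\<And>y. P (y - 0) < 1 \<Longrightarrow> p y < 1"
    by (rule minkowski_seminorm[OF K]) auto
  have cP: "cseminorm P"
    using P K continuous_seminorm_imp_cseminorm[OF locally_convex_space_axioms] by auto
  have "p x \<le> P x" for x
  proof (rule dense_ge)
    fix s assume s: "P x < s"
    have "s > 0" using s cseminorm_nonneg[OF cP, of x] by linarith
    then have "P (x /\<^sub>R s) < 1" using s by (simp add: cseminorm_scale[OF cP] field_simps)
    then have "p (x /\<^sub>R s) < 1" using P(2) by simp
    then show "p x \<le> s" using \<open>s > 0\<close> by (simp add: cseminorm_scale[OF p] field_simps)
  qed
  then show ?thesis using P(1) that by blast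
qed

end

section \<open>Vector topologies given by seminorms\<close>

text \<open>Relative to a subspace, because a supremum such as \<open>curve_sup p\<close> obeys
  these laws only for curves on which \<open>p\<close> is bounded.\<close>

definition seminorm_on :: "'e::real_vector set \<Rightarrow> ('e \<Rightarrow> real) \<Rightarrow> bool" where
  "seminorm_on S Q \<longleftrightarrow> (\<forall>x\<in>S. \<forall>y\<in>S. Q (x + y) \<le> Q x + Q y) \<and>
     (\<forall>r. \<forall>x\<in>S. Q (r *\<^sub>R x) = \<bar>r\<bar> * Q x)"

lemma seminorm_onD:
  assumes "seminorm_on S Q" "subspace S" "x \<in> S" "y \<in> S"
  shows seminorm_on_add: "Q (x + y) \<le> Q x + Q y"
    and seminorm_on_scale: "Q (r *\<^sub>R x) = \<bar>r\<bar> * Q x"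
    and seminorm_on_nonneg: "0 \<le> Q x"
    and seminorm_on_zero: "Q 0 = 0"
proof -
  show "Q (x + y) \<le> Q x + Q y" "Q (r *\<^sub>R x) = \<bar>r\<bar> * Q x"
    using assms by (auto simp: seminorm_on_def)
  have sc: "Q (- z) = Q z" if "z \<in> S" for z
    using assms(1) that unfolding seminorm_on_def by (metis abs_minus_cancel abs_one mult_1 scaleR_minus1_left)
  show z: "Q 0 = 0" using assms(1) subspace_0[OF assms(2)] unfolding seminorm_on_def
    by (metis abs_0 mult_zero_left scaleR_zero_left)
  have "Q (x + - x) \<le> Q x + Q (- x)" using assms subspace_neg unfolding seminorm_on_def by blast
  then show "0 \<le> Q x" using sc[OF assms(3)] z by simp
qed

lemma seminorm_on_subset: "seminorm_on S Q \<Longrightarrow> S' \<subseteq> S \<Longrightarrow> seminorm_on S' Q"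
  unfolding seminorm_on_def by blast

text \<open>One seminorm per point, with no finite maxima: the families used below are directed,
  since the sum of two continuous seminorms is again one.\<close>

locale seminorm_topology =
  fixes T :: "'e::real_vector topology" and S :: "'e set" and \<Q> :: "('e \<Rightarrow> real) set"
  assumes subspace: "subspace S"
    and nonempty: "\<Q> \<noteq> {}"
    and seminorm: "Q \<in> \<Q> \<Longrightarrow> seminorm_on S Q"
    and openin_iff: "openin T U \<longleftrightarrow>
      U \<subseteq> S \<and> (\<forall>x\<in>U. \<exists>Q\<in>\<Q>. \<exists>e>0. \<forall>y\<in>S. Q (y - x) < e \<longrightarrow> y \<in> U)"
begin

lemma topspace_eq: "topspace T = S"
proof
  show "topspace T \<subseteq> S" using openin_iff[of "topspace T"] by simp
  have "openin T S" using openin_iff nonempty by (auto intro: zero_less_one)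
  then show "S \<subseteq> topspace T" by (rule openin_subset)
qed

lemma openin_ball:
  assumes "Q \<in> \<Q>"
  shows "openin T {y\<in>S. \<exists>x\<in>A. x \<in> S \<and> Q (y - x) < r x}"
  unfolding openin_iff
proof (intro conjI ballI)
  fix y assume "y \<in> {y\<in>S. \<exists>x\<in>A. x \<in> S \<and> Q (y - x) < r x}"
  then obtain x where y: "y \<in> S" "x \<in> A" "x \<in> S" "Q (y - x) < r x" by auto
  have "z \<in> {y\<in>S. \<exists>x\<in>A. x \<in> S \<and> Q (y - x) < r x}" if z: "z \<in> S" "Q (z - y) < r x - Q (y - x)" for z
  proof -
    have "Q ((z - y) + (y - x)) \<le> Q (z - y) + Q (y - x)"
      using y z subspace by (intro seminorm_on_add[OF seminorm[OF assms]]) (auto intro: subspace_diff)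
    then show ?thesis using y z by auto
  qed
  then show "\<exists>Q'\<in>\<Q>. \<exists>e>0. \<forall>z\<in>S. Q' (z - y) < e \<longrightarrow> z \<in> {y\<in>S. \<exists>x\<in>A. x \<in> S \<and> Q (y - x) < r x}"
    using assms y(4) by (intro bexI[of _ Q] exI[of _ "r x - Q (y - x)"]) auto
qed auto

lemma limitin_iff:
  "limitin T f l F \<longleftrightarrow> l \<in> S \<and> (\<forall>\<^sub>F x in F. f x \<in> S) \<and> (\<forall>Q\<in>\<Q>. ((\<lambda>x. Q (f x - l)) \<longlongrightarrow> 0) F)"
proof (intro iffI conjI ballI)
  assume L: "limitin T f l F"
  then show l: "l \<in> S" using limitin_topspace[OF L] topspace_eq by simp
  show ev: "\<forall>\<^sub>F x in F. f x \<in> S"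
    using limitinD[OF L openin_topspace] l topspace_eq by simp
  fix Q assume Q: "Q \<in> \<Q>"
  show "((\<lambda>x. Q (f x - l)) \<longlongrightarrow> 0) F"
  proof (rule tendstoI)
    fix e :: real assume "e > 0"
    then have "l \<in> {y\<in>S. \<exists>x\<in>{l}. x \<in> S \<and> Q (y - x) < e}"
      using l seminorm_on_zero[OF seminorm[OF Q] subspace l l] by simp
    from limitinD[OF L openin_ball[OF Q] this]
    have "\<forall>\<^sub>F x in F. f x \<in> S \<and> Q (f x - l) < e" by (auto elim: eventually_mono)
    then show "\<forall>\<^sub>F x in F. dist (Q (f x - l)) 0 < e"
    proof eventually_elim
      case (elim x)
      then have "Q (f x - l) \<ge> 0"
        using subspace_diff[OF subspace _ l] seminorm_on_nonneg[OF seminorm[OF Q] subspace] by blast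
      then show ?case using elim by simp
    qed
  qed
next
  assume R: "l \<in> S \<and> (\<forall>\<^sub>F x in F. f x \<in> S) \<and> (\<forall>Q\<in>\<Q>. ((\<lambda>x. Q (f x - l)) \<longlongrightarrow> 0) F)"
  show "limitin T f l F"
    unfolding limitin_def
  proof (intro conjI allI impI)
    show "l \<in> topspace T" using R topspace_eq by simp
    fix U assume "openin T U \<and> l \<in> U"
    then obtain Q e where Q: "Q \<in> \<Q>" "e > 0" "\<And>y. y \<in> S \<Longrightarrow> Q (y - l) < e \<Longrightarrow> y \<in> U"
      unfolding openin_iff by meson
    have "\<forall>\<^sub>F x in F. Q (f x - l) < e"
      using R Q by (intro order_tendstoD(2)[of _ 0]) auto
    moreover have "\<forall>\<^sub>F x in F. f x \<in> S" using R by blast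
    ultimately show "\<forall>\<^sub>F x in F. f x \<in> U"
      by eventually_elim (rule Q(3))
  qed
qed

lemma limitin_plus:
  assumes "limitin T f a F" "limitin T g b F"
  shows "limitin T (\<lambda>x. f x + g x) (a + b) F"
  unfolding limitin_iff
proof (intro conjI ballI)
  have ab: "a \<in> S" "b \<in> S" and ev: "\<forall>\<^sub>F x in F. f x \<in> S" "\<forall>\<^sub>F x in F. g x \<in> S"
    using assms by (auto simp: limitin_iff)
  show "a + b \<in> S" using ab subspace by (auto intro: subspace_add)
  show "\<forall>\<^sub>F x in F. f x + g x \<in> S"
    using ev by eventually_elim (use subspace in \<open>auto intro: subspace_add\<close>)
  fix Q assume Q: "Q \<in> \<Q>"
  have "((\<lambda>x. Q (f x - a) + Q (g x - b)) \<longlongrightarrow> 0 + 0) F"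
    using assms Q by (intro tendsto_add) (auto simp: limitin_iff)
  then have lim: "((\<lambda>x. Q (f x - a) + Q (g x - b)) \<longlongrightarrow> 0) F" by simp
  have "\<forall>\<^sub>F x in F. norm (Q (f x + g x - (a + b))) \<le> Q (f x - a) + Q (g x - b)"
    using ev
  proof eventually_elim
    case (elim x)
    then have S: "f x - a \<in> S" "g x - b \<in> S" using ab subspace by (auto intro: subspace_diff)
    from seminorm_onD[OF seminorm[OF Q] subspace this]
      seminorm_on_nonneg[OF seminorm[OF Q] subspace subspace_add[OF subspace S] S(1)]
    show ?case by (simp add: algebra_simps)
  qed
  then show "((\<lambda>x. Q (f x + g x - (a + b))) \<longlongrightarrow> 0) F"
    by (rule Lim_null_comparison[OF _ lim])
qed

lemma limitin_sum_list:
  assumes "\<And>i. i \<in> set is \<Longrightarrow> limitin T (\<lambda>x. f x i) (l i) F"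
  shows "limitin T (\<lambda>x. \<Sum>i\<leftarrow>is. f x i) (\<Sum>i\<leftarrow>is. l i) F"
  using assms
  by (induction "is") (auto simp: topspace_eq subspace_0[OF subspace] intro!: limitin_plus)

lemma seminorm_topology_subtopology:
  assumes "subspace S'" "S' \<subseteq> S"
  shows "seminorm_topology (subtopology T S') S' \<Q>"
proof
  show "subspace S'" "\<Q> \<noteq> {}" by (fact assms(1), fact nonempty)
  show "seminorm_on S' Q" if "Q \<in> \<Q>" for Q using seminorm_on_subset[OF seminorm[OF that] assms(2)] .
  fix U
  show "openin (subtopology T S') U \<longleftrightarrow>
      U \<subseteq> S' \<and> (\<forall>x\<in>U. \<exists>Q\<in>\<Q>. \<exists>e>0. \<forall>y\<in>S'. Q (y - x) < e \<longrightarrow> y \<in> U)" (is "?L \<longleftrightarrow> ?R")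
  proof
    assume ?L
    then obtain V where V: "openin T V" "U = V \<inter> S'" by (auto simp: openin_subtopology)
    have "\<exists>Q\<in>\<Q>. \<exists>e>0. \<forall>y\<in>S'. Q (y - x) < e \<longrightarrow> y \<in> U" if "x \<in> U" for x
    proof -
      obtain Q e where "Q \<in> \<Q>" "e > 0" "\<forall>y\<in>S. Q (y - x) < e \<longrightarrow> y \<in> V"
        using V \<open>x \<in> U\<close> unfolding openin_iff by blast
      then show ?thesis using V assms(2) by (intro bexI[of _ Q] exI[of _ e]) auto
    qed
    then show ?R using V by auto
  next
    assume R: ?R
    \<comment> \<open>The union of all open sets with trace inside \<open>U\<close>; balls around
      the points of \<open>U\<close> show that it recovers all of \<open>U\<close>.\<close>
    define V where "V = \<Union>{W. openin T W \<and> W \<inter> S' \<subseteq> U}"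
    have "openin T V" unfolding V_def by blast
    moreover have "U = V \<inter> S'"
    proof
      show "U \<subseteq> V \<inter> S'"
      proof
        fix x assume x: "x \<in> U"
        then obtain Q e where Q: "Q \<in> \<Q>" "e > 0" "\<forall>y\<in>S'. Q (y - x) < e \<longrightarrow> y \<in> U" using R by blast
        let ?W = "{y\<in>S. \<exists>x\<in>{x}. x \<in> S \<and> Q (y - x) < e}"
        have xS: "x \<in> S" "x \<in> S'" using x R assms(2) by auto
        have "x \<in> ?W" using xS Q(2) seminorm_on_zero[OF seminorm[OF Q(1)] subspace xS(1) xS(1)] by simp
        moreover have "openin T ?W" by (rule openin_ball[OF Q(1)])
        moreover have "?W \<inter> S' \<subseteq> U" using Q(3) by auto
        ultimately show "x \<in> V \<inter> S'" using xS unfolding V_def by blast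
      qed
    qed (auto simp: V_def)
    ultimately show ?L unfolding openin_subtopology by blast
  qed
qed

end

text \<open>Replaces a subbasis of balls for \<open>\<Q>\<close> by balls for an equivalent directed
  family \<open>\<Q>'\<close>: directedness absorbs the finite intersections, the two dominations
  absorb the change of family. It applies to \<open>C_topology\<close>, whose maxima over
  derivatives are inconvenient in limits.\<close>

lemma seminorm_topology_generated:
  assumes S: "subspace S"
    and sub: "\<Q> \<noteq> {}" "\<And>Q. Q \<in> \<Q> \<Longrightarrow> seminorm_on S Q"
    and sub': "\<Q>' \<noteq> {}" "\<And>Q. Q \<in> \<Q>' \<Longrightarrow> seminorm_on S Q"
    and dir: "\<And>P Q. P \<in> \<Q>' \<Longrightarrow> Q \<in> \<Q>' \<Longrightarrow> \<exists>R\<in>\<Q>'. \<forall>x\<in>S. P x \<le> R x \<and> Q x \<le> R x"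
    and dom: "\<And>Q. Q \<in> \<Q> \<Longrightarrow> \<exists>P\<in>\<Q>'. \<forall>x\<in>S. Q x \<le> P x"
    and dom': "\<And>P. P \<in> \<Q>' \<Longrightarrow> \<exists>Q\<in>\<Q>. \<forall>x\<in>S. P x \<le> Q x"
    and T: "T = topology_generated_by {{y\<in>S. Q (y - x) < e} |x Q e. x \<in> S \<and> Q \<in> \<Q> \<and> e > 0}"
      (is "T = topology_generated_by ?B")
  shows "seminorm_topology T S \<Q>'"
proof
  show "subspace S" "\<Q>' \<noteq> {}" by fact+
  show "seminorm_on S Q" if "Q \<in> \<Q>'" for Q using sub'(2)[OF that] .
  let ?P = "\<lambda>U. U \<subseteq> S \<and> (\<forall>x\<in>U. \<exists>Q\<in>\<Q>'. \<exists>e>0. \<forall>y\<in>S. Q (y - x) < e \<longrightarrow> y \<in> U)"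
  fix U
  show "openin T U \<longleftrightarrow> ?P U"
  proof
    assume "openin T U"
    then have "generate_topology_on ?B U" unfolding T by (rule openin_topology_generated_by)
    then show "?P U"
    proof induction
      case Empty
      then show ?case by simp
    next
      case (Int a b)
      have "\<exists>Q\<in>\<Q>'. \<exists>e>0. \<forall>y\<in>S. Q (y - x) < e \<longrightarrow> y \<in> a \<inter> b" if x: "x \<in> a \<inter> b" for x
      proof -
        obtain P d where P: "P \<in> \<Q>'" "d > 0" "\<forall>y\<in>S. P (y - x) < d \<longrightarrow> y \<in> a"
          using bspec[OF conjunct2[OF Int.IH(1)], of x] x by blast
        obtain Q e where Q: "Q \<in> \<Q>'" "e > 0" "\<forall>y\<in>S. Q (y - x) < e \<longrightarrow> y \<in> b"
          using bspec[OF conjunct2[OF Int.IH(2)], of x] x by blast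
        obtain R where R: "R \<in> \<Q>'" "\<forall>x\<in>S. P x \<le> R x \<and> Q x \<le> R x" using dir P(1) Q(1) by blast
        have xS: "x \<in> S" using x Int.IH by blast
        have "y \<in> a \<inter> b" if "y \<in> S" "R (y - x) < min d e" for y
        proof -
          have "P (y - x) \<le> R (y - x) \<and> Q (y - x) \<le> R (y - x)"
            using R(2) subspace_diff[OF S that(1) xS] by blast
          then show ?thesis using P(3) Q(3) that by auto
        qed
        then show ?thesis using R(1) P(2) Q(2)
          by (intro bexI[of _ R] exI[of _ "min d e"]) auto
      qed
      then show ?case using Int.IH by blast
    next
      case (UN K)
      have "\<exists>Q\<in>\<Q>'. \<exists>e>0. \<forall>y\<in>S. Q (y - x) < e \<longrightarrow> y \<in> \<Union>K" if "x \<in> \<Union>K" for x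
      proof -
        obtain k where k: "k \<in> K" "x \<in> k" using \<open>x \<in> \<Union>K\<close> by blast
        then obtain Q e where "Q \<in> \<Q>'" "e > 0" "\<forall>y\<in>S. Q (y - x) < e \<longrightarrow> y \<in> k"
          using UN.IH by blast
        then show ?thesis using k by (intro bexI[of _ Q] exI[of _ e]) auto
      qed
      then show ?case using UN.IH by blast
    next
      case (Basis s)
      then obtain x Q e where s: "s = {y\<in>S. Q (y - x) < e}" "x \<in> S" "Q \<in> \<Q>" "e > 0" by auto
      have "\<exists>P\<in>\<Q>'. \<exists>e>0. \<forall>z\<in>S. P (z - y) < e \<longrightarrow> z \<in> s" if "y \<in> s" for y
      proof -
        obtain P where P: "P \<in> \<Q>'" "\<forall>x\<in>S. Q x \<le> P x" using dom s(3) by blast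
        have "z \<in> s" if z: "z \<in> S" "P (z - y) < e - Q (y - x)" for z
        proof -
          have yS: "y \<in> S" using \<open>y \<in> s\<close> s by auto
          have "Q ((z - y) + (y - x)) \<le> Q (z - y) + Q (y - x)"
            using s z S yS by (intro seminorm_on_add[OF sub(2)]) (auto intro: subspace_diff)
          moreover have "Q (z - y) \<le> P (z - y)" using P(2) subspace_diff[OF S z(1) yS] by blast
          ultimately show ?thesis using s z by auto
        qed
        then show ?thesis using P(1) that s by (intro bexI[of _ P] exI[of _ "e - Q (y - x)"]) auto
      qed
      then show ?case using s by blast
    qed
  next
    assume P: "?P U"
    have "\<exists>V. openin T V \<and> x \<in> V \<and> V \<subseteq> U" if x: "x \<in> U" for x
    proof -
      obtain P e where Pe: "P \<in> \<Q>'" "e > 0" "\<forall>y\<in>S. P (y - x) < e \<longrightarrow> y \<in> U" using P x by blast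
      obtain Q where Q: "Q \<in> \<Q>" "\<forall>x\<in>S. P x \<le> Q x" using dom' Pe(1) by blast
      have xS: "x \<in> S" using x P by blast
      let ?V = "{y\<in>S. Q (y - x) < e}"
      have "?V \<in> ?B" using xS Q Pe by blast
      then have "openin T ?V" unfolding T by (rule topology_generated_by_Basis)
      moreover have "x \<in> ?V" using xS Pe(2) seminorm_on_zero[OF sub(2)[OF Q(1)] S xS xS] by simp
      moreover have "?V \<subseteq> U"
      proof
        fix y assume y: "y \<in> ?V"
        then have "P (y - x) \<le> Q (y - x)" using Q(2) subspace_diff[OF S _ xS] by blast
        then show "y \<in> U" using y Pe(3) by auto
      qed
      ultimately show ?thesis by blast
    qed
    then show "openin T U" by (subst openin_subopen) blast
  qed
qed


section \<open>Curves\<close>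

context seminormed_space
begin

lemma seminorm_topology_euclidean: "seminorm_topology (euclidean :: 'b topology) UNIV {p. cseminorm p}"
proof
  show "subspace (UNIV :: 'b set)" by simp
  show "{p :: 'b \<Rightarrow> real. cseminorm p} \<noteq> {}" using cseminorm_null by blast
  show "seminorm_on UNIV p" if "p \<in> {p :: 'b \<Rightarrow> real. cseminorm p}" for p
    using that by (auto simp: seminorm_on_def cseminorm_def)
  fix U :: "'b set"
  show "openin euclidean U \<longleftrightarrow>
    U \<subseteq> UNIV \<and> (\<forall>x\<in>U. \<exists>p\<in>{p. cseminorm p}. \<exists>e>0. \<forall>y\<in>UNIV. p (y - x) < e \<longrightarrow> y \<in> U)"
  proof
    assume "openin euclidean U"
    then show "U \<subseteq> UNIV \<and> (\<forall>x\<in>U. \<exists>p\<in>{p. cseminorm p}. \<exists>e>0. \<forall>y\<in>UNIV. p (y - x) < e \<longrightarrow> y \<in> U)"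
      using open_contains_seminorm_ball[of U] zero_less_one by (auto, blast)
  next
    assume R: "U \<subseteq> UNIV \<and> (\<forall>x\<in>U. \<exists>p\<in>{p. cseminorm p}. \<exists>e>0. \<forall>y\<in>UNIV. p (y - x) < e \<longrightarrow> y \<in> U)"
    have "\<exists>V. open V \<and> x \<in> V \<and> V \<subseteq> U" if x: "x \<in> U" for x
    proof -
      obtain p e where p: "cseminorm p" "e > 0" "\<forall>y. p (y - x) < e \<longrightarrow> y \<in> U" using R x by auto
      then show ?thesis using open_cseminorm_ball[OF p(1), of x e]
        by (intro exI[of _ "{y. p (y - x) < e}"]) (auto simp: cseminorm_zero[OF p(1)])
    qed
    then show "openin euclidean U" unfolding open_openin[symmetric] by (subst open_subopen) blast
  qed
qed

text \<open>Without division the estimate also holds at \<open>s = t\<close>, so it combines with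
  triangle inequalities without case distinctions.\<close>

lemma has_curve_deriv_iff:
  fixes f :: "real \<Rightarrow> 'b"
  shows "has_curve_deriv f v t \<longleftrightarrow>
    (\<forall>p e. cseminorm p \<and> e > 0 \<longrightarrow>
      (\<exists>d>0. \<forall>s\<in>{0..1}. \<bar>s - t\<bar> < d \<longrightarrow> p (f s - f t - (s - t) *\<^sub>R v) \<le> e * \<bar>s - t\<bar>))"
    (is "?L \<longleftrightarrow> ?R")
proof -
  have key: "p (f s - f t - (s - t) *\<^sub>R v) = \<bar>s - t\<bar> * p ((f s - f t) /\<^sub>R (s - t) - v)"
    if p: "cseminorm p" and "s \<noteq> t" for p s
  proof -
    have "f s - f t - (s - t) *\<^sub>R v = (s - t) *\<^sub>R ((f s - f t) /\<^sub>R (s - t) - v)"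
      using that by (simp add: scaleR_diff_right)
    then show ?thesis using cseminorm_scale[OF p] by simp
  qed
  have "?L \<longleftrightarrow> (\<forall>p e. cseminorm p \<and> e > 0 \<longrightarrow>
      (\<exists>d>0. \<forall>s\<in>{0..1}. s \<noteq> t \<and> \<bar>s - t\<bar> < d \<longrightarrow> p ((f s - f t) /\<^sub>R (s - t) - v) < e))"
    unfolding has_curve_deriv_def tendsto_iff_cseminorm tendsto_iff eventually_at
    by (auto simp: dist_real_def cseminorm_nonneg)
  also have "\<dots> \<longleftrightarrow> ?R"
  proof (intro iffI allI impI)
    fix p e assume L: "\<forall>p e. cseminorm p \<and> e > 0 \<longrightarrow>
      (\<exists>d>0. \<forall>s\<in>{0..1}. s \<noteq> t \<and> \<bar>s - t\<bar> < d \<longrightarrow> p ((f s - f t) /\<^sub>R (s - t) - v) < e)"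
      and p: "cseminorm (p :: 'b \<Rightarrow> real) \<and> (e::real) > 0"
    then obtain d where d: "d > 0"
      "\<And>s. s \<in> {0..1} \<Longrightarrow> s \<noteq> t \<Longrightarrow> \<bar>s - t\<bar> < d \<Longrightarrow> p ((f s - f t) /\<^sub>R (s - t) - v) < e"
      by blast
    have "p (f s - f t - (s - t) *\<^sub>R v) \<le> e * \<bar>s - t\<bar>" if "s \<in> {0..1}" "\<bar>s - t\<bar> < d" for s
    proof (cases "s = t")
      case True
      then show ?thesis using p by (simp add: cseminorm_zero)
    next
      case False
      then show ?thesis using d(2)[OF that(1) False that(2)] key[of p s] p
        by (simp add: mult.commute mult_left_mono)
    qed
    then show "\<exists>d>0. \<forall>s\<in>{0..1}. \<bar>s - t\<bar> < d \<longrightarrow> p (f s - f t - (s - t) *\<^sub>R v) \<le> e * \<bar>s - t\<bar>"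
      using d(1) by blast
  next
    fix p e assume R: ?R and p: "cseminorm (p :: 'b \<Rightarrow> real) \<and> (e::real) > 0"
    then have "cseminorm p \<and> e / 2 > 0" by simp
    then obtain d where d: "d > 0"
      "\<And>s. s \<in> {0..1} \<Longrightarrow> \<bar>s - t\<bar> < d \<Longrightarrow> p (f s - f t - (s - t) *\<^sub>R v) \<le> e / 2 * \<bar>s - t\<bar>"
      using R by blast
    have "p ((f s - f t) /\<^sub>R (s - t) - v) < e" if "s \<in> {0..1}" "s \<noteq> t" "\<bar>s - t\<bar> < d" for s
    proof -
      have "\<bar>s - t\<bar> * p ((f s - f t) /\<^sub>R (s - t) - v) \<le> \<bar>s - t\<bar> * (e / 2)"
        using d(2)[OF that(1,3)] key[of p s] p that by (simp add: mult.commute)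
      then have "p ((f s - f t) /\<^sub>R (s - t) - v) \<le> e / 2"
        using that(2) by (subst (asm) mult_le_cancel_left_pos) auto
      then show ?thesis using p by linarith
    qed
    then show "\<exists>d>0. \<forall>s\<in>{0..1}. s \<noteq> t \<and> \<bar>s - t\<bar> < d \<longrightarrow> p ((f s - f t) /\<^sub>R (s - t) - v) < e"
      using d(1) by blast
  qed
  finally show ?thesis .
qed

lemma has_curve_deriv_unique:
  fixes f :: "real \<Rightarrow> 'b"
  assumes "has_curve_deriv f v t" "has_curve_deriv f w t" "t \<in> {0..1}"
  shows "v = w"
proof -
  have "at t within {0..1} \<noteq> bot" using assms(3) by (simp add: trivial_limit_within)
  then show ?thesis
    using assms(1,2) tendsto_unique unfolding has_curve_deriv_def by blast
qed

lemma curve_deriv_eq: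
  fixes f :: "real \<Rightarrow> 'b"
  assumes "has_curve_deriv f v t" "t \<in> {0..1}"
  shows "curve_deriv f t = v"
proof -
  have "(THE v. has_curve_deriv f v t) = v"
    using assms(1) has_curve_deriv_unique[OF _ assms] by (rule the_equality)
  then show ?thesis using assms(2) unfolding curve_deriv_def by (simp only: if_True)
qed

lemma curve_deriv_outside: "t \<notin> {0..1} \<Longrightarrow> curve_deriv f t = 0"
  unfolding curve_deriv_def by (rule if_not_P)

lemma has_curve_deriv_add:
  fixes f g :: "real \<Rightarrow> 'b"
  assumes "has_curve_deriv f v t" "has_curve_deriv g w t"
  shows "has_curve_deriv (\<lambda>s. f s + g s) (v + w) t"
proof -
  have eq: "(f s + g s - (f t + g t)) /\<^sub>R (s - t) = (f s - f t) /\<^sub>R (s - t) + (g s - g t) /\<^sub>R (s - t)" for s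
    by (simp add: algebra_simps flip: scaleR_add_right)
  show ?thesis
    using tendsto_add_seminormed[OF assms[unfolded has_curve_deriv_def]]
    unfolding has_curve_deriv_def eq .
qed

lemma has_curve_deriv_linear:
  fixes f :: "real \<Rightarrow> 'b" and L :: "'b \<Rightarrow> 'c::{real_vector,t2_space}"
  assumes "has_curve_deriv f v t" "linear L" "continuous_on UNIV L"
  shows "has_curve_deriv (\<lambda>s. L (f s)) (L v) t"
proof -
  have "isCont L v" using assms(3) by (simp add: continuous_on_eq_continuous_at)
  from isCont_tendsto_compose[OF this assms(1)[unfolded has_curve_deriv_def]]
  show ?thesis unfolding has_curve_deriv_def
    by (simp add: linear_scale[OF assms(2)] linear_diff[OF assms(2)])
qed

lemma continuous_on_scaleR_seminormed: "continuous_on UNIV (\<lambda>x::'b. r *\<^sub>R x)"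
  by (auto simp: continuous_on_def intro!: tendsto_scaleR_seminormed tendsto_ident_at)

lemma has_curve_deriv_scaleR:
  fixes f :: "real \<Rightarrow> 'b"
  assumes "has_curve_deriv f v t"
  shows "has_curve_deriv (\<lambda>s. r *\<^sub>R f s) (r *\<^sub>R v) t"
  by (rule has_curve_deriv_linear[OF assms _ continuous_on_scaleR_seminormed])
     (simp add: linear_iff scaleR_add_right)

lemma has_curve_deriv_diff:
  fixes f g :: "real \<Rightarrow> 'b"
  assumes "has_curve_deriv f v t" "has_curve_deriv g w t"
  shows "has_curve_deriv (\<lambda>s. f s - g s) (v - w) t"
  using has_curve_deriv_add[OF assms(1) has_curve_deriv_scaleR[OF assms(2), of "-1"]] by simp

lemma has_curve_deriv_const: "has_curve_deriv (\<lambda>_. c::'b) 0 t"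
  by (simp add: has_curve_deriv_def)

lemma has_curve_deriv_real_scaleR:
  assumes "(\<phi> has_real_derivative d) (at t)"
  shows "has_curve_deriv (\<lambda>s. \<phi> s *\<^sub>R (v::'b)) (d *\<^sub>R v) t"
  unfolding has_curve_deriv_def tendsto_iff_cseminorm
proof (intro allI impI)
  fix p :: "'b \<Rightarrow> real" assume p: "cseminorm p"
  have "((\<lambda>s. (\<phi> s - \<phi> t) / (s - t)) \<longlongrightarrow> d) (at t)"
    using assms by (simp add: has_field_derivative_iff)
  then have "((\<lambda>s. (\<phi> s - \<phi> t) / (s - t)) \<longlongrightarrow> d) (at t within {0..1})"
    by (rule tendsto_within_subset) simp
  then have "((\<lambda>s. \<bar>(\<phi> s - \<phi> t) / (s - t) - d\<bar> * p v) \<longlongrightarrow> \<bar>d - d\<bar> * p v) (at t within {0..1})"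
    by (intro tendsto_intros)
  moreover have "p ((\<phi> s *\<^sub>R v - \<phi> t *\<^sub>R v) /\<^sub>R (s - t) - d *\<^sub>R v) = \<bar>(\<phi> s - \<phi> t) / (s - t) - d\<bar> * p v" for s
  proof -
    have "(\<phi> s *\<^sub>R v - \<phi> t *\<^sub>R v) /\<^sub>R (s - t) - d *\<^sub>R v = ((\<phi> s - \<phi> t) / (s - t) - d) *\<^sub>R v"
      by (simp add: divide_inverse algebra_simps)
    then show ?thesis using cseminorm_scale[OF p] by simp
  qed
  ultimately show "((\<lambda>s. p ((\<phi> s *\<^sub>R v - \<phi> t *\<^sub>R v) /\<^sub>R (s - t) - d *\<^sub>R v)) \<longlongrightarrow> 0) (at t within {0..1})"
    by simp
qed

lemma has_curve_deriv_cong: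
  assumes "has_curve_deriv f v t" "\<And>s. s \<in> {0..1} \<Longrightarrow> f s = g s" "t \<in> {0..1}"
  shows "has_curve_deriv g v t"
proof -
  have "\<forall>\<^sub>F s in at t within {0..1}. (f s - f t) /\<^sub>R (s - t) = (g s - g t) /\<^sub>R (s - t)"
    using assms(2,3) by (auto simp: eventually_at_filter)
  from tendsto_cong[OF this] show ?thesis using assms(1) unfolding has_curve_deriv_def by blast
qed

lemma has_curve_deriv_imp_continuous_on:
  fixes f :: "real \<Rightarrow> 'b"
  assumes "\<And>t. t \<in> {0..1} \<Longrightarrow> has_curve_deriv f (g t) t"
  shows "continuous_on {0..1} f"
  unfolding continuous_on_curve_iff
proof (intro ballI allI impI)
  fix t p e assume t: "t \<in> {0..1::real}" and pe: "cseminorm (p::'b \<Rightarrow> real) \<and> (e::real) > 0"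
  then have p: "cseminorm p" and e: "e > 0" by auto
  obtain d where d: "d > 0"
    "\<And>s. s \<in> {0..1} \<Longrightarrow> \<bar>s - t\<bar> < d \<Longrightarrow> p (f s - f t - (s - t) *\<^sub>R g t) \<le> 1 * \<bar>s - t\<bar>"
    using assms[OF t] p unfolding has_curve_deriv_iff by (metis zero_less_one)
  define c where "c = 1 + p (g t)"
  have c: "c > 0" using cseminorm_nonneg[OF p, of "g t"] by (simp add: c_def)
  have "p (f s - f t) < e" if s: "s \<in> {0..1}" "\<bar>s - t\<bar> < min d (e / c)" for s
  proof -
    have "p (f s - f t) \<le> p (f s - f t - (s - t) *\<^sub>R g t) + p ((s - t) *\<^sub>R g t)"
      using cseminorm_add[OF p, of "f s - f t - (s - t) *\<^sub>R g t" "(s - t) *\<^sub>R g t"] by simp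
    also have "\<dots> \<le> c * \<bar>s - t\<bar>"
      using d(2)[of s] s cseminorm_scale[OF p, of "s - t" "g t"]
      by (simp add: c_def distrib_right)
    also have "\<dots> < e" using s c by (simp add: field_simps)
    finally show ?thesis .
  qed
  moreover have "min d (e / c) > 0" using d(1) e c by simp
  ultimately show "\<exists>d>0. \<forall>y\<in>{0..1}. \<bar>y - t\<bar> < d \<longrightarrow> p (f y - f t) < e" by blast
qed

text \<open>Replaces integrating \<open>f'\<close>, which might have no integral. Near a point the
  claim holds with an error proportional to the length; such errors add up over adjacent intervals,
  so \<open>Bolzano\<close> spreads the estimate to \<open>{a..b}\<close>.\<close>

lemma curve_mean_value_bound:
  fixes f :: "real \<Rightarrow> 'b"
  assumes p: "cseminorm p" and ab: "a \<le> b" "{a..b} \<subseteq> {0..1}"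
    and f: "\<And>u. u \<in> {a..b} \<Longrightarrow> has_curve_deriv f (f' u) u"
    and \<phi>: "\<And>u. u \<in> {a..b} \<Longrightarrow> (\<phi> has_real_derivative \<phi>' u) (at u)"
    and le: "\<And>u. u \<in> {a..b} \<Longrightarrow> p (f' u) \<le> \<phi>' u"
  shows "p (f b - f a) \<le> \<phi> b - \<phi> a"
proof (rule field_le_epsilon)
  fix e :: real assume e: "e > 0"
  \<comment> \<open>Twice \<open>e2\<close> times the length of the interval does not exceed
    \<open>e\<close>; the summand 1 keeps the denominator positive when
    \<open>a = b\<close>.\<close>
  define e2 where "e2 = e / (2 * (b - a + 1))"
  have e2: "e2 > 0" using e ab by (simp add: e2_def)
  define P where "P u v \<longleftrightarrow> (a \<le> u \<and> u \<le> v \<and> v \<le> b \<longrightarrow>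
    p (f v - f u) \<le> \<phi> v - \<phi> u + 2 * e2 * (v - u))" for u v
  have "P a b" using ab(1)
  proof (induction rule: Bolzano)
    case (trans u v w)
    then show ?case using cseminorm_triangle[OF p, of "f w" "f u" "f v"]
      by (auto simp: P_def algebra_simps)
  next
    case (local x)
    then have x: "x \<in> {a..b}" by simp
    obtain d where d: "d > 0"
      "\<And>s. s \<in> {0..1} \<Longrightarrow> \<bar>s - x\<bar> < d \<Longrightarrow> p (f s - f x - (s - x) *\<^sub>R f' x) \<le> e2 * \<bar>s - x\<bar>"
      using f[OF x] p e2 unfolding has_curve_deriv_iff by meson
    have "((\<lambda>s. (\<phi> s - \<phi> x) / (s - x)) \<longlongrightarrow> \<phi>' x) (at x)"
      using \<phi>[OF x] by (simp add: has_field_derivative_iff)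
    then obtain d' where d': "d' > 0"
      "\<And>s. s \<noteq> x \<Longrightarrow> \<bar>s - x\<bar> < d' \<Longrightarrow> \<bar>(\<phi> s - \<phi> x) / (s - x) - \<phi>' x\<bar> < e2"
      using e2 unfolding LIM_def by (auto simp: dist_real_def)
    have 1: "p (f s - f x) \<le> \<bar>s - x\<bar> * \<phi>' x + e2 * \<bar>s - x\<bar>" if "s \<in> {a..b}" "\<bar>s - x\<bar> < d" for s
    proof -
      have "p (f s - f x) \<le> p (f s - f x - (s - x) *\<^sub>R f' x) + p ((s - x) *\<^sub>R f' x)"
        using cseminorm_add[OF p, of "f s - f x - (s - x) *\<^sub>R f' x" "(s - x) *\<^sub>R f' x"] by simp
      also have "\<dots> \<le> e2 * \<bar>s - x\<bar> + \<bar>s - x\<bar> * \<phi>' x"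
        using d(2)[of s] that ab(2) le[OF x]
        by (intro add_mono) (auto simp: cseminorm_scale[OF p] mult_left_mono)
      finally show ?thesis by simp
    qed
    have 2: "\<bar>\<phi> s - \<phi> x - (s - x) * \<phi>' x\<bar> \<le> e2 * \<bar>s - x\<bar>" if "\<bar>s - x\<bar> < d'" for s
    proof (cases "s = x")
      case False
      have "\<phi> s - \<phi> x - (s - x) * \<phi>' x = (s - x) * ((\<phi> s - \<phi> x) / (s - x) - \<phi>' x)"
        using False by (simp add: field_simps)
      also have "\<bar>\<dots>\<bar> \<le> \<bar>s - x\<bar> * e2"
        using d'(2)[OF False that] unfolding abs_mult by (intro mult_left_mono) auto
      finally show ?thesis by (simp add: mult.commute)
    qed simp
    have "p (f v - f u) \<le> \<phi> v - \<phi> u + 2 * e2 * (v - u)"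
      if uv: "u \<le> x" "x \<le> v" "v - u < min d d'" "a \<le> u" "v \<le> b" for u v
    proof -
      have "p (f v - f u) \<le> p (f v - f x) + p (f u - f x)"
        using cseminorm_triangle[OF p, of "f v" "f u" "f x"] cseminorm_commute[OF p, of "f x" "f u"] by simp
      also have "\<dots> \<le> ((v - x) * \<phi>' x + e2 * (v - x)) + ((x - u) * \<phi>' x + e2 * (x - u))"
        using 1[of v] 1[of u] uv by (intro add_mono) auto
      also have "(v - x) * \<phi>' x \<le> \<phi> v - \<phi> x + e2 * (v - x)"
        using 2[of v] uv by (simp add: abs_le_iff)
      also have "(x - u) * \<phi>' x \<le> \<phi> x - \<phi> u + e2 * (x - u)"
        using 2[of u] uv by (simp add: abs_le_iff algebra_simps)
      finally show ?thesis by (simp add: algebra_simps)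
    qed
    then show ?case using d(1) d'(1) unfolding P_def by (intro exI[of _ "min d d'"]) auto
  qed
  moreover have "2 * e2 * (b - a) \<le> e" using ab e by (simp add: e2_def field_simps)
  ultimately show "p (f b - f a) \<le> \<phi> b - \<phi> a + e" using ab by (auto simp: P_def)
qed

text \<open>The mean value bound for \<open>f u - u *\<^sub>R v\<close> with a linear majorant. With
  \<open>v = 0\<close> it is a Lipschitz estimate; with \<open>v\<close> the derivative at
  \<open>t\<close> it is the estimate of \<open>has_curve_deriv_iff\<close>.\<close>

lemma curve_lipschitz_bound:
  fixes f :: "real \<Rightarrow> 'b"
  assumes p: "cseminorm p" and st: "s \<in> {0..1}" "t \<in> {0..1}"
    and f: "\<And>u. u \<in> {min s t..max s t} \<Longrightarrow> has_curve_deriv f (f' u) u"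
    and le: "\<And>u. u \<in> {min s t..max s t} \<Longrightarrow> p (f' u - v) \<le> c"
  shows "p (f s - f t - (s - t) *\<^sub>R v) \<le> c * \<bar>s - t\<bar>"
proof -
  let ?g = "\<lambda>u. f u - u *\<^sub>R v"
  have "p (?g (max s t) - ?g (min s t)) \<le> c * max s t - c * min s t"
  proof (rule curve_mean_value_bound[OF p, where f' = "\<lambda>u. f' u - v" and \<phi>' = "\<lambda>_. c"])
    fix u assume u: "u \<in> {min s t..max s t}"
    have "((\<lambda>u. u) has_real_derivative 1) (at u)" by (rule DERIV_ident)
    from has_curve_deriv_real_scaleR[OF this, of v] has_curve_deriv_diff[OF f[OF u]]
    show "has_curve_deriv ?g (f' u - v) u" by force
    show "((\<lambda>u. c * u) has_real_derivative c) (at u)"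
      by (auto intro!: derivative_eq_intros)
    show "p (f' u - v) \<le> c" by (rule le[OF u])
  qed (use st in auto)
  moreover have "p (?g (max s t) - ?g (min s t)) = p (f s - f t - (s - t) *\<^sub>R v)"
  proof (cases "t \<le> s")
    case True
    then show ?thesis by (simp add: max_def min_def algebra_simps)
  next
    case False
    then show ?thesis
      using cseminorm_commute[OF p, of "?g s" "?g t"] by (simp add: max_def min_def algebra_simps)
  qed
  ultimately show ?thesis by (auto simp: max_def min_def abs_if algebra_simps split: if_splits)
qed

lemma curve_eq_if_deriv_eq:
  fixes f g :: "real \<Rightarrow> 'b"
  assumes st: "s \<in> {0..1}" "t \<in> {0..1}"
    and f: "\<And>u. u \<in> {min s t..max s t} \<Longrightarrow> has_curve_deriv f (h u) u"
    and g: "\<And>u. u \<in> {min s t..max s t} \<Longrightarrow> has_curve_deriv g (h u) u"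
  shows "f s - f t = g s - g t"
proof -
  have "(f s - g s) - (f t - g t) = 0"
  proof (rule eq_zero_if_cseminorm_le)
    fix p :: "'b \<Rightarrow> real" assume p: "cseminorm p"
    have "p ((f s - g s) - (f t - g t) - (s - t) *\<^sub>R 0) \<le> 0 * \<bar>s - t\<bar>"
      by (rule curve_lipschitz_bound[OF p st, where f' = "\<lambda>u. h u - h u"])
         (use has_curve_deriv_diff[OF f g] in \<open>auto simp: cseminorm_zero[OF p]\<close>)
    then show "p ((f s - g s) - (f t - g t)) \<le> 0" by simp
  qed
  then show ?thesis by (simp add: algebra_simps)
qed

text \<open>Near \<open>t\<close> the derivatives \<open>f' n\<close> are within \<open>e\<close> of
  \<open>g' t\<close> for all large \<open>n\<close>. Hence \<open>curve_lipschitz_bound\<close>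
  holds for \<open>f n\<close> with one radius for all such \<open>n\<close> and survives the
  pointwise limit.\<close>

lemma has_curve_deriv_limit:
  fixes f :: "nat \<Rightarrow> real \<Rightarrow> 'b"
  assumes f: "\<And>n t. t \<in> {0..1} \<Longrightarrow> has_curve_deriv (f n) (f' n t) t"
    and lim: "\<And>t. t \<in> {0..1} \<Longrightarrow> (\<lambda>n. f n t) \<longlonglongrightarrow> g t"
    and unif: "\<And>p e. cseminorm p \<Longrightarrow> e > 0 \<Longrightarrow>
      \<forall>\<^sub>F n in sequentially. \<forall>t\<in>{0..1}. p (f' n t - g' t) \<le> e"
    and cont: "continuous_on {0..1} g'" and t: "t \<in> {0..1}"
  shows "has_curve_deriv g (g' t) t"
  unfolding has_curve_deriv_iff
proof (intro allI impI)
  fix p e assume "cseminorm (p::'b \<Rightarrow> real) \<and> (e::real) > 0"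
  then have p: "cseminorm p" and e: "e / 2 > 0" by auto
  obtain d where d: "d > 0" "\<And>s. s \<in> {0..1} \<Longrightarrow> \<bar>s - t\<bar> < d \<Longrightarrow> p (g' s - g' t) < e / 2"
    using cont t p e unfolding continuous_on_curve_iff by meson
  have "p (g s - g t - (s - t) *\<^sub>R g' t) \<le> e * \<bar>s - t\<bar>" if s: "s \<in> {0..1}" "\<bar>s - t\<bar> < d" for s
  proof (rule tendsto_upperbound)
    have "(\<lambda>n. (f n s + (-1) *\<^sub>R f n t) + (- ((s - t) *\<^sub>R g' t))) \<longlonglongrightarrow> (g s + (-1) *\<^sub>R g t) + (- ((s - t) *\<^sub>R g' t))"
      using lim s t by (intro tendsto_add_seminormed tendsto_scaleR_seminormed tendsto_const) auto
    from tendsto_cseminorm_comp[OF this p]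
    show "(\<lambda>n. p (f n s - f n t - (s - t) *\<^sub>R g' t)) \<longlonglongrightarrow> p (g s - g t - (s - t) *\<^sub>R g' t)" by simp
    show "\<forall>\<^sub>F n in sequentially. p (f n s - f n t - (s - t) *\<^sub>R g' t) \<le> e * \<bar>s - t\<bar>"
      using unif[OF p e]
    proof eventually_elim
      case (elim n)
      show ?case
      proof (rule curve_lipschitz_bound[OF p s(1) t, of "f n" "f' n"])
        fix u assume u: "u \<in> {min s t..max s t}"
        then have u01: "u \<in> {0..1}" and ud: "\<bar>u - t\<bar> < d" using s t by auto
        show "has_curve_deriv (f n) (f' n u) u" by (rule f[OF u01])
        have "p (f' n u - g' u) \<le> e / 2" using elim u01 by blast
        then show "p (f' n u - g' t) \<le> e"
          using cseminorm_triangle[OF p, of "f' n u" "g' t" "g' u"] d(2)[OF u01 ud] by linarith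
      qed
    qed
  qed simp
  then show "\<exists>d>0. \<forall>s\<in>{0..1}. \<bar>s - t\<bar> < d \<longrightarrow> p (g s - g t - (s - t) *\<^sub>R g' t) \<le> e * \<bar>s - t\<bar>"
    using d(1) by blast
qed

end

section \<open>Seminorms on spaces of continuous, Lipschitz and continuously differentiable
  curves\<close>

definition curve_sup :: "('b \<Rightarrow> real) \<Rightarrow> (real \<Rightarrow> 'b) \<Rightarrow> real" where
  "curve_sup p \<gamma> = (SUP t\<in>{0..1}. p (\<gamma> t))"

text \<open>A sum instead of the maximum in \<open>curve_seminorm 1 p\<close>: it induces the same
  topology and splits into two separate limits.\<close>

definition curve_sup1 :: "('b \<Rightarrow> real) \<Rightarrow> (real \<Rightarrow> 'b::{real_vector,t2_space}) \<Rightarrow> real" where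
  "curve_sup1 p \<gamma> = curve_sup p \<gamma> + curve_sup p (curve_deriv \<gamma>)"

text \<open>The form of \<open>Lip K cs\<close> that mentions no scalars of K, so that it also
  applies to curves in the complexification.\<close>

definition lipschitz_curves :: "(real \<Rightarrow> 'b::{real_vector,t2_space}) set" where
  "lipschitz_curves = {\<gamma>. (\<forall>t. t \<notin> {0..1} \<longrightarrow> \<gamma> t = 0) \<and>
     (\<forall>p. cseminorm p \<longrightarrow> (\<exists>L. \<forall>s\<in>{0..1}. \<forall>t\<in>{0..1}. p (\<gamma> t - \<gamma> s) \<le> L * \<bar>t - s\<bar>))}"

lemma C_curves_0_iff:
  "\<gamma> \<in> C_curves 0 \<longleftrightarrow> (\<forall>t. t \<notin> {0..1} \<longrightarrow> \<gamma> t = 0) \<and> continuous_on {0..1} \<gamma>"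
  by (auto simp: C_curves_def zero_enat_def)

lemma C_curves_outside: "\<gamma> \<in> C_curves r \<Longrightarrow> t \<notin> {0..1} \<Longrightarrow> \<gamma> t = 0"
  by (simp add: C_curves_def)

lemma C_curves_infinity_subset: "C_curves \<infinity> \<subseteq> C_curves 1"
  by (auto simp: C_curves_def)

lemma curve_sup_least: "(\<And>t. t \<in> {0..1} \<Longrightarrow> p (\<gamma> t) \<le> c) \<Longrightarrow> curve_sup p \<gamma> \<le> c"
  unfolding curve_sup_def by (rule cSUP_least) auto

lemma curve_sup_upper:
  assumes "\<gamma> \<in> C_curves 0" "cseminorm p" "t \<in> {0..1}"
  shows "p (\<gamma> t) \<le> curve_sup p \<gamma>"
proof -
  have "continuous_on {0..1} (\<lambda>t. p (\<gamma> t))"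
    using assms by (intro continuous_on_compose2[OF cseminorm_cont[OF assms(2)]]) (auto simp: C_curves_0_iff)
  then have "bdd_above ((\<lambda>t. p (\<gamma> t)) ` {0..1})"
    using compact_continuous_image[of "{0..1}"] by (intro bounded_imp_bdd_above compact_imp_bounded) auto
  then show ?thesis unfolding curve_sup_def using assms(3) by (intro cSUP_upper)
qed

lemma curve_sup_nonneg:
  assumes "\<gamma> \<in> C_curves 0" "cseminorm p"
  shows "0 \<le> curve_sup p \<gamma>"
  using curve_sup_upper[OF assms, of 0] cseminorm_nonneg[OF assms(2), of "\<gamma> 0"] by simp

lemma curve_sup_mono:
  assumes "\<delta> \<in> C_curves 0" "cseminorm q" "\<And>t. t \<in> {0..1} \<Longrightarrow> p (\<gamma> t) \<le> q (\<delta> t)"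
  shows "curve_sup p \<gamma> \<le> curve_sup q \<delta>"
  using assms(3) curve_sup_upper[OF assms(1,2)] by (intro curve_sup_least) (meson order_trans)

text \<open>An inequality suffices for homogeneity because it can also be applied to
  \<open>inverse r\<close>; nonnegativity settles \<open>r = 0\<close>.\<close>

lemma seminorm_onI:
  fixes Q :: "'e::real_vector \<Rightarrow> real"
  assumes S: "subspace S" and add: "\<And>x y. x \<in> S \<Longrightarrow> y \<in> S \<Longrightarrow> Q (x + y) \<le> Q x + Q y"
    and sc: "\<And>r x. x \<in> S \<Longrightarrow> Q (r *\<^sub>R x) \<le> \<bar>r\<bar> * Q x"
    and nn: "\<And>x. x \<in> S \<Longrightarrow> 0 \<le> Q x"
  shows "seminorm_on S Q"
  unfolding seminorm_on_def
proof (intro conjI ballI allI add)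
  fix r x assume x: "x \<in> S"
  show "Q (r *\<^sub>R x) = \<bar>r\<bar> * Q x"
  proof (cases "r = 0")
    case True
    then show ?thesis using sc[OF x, of 0] nn[of 0] S by (simp add: subspace_0)
  next
    case False
    have "Q x \<le> \<bar>inverse r\<bar> * Q (r *\<^sub>R x)"
      using sc[of "r *\<^sub>R x" "inverse r"] False subspace_scale[OF S x] by simp
    then have "\<bar>r\<bar> * Q x \<le> \<bar>r\<bar> * (\<bar>inverse r\<bar> * Q (r *\<^sub>R x))" by (intro mult_left_mono) auto
    also have "\<dots> = Q (r *\<^sub>R x)" using False by (simp add: abs_inverse)
    finally show ?thesis using sc[OF x, of r] by simp
  qed
qed

lemma seminorm_on_max:
  assumes "subspace S" "seminorm_on S P" "seminorm_on S Q"
  shows "seminorm_on S (\<lambda>x. max (P x) (Q x))"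
proof (rule seminorm_onI[OF assms(1)])
  fix x y assume "x \<in> S" "y \<in> S"
  then show "max (P (x + y)) (Q (x + y)) \<le> max (P x) (Q x) + max (P y) (Q y)"
    using seminorm_on_add[OF assms(2,1), of x y] seminorm_on_add[OF assms(3,1), of x y] by linarith
next
  fix r x assume "x \<in> S"
  then show "max (P (r *\<^sub>R x)) (Q (r *\<^sub>R x)) \<le> \<bar>r\<bar> * max (P x) (Q x)"
    using seminorm_on_scale[OF assms(2,1), of x x r] seminorm_on_scale[OF assms(3,1), of x x r]
    by (simp add: mult_left_mono)
next
  fix x assume "x \<in> S"
  then show "0 \<le> max (P x) (Q x)"
    using seminorm_on_nonneg[OF assms(2,1), of x x] by simp
qed

lemma seminorm_on_plus:
  assumes "seminorm_on S P" "seminorm_on S Q"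
  shows "seminorm_on S (\<lambda>x. P x + Q x)"
  unfolding seminorm_on_def
proof (intro conjI ballI allI)
  show "P (x + y) + Q (x + y) \<le> P x + Q x + (P y + Q y)" if "x \<in> S" "y \<in> S" for x y
  proof -
    have "P (x + y) \<le> P x + P y" "Q (x + y) \<le> Q x + Q y"
      using assms that unfolding seminorm_on_def by blast+
    then show ?thesis by simp
  qed
  show "P (r *\<^sub>R x) + Q (r *\<^sub>R x) = \<bar>r\<bar> * (P x + Q x)" if "x \<in> S" for r x
    using assms that unfolding seminorm_on_def by (simp add: distrib_left)
qed

context seminormed_space
begin

lemma subspace_C_curves_0: "subspace (C_curves 0 :: (real \<Rightarrow> 'b) set)"
  unfolding subspace_def
proof (intro conjI ballI allI)
  show "0 \<in> (C_curves 0 :: (real \<Rightarrow> 'b) set)" by (simp add: C_curves_0_iff zero_fun_def)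
  fix x y :: "real \<Rightarrow> 'b" and c assume x: "x \<in> C_curves 0"
  show "c *\<^sub>R x \<in> C_curves 0" using x
    by (auto simp: C_curves_0_iff scaleR_fun_def continuous_on_def intro: tendsto_scaleR_seminormed)
  assume y: "y \<in> C_curves 0"
  show "x + y \<in> C_curves 0" using x y
    by (auto simp: C_curves_0_iff plus_fun_def continuous_on_def intro: tendsto_add_seminormed)
qed

lemma C_curves_1I:
  fixes \<gamma> :: "real \<Rightarrow> 'b"
  assumes "\<And>t. t \<notin> {0..1} \<Longrightarrow> \<gamma> t = 0" "\<And>t. t \<in> {0..1} \<Longrightarrow> has_curve_deriv \<gamma> (g t) t"
    "continuous_on {0..1} g"
  shows "\<gamma> \<in> C_curves 1"
proof -
  have d: "curve_deriv \<gamma> t = g t" if "t \<in> {0..1}" for t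
    using curve_deriv_eq[OF assms(2)] that by blast
  have "continuous_on {0..1} (curve_deriv \<gamma>) \<longleftrightarrow> continuous_on {0..1} g"
    by (rule continuous_on_cong[OF refl d])
  then have "continuous_on {0..1} (curve_deriv \<gamma>)" using assms(3) by blast
  moreover have "continuous_on {0..1} \<gamma>" by (rule has_curve_deriv_imp_continuous_on[OF assms(2)])
  moreover have "enat j \<le> 1 \<longleftrightarrow> j = 0 \<or> j = 1" "enat (Suc j) \<le> 1 \<longleftrightarrow> j = 0" for j
    by (auto simp: one_enat_def)
  ultimately show ?thesis using assms(1,2) unfolding C_curves_def by (auto, blast)
qed

lemma C_curves_1D:
  fixes \<gamma> :: "real \<Rightarrow> 'b"
  assumes "\<gamma> \<in> C_curves 1"
  shows "t \<in> {0..1} \<Longrightarrow> has_curve_deriv \<gamma> (curve_deriv \<gamma> t) t"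
    and "curve_deriv \<gamma> \<in> C_curves 0" and "\<gamma> \<in> C_curves 0"
proof -
  have e: "enat (Suc 0) \<le> 1" "enat 0 \<le> 1" by (auto simp: one_enat_def zero_enat_def)
  have "(\<forall>j. enat (Suc j) \<le> 1 \<longrightarrow> (\<forall>t\<in>{0..1}. \<exists>v. has_curve_deriv ((curve_deriv ^^ j) \<gamma>) v t))"
    and c: "(\<forall>j. enat j \<le> 1 \<longrightarrow> continuous_on {0..1} ((curve_deriv ^^ j) \<gamma>))"
    using assms unfolding C_curves_def by blast+
  then have "\<forall>t\<in>{0..1}. \<exists>v. has_curve_deriv ((curve_deriv ^^ 0) \<gamma>) v t"
    using e(1) by blast
  then show "t \<in> {0..1} \<Longrightarrow> has_curve_deriv \<gamma> (curve_deriv \<gamma> t) t"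
    using curve_deriv_eq by fastforce
  show "curve_deriv \<gamma> \<in> C_curves 0"
    using spec[OF c, of 1] curve_deriv_outside by (auto simp: C_curves_0_iff one_enat_def)
  show "\<gamma> \<in> C_curves 0"
    using spec[OF c, of 0] C_curves_outside[OF assms] e(2) by (auto simp: C_curves_0_iff)
qed

lemma curve_deriv_plus:
  fixes \<gamma> \<delta> :: "real \<Rightarrow> 'b"
  assumes "\<gamma> \<in> C_curves 1" "\<delta> \<in> C_curves 1"
  shows "curve_deriv (\<gamma> + \<delta>) = curve_deriv \<gamma> + curve_deriv \<delta>"
proof
  fix t
  show "curve_deriv (\<gamma> + \<delta>) t = (curve_deriv \<gamma> + curve_deriv \<delta>) t"
  proof (cases "t \<in> {0..1}")
    case True
    have "has_curve_deriv (\<gamma> + \<delta>) (curve_deriv \<gamma> t + curve_deriv \<delta> t) t"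
      using has_curve_deriv_add[OF C_curves_1D(1)[OF assms(1) True] C_curves_1D(1)[OF assms(2) True]]
      by (simp add: plus_fun_def)
    then show ?thesis using curve_deriv_eq True by simp
  qed (simp add: curve_deriv_outside)
qed

lemma curve_deriv_scaleR:
  fixes \<gamma> :: "real \<Rightarrow> 'b"
  assumes "\<gamma> \<in> C_curves 1"
  shows "curve_deriv (r *\<^sub>R \<gamma>) = r *\<^sub>R curve_deriv \<gamma>"
proof
  fix t
  show "curve_deriv (r *\<^sub>R \<gamma>) t = (r *\<^sub>R curve_deriv \<gamma>) t"
  proof (cases "t \<in> {0..1}")
    case True
    have "has_curve_deriv (r *\<^sub>R \<gamma>) (r *\<^sub>R curve_deriv \<gamma> t) t"
      using has_curve_deriv_scaleR[OF C_curves_1D(1)[OF assms True]] by (simp add: scaleR_fun_def)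
    then show ?thesis using curve_deriv_eq True by (simp add: scaleR_fun_def)
  qed (simp add: curve_deriv_outside scaleR_fun_def)
qed

lemma subspace_C_curves_1: "subspace (C_curves 1 :: (real \<Rightarrow> 'b) set)"
  unfolding subspace_def
proof (intro conjI ballI allI)
  show "0 \<in> (C_curves 1 :: (real \<Rightarrow> 'b) set)"
    by (rule C_curves_1I[of _ "\<lambda>_. 0"]) (auto simp: zero_fun_def has_curve_deriv_const)
  fix \<gamma> \<delta> :: "real \<Rightarrow> 'b" and r assume g: "\<gamma> \<in> C_curves 1"
  show "r *\<^sub>R \<gamma> \<in> C_curves 1"
  proof (rule C_curves_1I)
    show "has_curve_deriv (r *\<^sub>R \<gamma>) ((r *\<^sub>R curve_deriv \<gamma>) t) t" if "t \<in> {0..1}" for t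
      using has_curve_deriv_scaleR[OF C_curves_1D(1)[OF g that]] by (simp add: scaleR_fun_def)
    show "continuous_on {0..1} (r *\<^sub>R curve_deriv \<gamma>)"
      using subspace_scale[OF subspace_C_curves_0 C_curves_1D(2)[OF g]] by (simp add: C_curves_0_iff)
  qed (simp add: scaleR_fun_def C_curves_outside[OF g])
  assume d: "\<delta> \<in> C_curves 1"
  show "\<gamma> + \<delta> \<in> C_curves 1"
  proof (rule C_curves_1I)
    show "has_curve_deriv (\<gamma> + \<delta>) ((curve_deriv \<gamma> + curve_deriv \<delta>) t) t" if "t \<in> {0..1}" for t
      using has_curve_deriv_add[OF C_curves_1D(1)[OF g that] C_curves_1D(1)[OF d that]]
      by (simp add: plus_fun_def)
    show "continuous_on {0..1} (curve_deriv \<gamma> + curve_deriv \<delta>)"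
      using subspace_add[OF subspace_C_curves_0 C_curves_1D(2)[OF g] C_curves_1D(2)[OF d]]
      by (simp add: C_curves_0_iff)
  qed (simp add: C_curves_outside[OF g] C_curves_outside[OF d])
qed

lemma seminorm_on_curve_sup:
  assumes p: "cseminorm (p :: 'b \<Rightarrow> real)"
  shows "seminorm_on (C_curves 0) (curve_sup p)"
proof (rule seminorm_onI[OF subspace_C_curves_0])
  fix \<gamma> \<delta> :: "real \<Rightarrow> 'b" and r assume g: "\<gamma> \<in> C_curves 0"
  show "0 \<le> curve_sup p \<gamma>" by (rule curve_sup_nonneg[OF g p])
  show "curve_sup p (r *\<^sub>R \<gamma>) \<le> \<bar>r\<bar> * curve_sup p \<gamma>"
    using curve_sup_upper[OF g p]
    by (intro curve_sup_least) (simp add: scaleR_fun_def cseminorm_scale[OF p] mult_left_mono)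
  assume d: "\<delta> \<in> C_curves 0"
  show "curve_sup p (\<gamma> + \<delta>) \<le> curve_sup p \<gamma> + curve_sup p \<delta>"
  proof (rule curve_sup_least)
    fix t assume "t \<in> {0..1::real}"
    then show "p ((\<gamma> + \<delta>) t) \<le> curve_sup p \<gamma> + curve_sup p \<delta>"
      using curve_sup_upper[OF g p] curve_sup_upper[OF d p] cseminorm_add[OF p, of "\<gamma> t" "\<delta> t"]
      by (simp add: plus_fun_def) (meson add_mono order_trans)
  qed
qed

lemma seminorm_on_curve_sup_deriv:
  assumes p: "cseminorm (p :: 'b \<Rightarrow> real)"
  shows "seminorm_on (C_curves 1) (\<lambda>\<gamma>. curve_sup p (curve_deriv \<gamma>))"
  using seminorm_on_curve_sup[OF p] C_curves_1D(2)
  by (auto simp: seminorm_on_def curve_deriv_plus curve_deriv_scaleR)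

lemma C_curves_1_subset_0: "C_curves 1 \<subseteq> (C_curves 0 :: (real \<Rightarrow> 'b) set)"
  using C_curves_1D(3) by blast

lemma seminorm_on_curve_sup1:
  assumes p: "cseminorm (p :: 'b \<Rightarrow> real)"
  shows "seminorm_on (C_curves 1) (curve_sup1 p)"
  using seminorm_on_plus[OF seminorm_on_subset[OF seminorm_on_curve_sup[OF p] C_curves_1_subset_0]
      seminorm_on_curve_sup_deriv[OF p]]
  by (simp add: curve_sup1_def[abs_def])

lemma curve_sup_directed:
  assumes "cseminorm (p :: 'b \<Rightarrow> real)" "cseminorm q" "\<gamma> \<in> C_curves 0"
  shows "curve_sup p \<gamma> \<le> curve_sup (\<lambda>x. p x + q x) \<gamma>" "curve_sup q \<gamma> \<le> curve_sup (\<lambda>x. p x + q x) \<gamma>"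
  by (rule curve_sup_mono[OF assms(3) cseminorm_plus[OF assms(1,2)]];
      simp add: cseminorm_nonneg assms)+

lemma lipschitz_curves_subset_C_curves_0: "lipschitz_curves \<subseteq> (C_curves 0 :: (real \<Rightarrow> 'b) set)"
proof
  fix \<gamma> :: "real \<Rightarrow> 'b" assume g: "\<gamma> \<in> lipschitz_curves"
  have "continuous_on {0..1} \<gamma>"
    unfolding continuous_on_curve_iff
  proof (intro ballI allI impI)
    fix x p e assume x: "x \<in> {0..1::real}" and p: "cseminorm (p :: 'b \<Rightarrow> real) \<and> (e::real) > 0"
    then obtain L where L: "\<forall>s\<in>{0..1}. \<forall>t\<in>{0..1}. p (\<gamma> t - \<gamma> s) \<le> L * \<bar>t - s\<bar>"
      using g unfolding lipschitz_curves_def by blast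
    have "p (\<gamma> y - \<gamma> x) < e" if y: "y \<in> {0..1}" "\<bar>y - x\<bar> < e / (\<bar>L\<bar> + 1)" for y
    proof -
      have "p (\<gamma> y - \<gamma> x) \<le> L * \<bar>y - x\<bar>" using L x y by blast
      also have "\<dots> \<le> (\<bar>L\<bar> + 1) * \<bar>y - x\<bar>" by (intro mult_right_mono) auto
      also have "\<dots> < e" using y(2) by (simp add: field_simps)
      finally show ?thesis .
    qed
    then show "\<exists>d>0. \<forall>y\<in>{0..1}. \<bar>y - x\<bar> < d \<longrightarrow> p (\<gamma> y - \<gamma> x) < e"
      using p by (intro exI[of _ "e / (\<bar>L\<bar> + 1)"]) auto
  qed
  then show "\<gamma> \<in> C_curves 0" using g by (auto simp: C_curves_0_iff lipschitz_curves_def)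
qed

lemma C_curves_1_subset_lipschitz_curves: "C_curves 1 \<subseteq> (lipschitz_curves :: (real \<Rightarrow> 'b) set)"
proof
  fix \<gamma> :: "real \<Rightarrow> 'b" assume g: "\<gamma> \<in> C_curves 1"
  have "p (\<gamma> t - \<gamma> s) \<le> curve_sup p (curve_deriv \<gamma>) * \<bar>t - s\<bar>"
    if p: "cseminorm p" and st: "s \<in> {0..1}" "t \<in> {0..1}" for p s t
  proof -
    have "p (\<gamma> t - \<gamma> s - (t - s) *\<^sub>R 0) \<le> curve_sup p (curve_deriv \<gamma>) * \<bar>t - s\<bar>"
    proof (rule curve_lipschitz_bound[OF p st(2,1)])
      fix u assume "u \<in> {min t s..max t s}"
      then have u: "u \<in> {0..1}" using st by auto
      then show "has_curve_deriv \<gamma> (curve_deriv \<gamma> u) u" by (rule C_curves_1D(1)[OF g])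
      show "p (curve_deriv \<gamma> u - 0) \<le> curve_sup p (curve_deriv \<gamma>)"
        using curve_sup_upper[OF C_curves_1D(2)[OF g] p u] by simp
    qed
    then show ?thesis by simp
  qed
  then show "\<gamma> \<in> lipschitz_curves"
    using C_curves_outside[OF g] unfolding lipschitz_curves_def by blast
qed

lemma subspace_lipschitz_curves: "subspace (lipschitz_curves :: (real \<Rightarrow> 'b) set)"
  unfolding subspace_def
proof (intro conjI ballI allI)
  show "0 \<in> (lipschitz_curves :: (real \<Rightarrow> 'b) set)"
    using subspace_0[OF subspace_C_curves_1] C_curves_1_subset_lipschitz_curves by blast
  fix \<gamma> \<delta> :: "real \<Rightarrow> 'b" and r assume g: "\<gamma> \<in> lipschitz_curves"
  have "\<exists>L. \<forall>s\<in>{0..1}. \<forall>t\<in>{0..1}. p ((r *\<^sub>R \<gamma>) t - (r *\<^sub>R \<gamma>) s) \<le> L * \<bar>t - s\<bar>" if p: "cseminorm p" for p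
  proof -
    obtain L where L: "\<forall>s\<in>{0..1}. \<forall>t\<in>{0..1}. p (\<gamma> t - \<gamma> s) \<le> L * \<bar>t - s\<bar>"
      using g p unfolding lipschitz_curves_def by blast
    have "p ((r *\<^sub>R \<gamma>) t - (r *\<^sub>R \<gamma>) s) = \<bar>r\<bar> * p (\<gamma> t - \<gamma> s)" for s t
      using cseminorm_scale[OF p, of r "\<gamma> t - \<gamma> s"] by (simp add: scaleR_fun_def scaleR_diff_right)
    then show ?thesis using L by (intro exI[of _ "\<bar>r\<bar> * L"]) (simp add: mult.assoc mult_left_mono)
  qed
  then show "r *\<^sub>R \<gamma> \<in> lipschitz_curves"
    using g by (auto simp: lipschitz_curves_def scaleR_fun_def)
  assume d: "\<delta> \<in> lipschitz_curves"
  have "\<exists>L. \<forall>s\<in>{0..1}. \<forall>t\<in>{0..1}. p ((\<gamma> + \<delta>) t - (\<gamma> + \<delta>) s) \<le> L * \<bar>t - s\<bar>" if p: "cseminorm p" for p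
  proof -
    obtain L where L: "\<forall>s\<in>{0..1}. \<forall>t\<in>{0..1}. p (\<gamma> t - \<gamma> s) \<le> L * \<bar>t - s\<bar>"
      using g p unfolding lipschitz_curves_def by blast
    obtain M where M: "\<forall>s\<in>{0..1}. \<forall>t\<in>{0..1}. p (\<delta> t - \<delta> s) \<le> M * \<bar>t - s\<bar>"
      using d p unfolding lipschitz_curves_def by blast
    have "p ((\<gamma> + \<delta>) t - (\<gamma> + \<delta>) s) \<le> (L + M) * \<bar>t - s\<bar>" if "s \<in> {0..1}" "t \<in> {0..1}" for s t
    proof -
      have "p ((\<gamma> + \<delta>) t - (\<gamma> + \<delta>) s) \<le> p (\<gamma> t - \<gamma> s) + p (\<delta> t - \<delta> s)"
        using cseminorm_add[OF p, of "\<gamma> t - \<gamma> s" "\<delta> t - \<delta> s"] by (simp add: algebra_simps)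
      also have "\<dots> \<le> L * \<bar>t - s\<bar> + M * \<bar>t - s\<bar>" using L M that by (intro add_mono) blast+
      finally show ?thesis by (simp add: distrib_right)
    qed
    then show ?thesis by blast
  qed
  then show "\<gamma> + \<delta> \<in> lipschitz_curves"
    using g d by (auto simp: lipschitz_curves_def)
qed

end

section \<open>The Lipschitz space and the topologies \<open>C_topology\<close> in terms of real
  seminorms\<close>

context locally_convex_space
begin

text \<open>Boundedness tested by K-homogeneous seminorms and boundedness tested by real-homogeneous
  ones agree, since each of the latter is dominated by one of the former.\<close>

lemma Lip_eq_lipschitz_curves:
  assumes K: "K = \<real> \<or> K = UNIV"
  shows "Lip K cs = lipschitz_curves"
proof -
  have RK: "\<real> \<subseteq> K" using K by auto
  let ?B = "\<lambda>\<gamma>. {(\<gamma> t - \<gamma> s) /\<^sub>R (t - s) |s t. s \<in> {0..1::real} \<and> t \<in> {0..1} \<and> s \<noteq> t}"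
  have "lcs_bounded K cs (?B \<gamma>) \<longleftrightarrow>
    (\<forall>p. cseminorm p \<longrightarrow> (\<exists>L. \<forall>s\<in>{0..1}. \<forall>t\<in>{0..1}. p (\<gamma> t - \<gamma> s) \<le> L * \<bar>t - s\<bar>))" for \<gamma>
  proof (intro iffI allI impI)
    fix p :: "'a \<Rightarrow> real" assume B: "lcs_bounded K cs (?B \<gamma>)" and p: "cseminorm p"
    obtain P where P: "continuous_seminorm K cs P" "\<And>x. p x \<le> P x"
      using cseminorm_le_continuous_seminorm[OF K p] by blast
    have cP: "cseminorm P"
      by (rule continuous_seminorm_imp_cseminorm[OF locally_convex_space_axioms RK P(1)])
    obtain L where L: "\<And>y. y \<in> ?B \<gamma> \<Longrightarrow> P y \<le> L"
      using B P(1) unfolding lcs_bounded_def bdd_above_def by blast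
    have "p (\<gamma> t - \<gamma> s) \<le> L * \<bar>t - s\<bar>" if "s \<in> {0..1}" "t \<in> {0..1}" for s t
    proof (cases "s = t")
      case True
      then show ?thesis by (simp add: cseminorm_zero[OF p])
    next
      case False
      have "P ((\<gamma> t - \<gamma> s) /\<^sub>R (t - s)) \<le> L" using that False by (intro L) blast
      then have "P (\<gamma> t - \<gamma> s) / \<bar>t - s\<bar> \<le> L"
        by (simp add: cseminorm_scale[OF cP] abs_inverse divide_inverse mult.commute)
      then have "P (\<gamma> t - \<gamma> s) \<le> L * \<bar>t - s\<bar>" using False by (simp add: field_simps)
      then show ?thesis using P(2) order_trans by blast
    qed
    then show "\<exists>L. \<forall>s\<in>{0..1}. \<forall>t\<in>{0..1}. p (\<gamma> t - \<gamma> s) \<le> L * \<bar>t - s\<bar>" by blast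
  next
    assume R: "\<forall>p. cseminorm p \<longrightarrow> (\<exists>L. \<forall>s\<in>{0..1}. \<forall>t\<in>{0..1}. p (\<gamma> t - \<gamma> s) \<le> L * \<bar>t - s\<bar>)"
    show "lcs_bounded K cs (?B \<gamma>)"
      unfolding lcs_bounded_def
    proof (intro allI impI)
      fix p assume "continuous_seminorm K cs p"
      then have p: "cseminorm p"
        by (rule continuous_seminorm_imp_cseminorm[OF locally_convex_space_axioms RK])
      then obtain L where L: "\<forall>s\<in>{0..1}. \<forall>t\<in>{0..1}. p (\<gamma> t - \<gamma> s) \<le> L * \<bar>t - s\<bar>" using R by blast
      show "bdd_above (p ` ?B \<gamma>)"
      proof (rule bdd_aboveI2)
        fix y assume "y \<in> ?B \<gamma>"
        then obtain s t where st: "y = (\<gamma> t - \<gamma> s) /\<^sub>R (t - s)" "s \<in> {0..1}" "t \<in> {0..1}" "s \<noteq> t"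
          by blast
        then have "p (\<gamma> t - \<gamma> s) \<le> L * \<bar>t - s\<bar>" using L by blast
        then have "p (\<gamma> t - \<gamma> s) / \<bar>t - s\<bar> \<le> L" using st(4) by (simp add: field_simps)
        then show "p y \<le> L"
          unfolding st(1) by (simp add: cseminorm_scale[OF p] abs_inverse divide_inverse mult.commute)
      qed
    qed
  qed
  then show ?thesis unfolding Lip_def lipschitz_curves_def by simp
qed

lemma seminorm_topology_C_topology:
  assumes K: "K = \<real> \<or> K = UNIV"
    and r: "r = 0 \<and> N = (curve_sup :: ('a \<Rightarrow> real) \<Rightarrow> _) \<or> r = 1 \<and> N = curve_sup1"
  shows "seminorm_topology (C_topology K cs r) (C_curves r) (N ` {p. cseminorm p})"
proof -
  interpret seminormed_space "TYPE('a)" by (rule seminormed_space[OF K])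
  have RK: "\<real> \<subseteq> K" using K by auto
  note imp = continuous_seminorm_imp_cseminorm[OF locally_convex_space_axioms RK]
  have cs0: "curve_seminorm 0 p = curve_sup p" for p :: "'a \<Rightarrow> real"
    by (simp add: curve_seminorm_def curve_sup_def fun_eq_iff)
  have cs1: "curve_seminorm 1 p = (\<lambda>\<gamma>. max (curve_sup p \<gamma>) (curve_sup p (curve_deriv \<gamma>)))" for p :: "'a \<Rightarrow> real"
  proof
    fix \<gamma> :: "real \<Rightarrow> 'a"
    have "{..1::nat} = {0, 1}" by auto
    then show "curve_seminorm 1 p \<gamma> = max (curve_sup p \<gamma>) (curve_sup p (curve_deriv \<gamma>))"
      by (simp add: curve_seminorm_def curve_sup_def)
  qed
  have sub: "subspace (C_curves r :: (real \<Rightarrow> 'a) set)"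
    using r subspace_C_curves_0 subspace_C_curves_1 by auto
  have sem: "seminorm_on (C_curves r) (N p)" if "cseminorm p" for p
    using r seminorm_on_curve_sup[OF that] seminorm_on_curve_sup1[OF that] by auto
  have mono: "N p \<gamma> \<le> N (\<lambda>x. p x + q x) \<gamma> \<and> N q \<gamma> \<le> N (\<lambda>x. p x + q x) \<gamma>"
    if "cseminorm p" "cseminorm q" "\<gamma> \<in> C_curves r" for p q \<gamma>
  proof -
    have "curve_sup p \<delta> \<le> curve_sup (\<lambda>x. p x + q x) \<delta> \<and> curve_sup q \<delta> \<le> curve_sup (\<lambda>x. p x + q x) \<delta>"
      if "\<delta> \<in> C_curves 0" for \<delta>
      using curve_sup_directed[OF \<open>cseminorm p\<close> \<open>cseminorm q\<close> that] by simp
    then show ?thesis using r that(3) C_curves_1D(2,3)[of \<gamma>]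
      by (auto simp: curve_sup1_def intro!: add_mono)
  qed
  have le1: "curve_seminorm k p \<gamma> \<le> N p \<gamma>" if "cseminorm p" "\<gamma> \<in> C_curves r" "enat k \<le> r" for k p \<gamma>
  proof -
    have "k = 0 \<or> r = 1 \<and> k = 1" using r that(3) by (auto simp: zero_enat_def one_enat_def)
    then show ?thesis
      using r that C_curves_1D(2,3)[of \<gamma>] curve_sup_nonneg[of _ p]
      by (auto simp: cs0 cs1 curve_sup1_def simp del: One_nat_def)
  qed
  show ?thesis
  proof (rule seminorm_topology_generated[OF sub, where \<Q> = "{curve_seminorm k p |k p. enat k \<le> r \<and> continuous_seminorm K cs p}"])
    obtain p0 where p0: "continuous_seminorm K cs p0"
      using cseminorm_le_continuous_seminorm[OF K cseminorm_null] by blast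
    moreover have "enat 0 \<le> r" using r by (auto simp: zero_enat_def one_enat_def)
    ultimately show "{curve_seminorm k p |k p. enat k \<le> r \<and> continuous_seminorm K cs p} \<noteq> {}" by blast
    show "N ` {p. cseminorm p} \<noteq> {}" using cseminorm_null by blast
    show "seminorm_on (C_curves r) Q" if "Q \<in> N ` {p. cseminorm p}" for Q using that sem by blast
    show "seminorm_on (C_curves r) Q"
      if Q: "Q \<in> {curve_seminorm k p |k p. enat k \<le> r \<and> continuous_seminorm K cs p}" for Q
    proof -
      obtain k p where kp: "Q = curve_seminorm k p" "enat k \<le> r" "continuous_seminorm K cs p" using Q by blast
      have p: "cseminorm p" by (rule imp[OF kp(3)])
      have "k = 0 \<or> r = 1 \<and> k = 1" using r kp(2) by (auto simp: zero_enat_def one_enat_def)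
      then show ?thesis
      proof
        assume "k = 0"
        then show ?thesis using r seminorm_on_curve_sup[OF p]
            seminorm_on_subset[OF seminorm_on_curve_sup[OF p] C_curves_1_subset_0] kp(1) cs0 by auto
      next
        assume k: "r = 1 \<and> k = 1"
        show ?thesis unfolding kp(1) conjunct1[OF k] conjunct2[OF k] cs1
          by (intro seminorm_on_max subspace_C_curves_1 seminorm_on_curve_sup_deriv[OF p]
              seminorm_on_subset[OF seminorm_on_curve_sup[OF p] C_curves_1_subset_0])
      qed
    qed
    show "\<exists>R\<in>N ` {p. cseminorm p}. \<forall>x\<in>C_curves r. P x \<le> R x \<and> Q x \<le> R x"
      if PQ: "P \<in> N ` {p. cseminorm p}" "Q \<in> N ` {p. cseminorm p}" for P Q
    proof -
      obtain p q where pq: "P = N p" "Q = N q" "cseminorm p" "cseminorm q" using PQ by blast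
      have "N (\<lambda>x. p x + q x) \<in> N ` {p. cseminorm p}" using cseminorm_plus[OF pq(3,4)] by blast
      then show ?thesis using mono[OF pq(3,4)] pq(1,2) by blast
    qed
    show "\<exists>P\<in>N ` {p. cseminorm p}. \<forall>x\<in>C_curves r. Q x \<le> P x"
      if "Q \<in> {curve_seminorm k p |k p. enat k \<le> r \<and> continuous_seminorm K cs p}" for Q
      using that le1 imp by blast
    show "\<exists>Q\<in>{curve_seminorm k p |k p. enat k \<le> r \<and> continuous_seminorm K cs p}. \<forall>x\<in>C_curves r. P x \<le> Q x"
      if P: "P \<in> N ` {p. cseminorm p}" for P
    proof -
      obtain p where p: "P = N p" "cseminorm p" using P by blast
      \<comment> \<open>\<open>curve_sup1\<close> is a sum of two suprema,
        \<open>curve_seminorm 1\<close> their maximum; the factor 2 makes up for the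
        difference.\<close>
      have p2: "cseminorm (\<lambda>x. 2 * p x)" using cseminorm_mult[OF p(2), of 2] by simp
      obtain q where q: "continuous_seminorm K cs q" "\<And>x. 2 * p x \<le> q x"
        using cseminorm_le_continuous_seminorm[OF K p2] by blast
      have cq: "cseminorm q" by (rule imp[OF q(1)])
      have half: "curve_sup p \<delta> \<le> curve_sup q \<delta> / 2" if d: "\<delta> \<in> C_curves 0" for \<delta>
      proof (rule curve_sup_least)
        fix t assume "t \<in> {0..1::real}"
        then show "p (\<delta> t) \<le> curve_sup q \<delta> / 2"
          using curve_sup_upper[OF d cq, of t] q(2)[of "\<delta> t"] by simp
      qed
      have "N p \<gamma> \<le> curve_seminorm (if r = 0 then 0 else 1) q \<gamma>" if "\<gamma> \<in> C_curves r" for \<gamma>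
        using r
      proof
        assume a: "r = 0 \<and> N = curve_sup"
        then show ?thesis using half[of \<gamma>] that curve_sup_nonneg[OF _ cq, of \<gamma>] by (auto simp: cs0)
      next
        assume a: "r = 1 \<and> N = curve_sup1"
        then have "\<gamma> \<in> C_curves 1" using that by simp
        from half[OF C_curves_1D(3)[OF this]] half[OF C_curves_1D(2)[OF this]]
        have "curve_sup1 p \<gamma> \<le> curve_seminorm 1 q \<gamma>" unfolding cs1 curve_sup1_def by linarith
        then show ?thesis using a by simp
      qed
      moreover have "enat (if r = 0 then 0 else 1) \<le> r" using r by (auto simp: zero_enat_def one_enat_def)
      ultimately show ?thesis using p(1) q(1) by blast
    qed
    show "C_topology K cs r = topology_generated_by {{y \<in> C_curves r. Q (y - x) < e} |x Q e.
        x \<in> C_curves r \<and> Q \<in> {curve_seminorm k p |k p. enat k \<le> r \<and> continuous_seminorm K cs p} \<and> 0 < e}"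
      unfolding C_topology_def by (rule arg_cong[where f = topology_generated_by]) blast
  qed
qed

end

section \<open>Linear differential equations\<close>

text \<open>
  In \<open>mult_bound\<close> the same seminorm \<open>p'\<close> occurs on both sides. This is what makes Gronwall-type
  estimates and Picard iteration available although \<open>'b\<close> is not normed.
\<close>

locale bounded_mult = seminormed_space T
  for T :: "'b::{real_vector,t2_space} itself" +
  fixes m :: "'b \<Rightarrow> 'b \<Rightarrow> 'b"
  assumes mult_add_left: "m (x + y) z = m x z + m y z"
    and mult_add_right: "m x (y + z) = m x y + m x z"
    and mult_scaleR_left: "m (r *\<^sub>R x) y = r *\<^sub>R m x y"
    and mult_scaleR_right: "m x (r *\<^sub>R y) = r *\<^sub>R m x y"
    and mult_bound: "cseminorm p \<Longrightarrow> \<exists>p' q'. cseminorm p' \<and> cseminorm q' \<and> (\<forall>x. p x \<le> p' x) \<and>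
      (\<forall>x y. p' (m x y) \<le> p' x * q' y)"
begin

lemma mult_zero: "m 0 y = 0" "m x 0 = 0"
  using mult_scaleR_left[of 0 0 y] mult_scaleR_right[of x 0 0] by simp_all

lemma mult_diff: "m (x - y) z = m x z - m y z" "m x (y - z) = m x y - m x z"
  using mult_add_left[of "x - y" y z] mult_add_right[of x "y - z" z] by simp_all

lemma mult_lipschitz_curves:
  assumes u: "u \<in> lipschitz_curves" and g: "\<gamma> \<in> lipschitz_curves"
  shows "(\<lambda>t. m (u t) (\<gamma> t)) \<in> lipschitz_curves"
  unfolding lipschitz_curves_def
proof (intro CollectI conjI allI impI)
  show "m (u t) (\<gamma> t) = 0" if "t \<notin> {0..1}" for t
    using u that by (simp add: lipschitz_curves_def mult_zero)
  fix p :: "'b \<Rightarrow> real" assume p: "cseminorm p"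
  obtain p' q' where pq: "cseminorm p'" "cseminorm q'" "\<And>x. p x \<le> p' x"
    "\<And>x y. p' (m x y) \<le> p' x * q' y"
    using mult_bound[OF p] by meson
  obtain L where L: "\<forall>s\<in>{0..1}. \<forall>t\<in>{0..1}. p' (u t - u s) \<le> L * \<bar>t - s\<bar>"
    using u pq(1) unfolding lipschitz_curves_def by blast
  obtain M where M: "\<forall>s\<in>{0..1}. \<forall>t\<in>{0..1}. q' (\<gamma> t - \<gamma> s) \<le> M * \<bar>t - s\<bar>"
    using g pq(2) unfolding lipschitz_curves_def by blast
  have u0: "u \<in> C_curves 0" and g0: "\<gamma> \<in> C_curves 0"
    using u g lipschitz_curves_subset_C_curves_0 by blast+
  have "p (m (u t) (\<gamma> t) - m (u s) (\<gamma> s)) \<le> (L * curve_sup q' \<gamma> + curve_sup p' u * M) * \<bar>t - s\<bar>"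
    if st: "s \<in> {0..1}" "t \<in> {0..1}" for s t
  proof -
    have "m (u t) (\<gamma> t) - m (u s) (\<gamma> s) = m (u t - u s) (\<gamma> t) + m (u s) (\<gamma> t - \<gamma> s)"
      by (simp add: mult_diff)
    also have "p \<dots> \<le> p' (m (u t - u s) (\<gamma> t)) + p' (m (u s) (\<gamma> t - \<gamma> s))"
      using pq(3) cseminorm_add[OF pq(1)] order_trans by blast
    also have "\<dots> \<le> (L * \<bar>t - s\<bar>) * curve_sup q' \<gamma> + curve_sup p' u * (M * \<bar>t - s\<bar>)"
    proof (intro add_mono order_trans[OF pq(4)] mult_mono)
      show Lst: "p' (u t - u s) \<le> L * \<bar>t - s\<bar>" "q' (\<gamma> t - \<gamma> s) \<le> M * \<bar>t - s\<bar>" using L M st by blast+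
      show "q' (\<gamma> t) \<le> curve_sup q' \<gamma>" by (rule curve_sup_upper[OF g0 pq(2) st(2)])
      show "p' (u s) \<le> curve_sup p' u" by (rule curve_sup_upper[OF u0 pq(1) st(1)])
      show "0 \<le> L * \<bar>t - s\<bar>" using Lst(1) cseminorm_nonneg[OF pq(1)] order_trans by blast
    qed (auto simp: cseminorm_nonneg[OF pq(2)] curve_sup_nonneg[OF u0 pq(1)])
    finally show ?thesis by (simp add: algebra_simps)
  qed
  then show "\<exists>L. \<forall>s\<in>{0..1}. \<forall>t\<in>{0..1}. p (m (u t) (\<gamma> t) - m (u s) (\<gamma> s)) \<le> L * \<bar>t - s\<bar>" by blast
qed

lemma mult_C_curves_0:
  assumes u: "u \<in> C_curves 0" and g: "\<gamma> \<in> C_curves 0"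
  shows "(\<lambda>t. m (u t) (\<gamma> t)) \<in> C_curves 0"
  unfolding C_curves_0_iff continuous_on_iff_cseminorm
proof (intro conjI allI impI ballI)
  show "m (u t) (\<gamma> t) = 0" if "t \<notin> {0..1}" for t
    using C_curves_outside[OF u that] by (simp add: mult_zero)
  fix x p assume x: "x \<in> {0..1::real}" and p: "cseminorm (p :: 'b \<Rightarrow> real)"
  obtain p' q' where pq: "cseminorm p'" "cseminorm q'" "\<And>x. p x \<le> p' x"
    "\<And>x y. p' (m x y) \<le> p' x * q' y"
    using mult_bound[OF p] by meson
  have lim: "((\<lambda>y. p' (u y - u x)) \<longlongrightarrow> 0) (at x within {0..1})" "((\<lambda>y. q' (\<gamma> y - \<gamma> x)) \<longlongrightarrow> 0) (at x within {0..1})"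
    using u g x pq unfolding C_curves_0_iff continuous_on_iff_cseminorm by blast+
  have "((\<lambda>y. p' (u y - u x) * curve_sup q' \<gamma> + p' (u x) * q' (\<gamma> y - \<gamma> x)) \<longlongrightarrow> 0 * curve_sup q' \<gamma> + p' (u x) * 0) (at x within {0..1})"
    by (intro tendsto_intros lim)
  then have lim: "((\<lambda>y. p' (u y - u x) * curve_sup q' \<gamma> + p' (u x) * q' (\<gamma> y - \<gamma> x)) \<longlongrightarrow> 0) (at x within {0..1})"
    by simp
  have le: "p (m (u y) (\<gamma> y) - m (u x) (\<gamma> x)) \<le> p' (u y - u x) * curve_sup q' \<gamma> + p' (u x) * q' (\<gamma> y - \<gamma> x)"
    if y: "y \<in> {0..1}" for y
  proof -
    have "m (u y) (\<gamma> y) - m (u x) (\<gamma> x) = m (u y - u x) (\<gamma> y) + m (u x) (\<gamma> y - \<gamma> x)"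
      by (simp add: mult_diff)
    also have "p \<dots> \<le> p' (m (u y - u x) (\<gamma> y)) + p' (m (u x) (\<gamma> y - \<gamma> x))"
      using pq(3) cseminorm_add[OF pq(1)] order_trans by blast
    also have "\<dots> \<le> p' (u y - u x) * curve_sup q' \<gamma> + p' (u x) * q' (\<gamma> y - \<gamma> x)"
      using curve_sup_upper[OF g pq(2) y]
      by (intro add_mono order_trans[OF pq(4)] mult_left_mono) (auto simp: cseminorm_nonneg[OF pq(1)])
    finally show ?thesis .
  qed
  have "\<forall>\<^sub>F y in at x within {0..1}. norm (p (m (u y) (\<gamma> y) - m (u x) (\<gamma> x))) \<le>
      p' (u y - u x) * curve_sup q' \<gamma> + p' (u x) * q' (\<gamma> y - \<gamma> x)"
    using le by (auto simp: eventually_at_filter cseminorm_nonneg[OF p])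
  then show "((\<lambda>y. p (m (u y) (\<gamma> y) - m (u x) (\<gamma> x))) \<longlongrightarrow> 0) (at x within {0..1})"
    by (rule Lim_null_comparison[OF _ lim])
qed

end

text \<open>Instances are the continuous curves over a sequentially complete algebra, the Lipschitz
  curves over a Mackey-complete one, and pairs of such curves. The Lipschitz curves must belong to
  \<open>X\<close> because that is where solutions are first located. \<open>TE\<close> is uniform
  convergence on \<open>X\<close>, \<open>TF\<close> is convergence in
  \<open>C\<^sup>1\<close>.\<close>

locale curve_ode = bounded_mult T m
  for T :: "'b::{real_vector,t2_space} itself" and m :: "'b \<Rightarrow> 'b \<Rightarrow> 'b" +
  fixes X :: "(real \<Rightarrow> 'b) set" and TE TF :: "(real \<Rightarrow> 'b) topology"
  assumes subspace_X: "subspace X"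
    and lipschitz_subset: "lipschitz_curves \<subseteq> X"
    and X_subset: "X \<subseteq> C_curves 0"
    and X_mult: "u \<in> X \<Longrightarrow> \<gamma> \<in> X \<Longrightarrow> (\<lambda>t. m (u t) (\<gamma> t)) \<in> X"
    and antiderivative: "\<gamma> \<in> X \<Longrightarrow>
      \<exists>F\<in>C_curves 1. F 0 = 0 \<and> (\<forall>t\<in>{0..1}. has_curve_deriv F (\<gamma> t) t)"
    and TE: "seminorm_topology TE X (curve_sup ` {p. cseminorm p})"
    and TF: "seminorm_topology TF (C_curves 1) (curve_sup1 ` {p. cseminorm p})"
begin

sublocale E: seminorm_topology TE X "curve_sup ` {p. cseminorm p}" by (rule TE)
sublocale F: seminorm_topology TF "C_curves 1" "curve_sup1 ` {p. cseminorm p}" by (rule TF)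

lemma C1_X: "\<gamma> \<in> C_curves 1 \<Longrightarrow> \<gamma> \<in> X"
  using C_curves_1_subset_lipschitz_curves lipschitz_subset by blast

lemma X_C0: "\<gamma> \<in> X \<Longrightarrow> \<gamma> \<in> C_curves 0"
  using X_subset by blast

lemma X_diff: "\<gamma> \<in> X \<Longrightarrow> \<delta> \<in> X \<Longrightarrow> \<gamma> - \<delta> \<in> X"
  and X_add: "\<gamma> \<in> X \<Longrightarrow> \<delta> \<in> X \<Longrightarrow> \<gamma> + \<delta> \<in> X"
  and X_scaleR: "\<gamma> \<in> X \<Longrightarrow> r *\<^sub>R \<gamma> \<in> X"
  using subspace_X by (auto intro: subspace_diff subspace_add subspace_scale)

definition pmul :: "(real \<Rightarrow> 'b) \<Rightarrow> (real \<Rightarrow> 'b) \<Rightarrow> real \<Rightarrow> 'b" where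
  "pmul u \<gamma> = (\<lambda>t. m (u t) (\<gamma> t))"

lemma X_pmul: "u \<in> X \<Longrightarrow> \<gamma> \<in> X \<Longrightarrow> pmul u \<gamma> \<in> X"
  unfolding pmul_def by (rule X_mult)

lemma pmul_simps:
  "pmul (u + v) \<gamma> = pmul u \<gamma> + pmul v \<gamma>" "pmul u (\<gamma> + \<delta>) = pmul u \<gamma> + pmul u \<delta>"
  "pmul (u - v) \<gamma> = pmul u \<gamma> - pmul v \<gamma>" "pmul u (\<gamma> - \<delta>) = pmul u \<gamma> - pmul u \<delta>"
  "pmul (r *\<^sub>R u) \<gamma> = r *\<^sub>R pmul u \<gamma>" "pmul u (r *\<^sub>R \<gamma>) = r *\<^sub>R pmul u \<gamma>"
  "pmul 0 \<gamma> = 0" "pmul u 0 = 0"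
  by (simp_all add: pmul_def fun_eq_iff scaleR_fun_def mult_add_left mult_add_right mult_diff
      mult_scaleR_left mult_scaleR_right mult_zero)


subsection \<open>Rapidly decreasing series converge\<close>

text \<open>
  The sum is obtained as the integral over \<open>[0,1]\<close> of a Lipschitz curve that, on the interval
  \<open>[2\<^sup>-\<^sup>n\<^sup>-\<^sup>1, 2\<^sup>-\<^sup>n]\<close>, is a multiple of the \<open>n\<close>-th term with integral \<open>x n\<close>. The bump function there
  has height of order \<open>2\<^sup>n\<close> and slopes of order \<open>4\<^sup>n\<close>.
\<close>

definition bump :: "real \<Rightarrow> real \<Rightarrow> real" where
  "bump a t = (let u = max a (min (2 * a) t) in 6 / a ^ 3 * ((u - a) * (2 * a - u)))"

text \<open>On \<open>[a, 2 a]\<close> the slope of \<open>(u - a) (2 a - u)\<close> is at most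
  \<open>a\<close> in modulus, visible in the factor \<open>3 a - u - v\<close>. The normalisation
  \<open>6 / a ^ 3\<close> in \<open>bump\<close> belongs to the integral \<open>a ^ 3 / 6\<close>
  of this parabola.\<close>

lemma bump_lipschitz:
  assumes a: "a > 0"
  shows "\<bar>bump a t - bump a s\<bar> \<le> 6 / a\<^sup>2 * \<bar>t - s\<bar>"
proof -
  define u v where "u = max a (min (2 * a) t)" and "v = max a (min (2 * a) s)"
  have uv: "a \<le> u" "u \<le> 2 * a" "a \<le> v" "v \<le> 2 * a" "\<bar>u - v\<bar> \<le> \<bar>t - s\<bar>"
    using a by (auto simp: u_def v_def)
  have "bump a t - bump a s = 6 / a ^ 3 * ((u - a) * (2 * a - u)) - 6 / a ^ 3 * ((v - a) * (2 * a - v))"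
    by (simp add: bump_def Let_def u_def v_def)
  also have "\<dots> = 6 / a ^ 3 * ((u - v) * (3 * a - u - v))"
    by (simp add: algebra_simps)
  also have "\<bar>\<dots>\<bar> \<le> 6 / a ^ 3 * (\<bar>t - s\<bar> * a)"
    unfolding abs_mult using a uv by (intro mult_mono) auto
  also have "\<dots> = 6 / a\<^sup>2 * \<bar>t - s\<bar>" using a by (simp add: power3_eq_cube power2_eq_square)
  finally show ?thesis .
qed

lemma bump_support:
  assumes "bump a t \<noteq> 0" "a > 0"
  shows "a < t" "t < 2 * a"
proof -
  have "max a (min (2 * a) t) \<noteq> a" "max a (min (2 * a) t) \<noteq> 2 * a"
    using assms(1) by (auto simp: bump_def Let_def)
  then show "a < t" "t < 2 * a" using assms(2) by (auto simp: max_def min_def split: if_splits)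
qed

text \<open>Different dyadic intervals share at most an endpoint, and there the bumps
  vanish.\<close>

lemma bump_unique:
  assumes "bump ((1/2) ^ Suc k) t \<noteq> 0" "(1/2) ^ Suc n \<le> t" "t \<le> 2 * (1/2) ^ Suc n"
  shows "k = n"
proof (rule ccontr)
  assume "k \<noteq> n"
  have k: "(1/2) ^ Suc k < t" "t < 2 * (1/2) ^ Suc k"
    using bump_support[OF assms(1)] by simp_all
  have le: "2 * (1/2) ^ Suc j \<le> ((1/2) ^ Suc i :: real)" if "i < j" for i j
  proof -
    have "((1/2) ^ j :: real) \<le> (1/2) ^ Suc i" using that by (intro power_decreasing) auto
    then show ?thesis by simp
  qed
  show False
  proof (cases "k < n")
    case True
    then show ?thesis using le[OF True] k assms by linarith
  next
    case False
    then show ?thesis using le[of n k] k assms \<open>k \<noteq> n\<close> by linarith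
  qed
qed

lemma rapid_series_converges:
  fixes x :: "nat \<Rightarrow> 'b"
  assumes "\<And>p. cseminorm p \<Longrightarrow> \<exists>C. \<forall>n. 4 ^ n * p (x n) \<le> C"
  shows "\<exists>S. (\<lambda>N. \<Sum>n<N. x n) \<longlonglongrightarrow> S"
proof -
  define h :: "nat \<Rightarrow> real" where "h n = (1/2) ^ Suc n" for n
  have h: "h n > 0" "2 * h n \<le> 1" for n by (auto simp: h_def power_le_one)
  \<comment> \<open>The only index whose bump is nonzero at \<open>t\<close>. If there is none, the
    choice is arbitrary and harmless, since then \<open>c t = 0\<close>.\<close>
  define N where "N t = (SOME n. bump (h n) t \<noteq> 0 \<or> (\<forall>k. bump (h k) t = 0))" for t
  have N: "bump (h (N t)) t \<noteq> 0 \<or> (\<forall>k. bump (h k) t = 0)" for t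
    unfolding N_def by (rule someI_ex) blast
  have N_unique: "bump (h k) t = 0" if "k \<noteq> N t" for k t
    using N[of t] bump_unique[of k t "N t", folded h_def] bump_support[of "h (N t)" t] h(1)[of "N t"] that
    by (meson less_imp_le)
  define c where "c t = bump (h (N t)) t *\<^sub>R x (N t)" for t
  have c_eq: "c t = bump (h n) t *\<^sub>R x n" if "h n \<le> t" "t \<le> 2 * h n" for n t
  proof (cases "n = N t")
    case False
    then have "bump (h n) t = 0" by (rule N_unique)
    moreover have "bump (h (N t)) t = 0" using bump_unique[of "N t" t n, folded h_def] that False by blast
    ultimately show ?thesis by (simp add: c_def)
  qed (simp add: c_def)
  have "c \<in> lipschitz_curves"
    unfolding lipschitz_curves_def
  proof (intro CollectI conjI allI impI)
    fix t :: real assume t: "t \<notin> {0..1}"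
    have "bump (h n) t = 0" for n
    proof (rule ccontr)
      assume "bump (h n) t \<noteq> 0"
      from bump_support[OF this h(1)] show False using t h[of n] by simp
    qed
    then show "c t = 0" by (simp add: c_def)
  next
    fix p :: "'b \<Rightarrow> real" assume p: "cseminorm p"
    obtain C where C: "\<And>n. 4 ^ n * p (x n) \<le> C" using assms[OF p] by blast
    have C0: "C \<ge> 0" using C[of 0] cseminorm_nonneg[OF p, of "x 0"] by simp
    \<comment> \<open>\<open>6 / (h n)\<^sup>2\<close> is \<open>24 * 4 ^ n\<close>; the assumed
      decay of \<open>x n\<close> cancels exactly the power of 4.\<close>
    have one: "p ((bump (h n) t - bump (h n) s) *\<^sub>R x n) \<le> 24 * C * \<bar>t - s\<bar>" for n s t
    proof -
      have "p ((bump (h n) t - bump (h n) s) *\<^sub>R x n) \<le> (6 / (h n)\<^sup>2 * \<bar>t - s\<bar>) * p (x n)"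
        unfolding cseminorm_scale[OF p]
        by (intro mult_right_mono bump_lipschitz cseminorm_nonneg[OF p] h)
      also have "6 / (h n)\<^sup>2 = 24 * 4 ^ n"
        by (simp add: h_def power_divide power_mult_distrib flip: power_mult) (simp add: power_mult mult.commute[of n])
      also have "24 * 4 ^ n * \<bar>t - s\<bar> * p (x n) = 24 * \<bar>t - s\<bar> * (4 ^ n * p (x n))" by simp
      also have "\<dots> \<le> 24 * \<bar>t - s\<bar> * C" by (intro mult_left_mono C) auto
      finally show ?thesis by (simp add: mult_ac)
    qed
    \<comment> \<open>If \<open>s\<close> and \<open>t\<close> lie under different bumps, two terms
      contribute, hence 48 instead of 24.\<close>
    have "p (c t - c s) \<le> 48 * C * \<bar>t - s\<bar>" for s t
    proof (cases "N t = N s")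
      case True
      then have "c t - c s = (bump (h (N t)) t - bump (h (N t)) s) *\<^sub>R x (N t)"
        by (simp add: c_def scaleR_diff_left)
      also have "p \<dots> \<le> 24 * C * \<bar>t - s\<bar>" by (rule one)
      also have "\<dots> \<le> 48 * C * \<bar>t - s\<bar>" using C0 by (intro mult_right_mono) auto
      finally show ?thesis .
    next
      case False
      then have "c t - c s = (bump (h (N t)) t - bump (h (N t)) s) *\<^sub>R x (N t) + (bump (h (N s)) t - bump (h (N s)) s) *\<^sub>R x (N s)"
        using N_unique[of "N t" s] N_unique[of "N s" t] by (simp add: c_def)
      then have "p (c t - c s) \<le> p ((bump (h (N t)) t - bump (h (N t)) s) *\<^sub>R x (N t)) + p ((bump (h (N s)) t - bump (h (N s)) s) *\<^sub>R x (N s))"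
        using cseminorm_add[OF p] by simp
      also have "\<dots> \<le> 24 * C * \<bar>t - s\<bar> + 24 * C * \<bar>t - s\<bar>" by (intro add_mono one)
      finally show ?thesis by simp
    qed
    then show "\<exists>L. \<forall>s\<in>{0..1}. \<forall>t\<in>{0..1}. p (c t - c s) \<le> L * \<bar>t - s\<bar>" by blast
  qed
  then have "c \<in> X" using lipschitz_subset by blast
  from antiderivative[OF this] obtain F
    where F: "F \<in> C_curves 1" "F 0 = 0" and F': "\<forall>t\<in>{0..1}. has_curve_deriv F (c t) t"
    by (elim bexE conjE)
  have step: "F (2 * h n) - F (h n) = x n" for n
  proof -
    define a where "a = h n"
    have a: "a > 0" "2 * a \<le> 1" using h[of n] by (auto simp: a_def)
    \<comment> \<open>An antiderivative of the bump on \<open>[a, 2 a]\<close>; it increases by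
      exactly 1 there.\<close>
    define \<Phi> where "\<Phi> t = 6 / a ^ 3 * (3 * a * t\<^sup>2 / 2 - t ^ 3 / 3 - 2 * a\<^sup>2 * t)" for t
    have "F (2 * a) - F a = \<Phi> (2 * a) *\<^sub>R x n - \<Phi> a *\<^sub>R x n"
    proof (rule curve_eq_if_deriv_eq)
      fix u assume "u \<in> {min (2 * a) a..max (2 * a) a}"
      then have u: "a \<le> u" "u \<le> 2 * a" using a by auto
      then show "has_curve_deriv F (bump (h n) u *\<^sub>R x n) u"
        using bspec[OF F', of u] c_eq[of n u] a by (auto simp: a_def)
      have "(\<Phi> has_real_derivative 6 / a ^ 3 * ((u - a) * (2 * a - u))) (at u)"
        unfolding \<Phi>_def[abs_def]
        by (rule derivative_eq_intros refl | simp)+ (simp add: algebra_simps power2_eq_square)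
      moreover have "bump (h n) u = 6 / a ^ 3 * ((u - a) * (2 * a - u))"
        using u by (simp add: bump_def Let_def max_def min_def flip: a_def)
      ultimately show "has_curve_deriv (\<lambda>t. \<Phi> t *\<^sub>R x n) (bump (h n) u *\<^sub>R x n) u"
        by (simp add: has_curve_deriv_real_scaleR)
    qed (use a in auto)
    also have "\<dots> = (\<Phi> (2 * a) - \<Phi> a) *\<^sub>R x n" by (simp add: scaleR_diff_left)
    also have "\<Phi> (2 * a) - \<Phi> a = 1"
      using a by (simp add: \<Phi>_def field_simps power3_eq_cube power2_eq_square)
    finally show ?thesis by (simp add: a_def)
  qed
  \<comment> \<open>Telescoping: the increments of \<open>F\<close> over the dyadic intervals are
    the terms, and continuity of \<open>F\<close> at 0 gives the limit \<open>F 1\<close>.\<close>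
  have sum: "(\<Sum>n<N. x n) = F 1 - F ((1/2) ^ N)" for N
  proof (induction N)
    case (Suc N)
    have eq: "x N = F ((1/2) ^ N) - F ((1/2) ^ Suc N)" using step[of N] by (simp add: h_def)
    show ?case unfolding sum.lessThan_Suc Suc by (subst eq) simp
  qed simp
  have "continuous_on {0..1} F" using C_curves_1D(3)[OF F(1)] by (simp add: C_curves_0_iff)
  moreover have "(\<lambda>N. (1/2) ^ N :: real) \<longlonglongrightarrow> 0" by (rule LIMSEQ_power_zero) simp
  ultimately have "(\<lambda>N. F ((1/2) ^ N)) \<longlonglongrightarrow> F 0"
    by (rule continuous_on_tendsto_compose) (auto simp: power_le_one)
  then have "(\<lambda>N. F 1 + (-1) *\<^sub>R F ((1/2) ^ N)) \<longlonglongrightarrow> F 1 + (-1) *\<^sub>R F 0"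
    by (intro tendsto_add_seminormed tendsto_scaleR_seminormed tendsto_const)
  then show ?thesis unfolding sum by auto
qed


subsection \<open>Existence, uniqueness and continuous dependence\<close>

text \<open>Gronwall's inequality by a maximum principle: let \<open>M\<close> be the maximum of
  \<open>exp (- l * t) * p (x t)\<close>. Inserting the bound \<open>M * exp (l * s)\<close> into
  the differential inequality and evaluating at a maximum point gives
  \<open>M * l \<le> R * M + W\<close>, which bounds \<open>M\<close> because
  \<open>R < l\<close>.\<close>

lemma weighted_bound:
  fixes x :: "real \<Rightarrow> 'b"
  assumes p: "cseminorm p" and x0: "x 0 = 0"
    and der: "\<And>t. t \<in> {0..1} \<Longrightarrow> has_curve_deriv x (x' t) t"
    and le: "\<And>t. t \<in> {0..1} \<Longrightarrow> p (x' t) \<le> R * p (x t) + W * exp (l * t)"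
    and R: "0 \<le> R" "R < l" and W: "0 \<le> W" and t: "t \<in> {0..1}"
  shows "p (x t) \<le> W / (l - R) * exp (l * t)"
proof -
  have "continuous_on {0..1} x" by (rule has_curve_deriv_imp_continuous_on[OF der])
  then have "continuous_on {0..1} (\<lambda>s. exp (- l * s) * p (x s))"
    by (intro continuous_on_mult continuous_intros continuous_on_compose2[OF cseminorm_cont[OF p]]) auto
  then obtain t0 where t0: "t0 \<in> {0..1}"
    "\<And>s. s \<in> {0..1} \<Longrightarrow> exp (- l * s) * p (x s) \<le> exp (- l * t0) * p (x t0)"
    using continuous_attains_sup[of "{0..1}" "\<lambda>s. exp (- l * s) * p (x s)"] by auto
  define M where "M = exp (- l * t0) * p (x t0)"
  have M: "M \<ge> 0" using cseminorm_nonneg[OF p] by (simp add: M_def)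
  have xM: "p (x s) \<le> M * exp (l * s)" if "s \<in> {0..1}" for s
  proof -
    have "exp (l * s) * (exp (- l * s) * p (x s)) \<le> exp (l * s) * M"
      using t0(2)[OF that] unfolding M_def by (intro mult_left_mono) auto
    moreover have "exp (l * s) * (exp (- l * s) * p (x s)) = p (x s)"
      by (simp add: exp_minus_inverse flip: mult.assoc)
    ultimately show ?thesis by (simp only: mult.commute)
  qed
  have l: "l > 0" using R by simp
  have "p (x t0 - x 0) \<le> (R * M + W) / l * exp (l * t0) - (R * M + W) / l * exp (l * 0)"
  proof (rule curve_mean_value_bound[OF p, where f' = x' and \<phi>' = "\<lambda>s. (R * M + W) * exp (l * s)"])
    fix u assume "u \<in> {0..t0}"
    then have u: "u \<in> {0..1}" using t0(1) by auto
    show "has_curve_deriv x (x' u) u" by (rule der[OF u])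
    show "((\<lambda>s. (R * M + W) / l * exp (l * s)) has_real_derivative (R * M + W) * exp (l * u)) (at u)"
      using l by (auto intro!: derivative_eq_intros)
    have "p (x' u) \<le> R * (M * exp (l * u)) + W * exp (l * u)"
      using le[OF u] mult_left_mono[OF xM[OF u] R(1)] by simp
    then show "p (x' u) \<le> (R * M + W) * exp (l * u)" by (simp add: algebra_simps)
  qed (use t0(1) in auto)
  also have "\<dots> \<le> (R * M + W) / l * exp (l * t0)" using R M W l by simp
  finally have "p (x t0) \<le> (R * M + W) / l * exp (l * t0)" by (simp add: x0)
  then have "exp (- l * t0) * p (x t0) \<le> exp (- l * t0) * ((R * M + W) / l * exp (l * t0))"
    by (intro mult_left_mono) auto
  also have "\<dots> = (exp (l * t0) * exp (- (l * t0))) * ((R * M + W) / l)" by (simp add: mult_ac)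
  also have "\<dots> = (R * M + W) / l" by (simp only: exp_minus_inverse mult_1)
  finally have "M * l \<le> R * M + W" using l by (simp add: M_def field_simps)
  then have "M \<le> W / (l - R)" using R by (simp add: field_simps)
  then have "M * exp (l * t) \<le> W / (l - R) * exp (l * t)" by (intro mult_right_mono) auto
  then show ?thesis using xM[OF t] by simp
qed

definition solves :: "(real \<Rightarrow> 'b) \<Rightarrow> (real \<Rightarrow> 'b) \<Rightarrow> (real \<Rightarrow> 'b) \<Rightarrow> bool" where
  "solves \<gamma> w x \<longleftrightarrow> x \<in> C_curves 1 \<and> x 0 = 0 \<and>
     (\<forall>t\<in>{0..1}. has_curve_deriv x (m (x t) (\<gamma> t) + w t) t)"

text \<open>The operator \<open>T\<^sub>\<gamma> w\<close> of the overview; the description is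
  meaningful for \<open>\<gamma>\<close> and \<open>w\<close> in \<open>X\<close>.\<close>

definition sol :: "(real \<Rightarrow> 'b) \<Rightarrow> (real \<Rightarrow> 'b) \<Rightarrow> real \<Rightarrow> 'b" where
  "sol \<gamma> w = (THE x. solves \<gamma> w x)"

lemma solves_bound:
  assumes x: "solves \<gamma> w x" and p: "cseminorm p" and mb: "\<And>x y. p (m x y) \<le> p x * q y"
    and R: "\<And>t. t \<in> {0..1} \<Longrightarrow> q (\<gamma> t) \<le> R" "0 \<le> R" "R < l"
    and W: "\<And>t. t \<in> {0..1} \<Longrightarrow> p (w t) \<le> W * exp (l * t)" "0 \<le> W" and t: "t \<in> {0..1}"
  shows "p (x t) \<le> W / (l - R) * exp (l * t)"
proof (rule weighted_bound[OF p _ _ _ R(2,3) W(2) t])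
  show "x 0 = 0" using x by (simp add: solves_def)
  fix s assume s: "s \<in> {0..1::real}"
  show "has_curve_deriv x (m (x s) (\<gamma> s) + w s) s" using x s by (simp add: solves_def)
  have "p (m (x s) (\<gamma> s) + w s) \<le> p (m (x s) (\<gamma> s)) + p (w s)" by (rule cseminorm_add[OF p])
  also have "p (m (x s) (\<gamma> s)) \<le> p (x s) * R"
    using mb[of "x s" "\<gamma> s"] mult_left_mono[OF R(1)[OF s] cseminorm_nonneg[OF p, of "x s"]] by simp
  finally show "p (m (x s) (\<gamma> s) + w s) \<le> R * p (x s) + W * exp (l * s)"
    using W(1)[OF s] by (simp add: mult.commute)
qed

text \<open>Since \<open>y \<delta> - x \<gamma> = (y - x) \<delta> + x (\<delta> -
  \<gamma>)\<close>, differences of solutions stay within the class of equations handled by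
  \<open>sol\<close>. Uniqueness, continuous dependence, the remainder formula and the directional
  derivatives all reduce to this.\<close>

lemma solves_diff:
  assumes "solves \<gamma> w x" "solves \<delta> v y"
  shows "solves \<delta> (pmul x (\<delta> - \<gamma>) + (v - w)) (y - x)"
  unfolding solves_def
proof (intro conjI ballI)
  show "y - x \<in> C_curves 1" "(y - x) 0 = 0"
    using assms subspace_diff[OF subspace_C_curves_1] by (auto simp: solves_def)
  fix t assume t: "t \<in> {0..1::real}"
  have "has_curve_deriv (\<lambda>s. y s - x s) ((m (y t) (\<delta> t) + v t) - (m (x t) (\<gamma> t) + w t)) t"
    using assms t by (intro has_curve_deriv_diff) (auto simp: solves_def)
  moreover have "(m (y t) (\<delta> t) + v t) - (m (x t) (\<gamma> t) + w t) =
      m ((y - x) t) (\<delta> t) + (pmul x (\<delta> - \<gamma>) + (v - w)) t"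
    by (simp add: pmul_def mult_diff)
  ultimately show "has_curve_deriv (y - x) (m ((y - x) t) (\<delta> t) + (pmul x (\<delta> - \<gamma>) + (v - w)) t) t"
    by (simp add: fun_diff_def)
qed

lemma solves_add:
  assumes "solves \<gamma> w x" "solves \<gamma> v y"
  shows "solves \<gamma> (w + v) (x + y)"
  unfolding solves_def
proof (intro conjI ballI)
  show "x + y \<in> C_curves 1" "(x + y) 0 = 0"
    using assms subspace_add[OF subspace_C_curves_1] by (auto simp: solves_def)
  fix t assume t: "t \<in> {0..1::real}"
  have "has_curve_deriv (\<lambda>s. x s + y s) ((m (x t) (\<gamma> t) + w t) + (m (y t) (\<gamma> t) + v t)) t"
    using assms t by (intro has_curve_deriv_add) (auto simp: solves_def)
  then show "has_curve_deriv (x + y) (m ((x + y) t) (\<gamma> t) + (w + v) t) t"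
    by (simp add: plus_fun_def mult_add_left algebra_simps)
qed

lemma solves_scaleR:
  assumes "solves \<gamma> w x"
  shows "solves \<gamma> (r *\<^sub>R w) (r *\<^sub>R x)"
  unfolding solves_def
proof (intro conjI ballI)
  show "r *\<^sub>R x \<in> C_curves 1" "(r *\<^sub>R x) 0 = 0"
    using assms subspace_scale[OF subspace_C_curves_1] by (auto simp: solves_def scaleR_fun_def)
  fix t assume t: "t \<in> {0..1::real}"
  have "has_curve_deriv (\<lambda>s. r *\<^sub>R x s) (r *\<^sub>R (m (x t) (\<gamma> t) + w t)) t"
    using assms t by (intro has_curve_deriv_scaleR) (auto simp: solves_def)
  then show "has_curve_deriv (r *\<^sub>R x) (m ((r *\<^sub>R x) t) (\<gamma> t) + (r *\<^sub>R w) t) t"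
    by (simp add: scaleR_fun_def mult_scaleR_left scaleR_add_right)
qed

text \<open>The difference of two solutions has inhomogeneity 0, and the weighted bound with
  \<open>W = 0\<close> annihilates it in every seminorm \<open>p'\<close>.\<close>

lemma solves_unique:
  assumes "solves \<gamma> w x" "solves \<gamma> w y" "\<gamma> \<in> X"
  shows "x = y"
proof
  fix t
  have z: "solves \<gamma> 0 (y - x)"
    using solves_diff[OF assms(1,2)] by (simp add: pmul_simps)
  show "x t = y t"
  proof (cases "t \<in> {0..1}")
    case True
    have "(y - x) t = 0"
    proof (rule eq_zero_if_cseminorm_le)
      fix p :: "'b \<Rightarrow> real" assume "cseminorm p"
      then obtain p' q' where pq: "cseminorm p'" "cseminorm q'" "\<And>x. p x \<le> p' x"
        "\<And>x y. p' (m x y) \<le> p' x * q' y"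
        using mult_bound by meson
      have "p' ((y - x) t) \<le> 0 / (curve_sup q' \<gamma> + 1 - curve_sup q' \<gamma>) * exp ((curve_sup q' \<gamma> + 1) * t)"
        by (rule solves_bound[OF z pq(1,4) _ _ _ _ _ True])
          (auto simp: curve_sup_upper[OF X_C0[OF assms(3)] pq(2)] curve_sup_nonneg[OF X_C0[OF assms(3)] pq(2)] cseminorm_zero[OF pq(1)])
      then show "p ((y - x) t) \<le> 0" using pq(3)[of "(y - x) t"] by simp
    qed
    then show ?thesis by simp
  next
    case False
    then show ?thesis using assms C_curves_outside by (metis solves_def)
  qed
qed

lemma sol_eqI: "solves \<gamma> w x \<Longrightarrow> \<gamma> \<in> X \<Longrightarrow> sol \<gamma> w = x"
  unfolding sol_def using solves_unique by blast

lemma solution_exists: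
  assumes \<gamma>: "\<gamma> \<in> X" and w: "w \<in> X"
  shows "\<exists>x. solves \<gamma> w x"
proof -
  define AD where "AD \<gamma> = (SOME F. F \<in> C_curves 1 \<and> F 0 = 0 \<and> (\<forall>t\<in>{0..1}. has_curve_deriv F (\<gamma> t) t))" for \<gamma> :: "real \<Rightarrow> 'b"
  have AD: "AD \<gamma> \<in> C_curves 1 \<and> AD \<gamma> 0 = 0 \<and> (\<forall>t\<in>{0..1}. has_curve_deriv (AD \<gamma>) (\<gamma> t) t)" if "\<gamma> \<in> X" for \<gamma>
    unfolding AD_def using someI_ex[OF antiderivative[OF that, unfolded Bex_def]] .
  \<comment> \<open>Increments of the Picard iteration instead of the iterates: the solution will be
    their sum.\<close>
  define u where "u = rec_nat (AD w) (\<lambda>_ v. AD (pmul v \<gamma>))"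
  have u0: "u 0 = AD w" and uS: "u (Suc n) = AD (pmul (u n) \<gamma>)" for n by (simp_all add: u_def)
  have uC: "u n \<in> C_curves 1" for n
  proof (induction n)
    case 0
    show ?case using AD[OF w] by (simp add: u0)
  next
    case (Suc n)
    show ?case using AD[OF X_pmul[OF C1_X[OF Suc] \<gamma>]] by (simp add: uS)
  qed
  have uz: "u n 0 = 0" for n
    using AD[OF w] AD[OF X_pmul[OF C1_X[OF uC] \<gamma>]] by (cases n) (auto simp: u0 uS)
  have ud0: "has_curve_deriv (u 0) (w t) t" if "t \<in> {0..1}" for t
    using AD[OF w] that by (simp add: u0)
  have udS: "has_curve_deriv (u (Suc n)) (m (u n t) (\<gamma> t)) t" if "t \<in> {0..1}" for n t
    using AD[OF X_pmul[OF C1_X[OF uC] \<gamma>], of n] that by (simp add: uS pmul_def)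
  have decay: "\<exists>C\<ge>0. \<forall>n. \<forall>t\<in>{0..1}. p (u n t) \<le> C * (1/8) ^ n" if p: "cseminorm p" for p
  proof -
    obtain p' q' where pq: "cseminorm p'" "cseminorm q'" "\<And>x. p x \<le> p' x"
      "\<And>x y. p' (m x y) \<le> p' x * q' y"
      using mult_bound[OF p] by meson
    define R where "R = curve_sup q' \<gamma>"
    define W where "W = curve_sup p' w"
    have R: "R \<ge> 0" and W: "W \<ge> 0"
      unfolding R_def W_def using \<gamma> w pq X_C0 by (auto intro: curve_sup_nonneg)
    \<comment> \<open>In the weighted norm one integration gains \<open>R / l \<le> 1 / 8\<close>,
      more than the factor 4 per term that \<open>rapid_series_converges\<close> requires; the
      summand 1 keeps \<open>l\<close> positive.\<close>
    define l where "l = 8 * R + 1"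
    have l: "l > 0" "R / l \<le> 1 / 8" using R by (auto simp: l_def field_simps)
    have *: "p' (u n t) \<le> W / l * (1/8) ^ n * exp (l * t)" if t: "t \<in> {0..1}" for n t
      using t
    proof (induction n arbitrary: t)
      case 0
      have "p' (u 0 t) \<le> W / (l - 0) * exp (l * t)"
      proof (rule weighted_bound[OF pq(1) uz ud0 _ _ l(1) W 0])
        fix s assume s: "s \<in> {0..1::real}"
        have "W * 1 \<le> W * exp (l * s)" using s l W by (intro mult_left_mono) auto
        then show "p' (w s) \<le> 0 * p' (u 0 s) + W * exp (l * s)"
          using curve_sup_upper[OF X_C0[OF w] pq(1) s] by (simp add: W_def)
      qed auto
      then show ?case by simp
    next
      case (Suc n)
      have "p' (u (Suc n) t) \<le> (W / l * (1/8) ^ n * R) / (l - 0) * exp (l * t)"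
      proof (rule weighted_bound[OF pq(1) uz udS _ _ l(1) _ Suc.prems])
        fix s assume s: "s \<in> {0..1::real}"
        have "p' (m (u n s) (\<gamma> s)) \<le> p' (u n s) * q' (\<gamma> s)" by (rule pq(4))
        also have "\<dots> \<le> (W / l * (1/8) ^ n * exp (l * s)) * R"
          using Suc.IH[OF s] curve_sup_upper[OF X_C0[OF \<gamma>] pq(2) s] W l
          by (intro mult_mono) (auto simp: R_def cseminorm_nonneg pq)
        finally show "p' (m (u n s) (\<gamma> s)) \<le> 0 * p' (u (Suc n) s) + W / l * (1/8) ^ n * R * exp (l * s)"
          by (simp add: mult_ac)
      qed (use W R l in auto)
      also have "(W / l * (1/8) ^ n * R) / (l - 0) = (W / l * (1/8) ^ n) * (R / l)" by simp
      also have "\<dots> \<le> (W / l * (1/8) ^ n) * (1 / 8)" using l W by (intro mult_left_mono) auto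
      finally show ?case by (simp add: mult_ac)
    qed
    have "p (u n t) \<le> W / l * exp l * (1/8) ^ n" if t: "t \<in> {0..1}" for n t
    proof -
      have "exp (l * t) \<le> exp l" using t l by (simp add: mult_left_le)
      then have "W / l * (1/8) ^ n * exp (l * t) \<le> W / l * (1/8) ^ n * exp l"
        using W l by (intro mult_left_mono) auto
      then show ?thesis using *[OF t, of n] pq(3)[of "u n t"] by (simp add: mult_ac)
    qed
    moreover have "W / l * exp l \<ge> 0" using W l by simp
    ultimately show ?thesis by blast
  qed
  have conv: "\<exists>S. (\<lambda>N. \<Sum>n<N. u n t) \<longlonglongrightarrow> S" if t: "t \<in> {0..1}" for t
  proof (rule rapid_series_converges)
    fix p :: "'b \<Rightarrow> real" assume p: "cseminorm p"
    obtain C where C: "C \<ge> 0" "\<And>n. p (u n t) \<le> C * (1/8) ^ n" using decay[OF p] t by blast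
    have "4 ^ n * p (u n t) \<le> C" for n
    proof -
      have "4 ^ n * p (u n t) \<le> 4 ^ n * (C * (1/8) ^ n)" by (intro mult_left_mono C) auto
      also have "\<dots> = C * (1/2) ^ n" by (simp add: power_mult_distrib[symmetric] mult_ac)
      also have "\<dots> \<le> C * 1" using C by (intro mult_left_mono power_le_one) auto
      finally show ?thesis by simp
    qed
    then show "\<exists>C. \<forall>n. 4 ^ n * p (u n t) \<le> C" by blast
  qed
  define s where "s N t = (\<Sum>n<N. u n t)" for N t
  define x where "x t = (if t \<in> {0..1} then (SOME S. (\<lambda>N. s N t) \<longlonglongrightarrow> S) else 0)" for t
  have x: "(\<lambda>N. s N t) \<longlonglongrightarrow> x t" if "t \<in> {0..1}" for t
    using someI_ex[OF conv[OF that]] that by (simp add: x_def s_def)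
  have tail: "\<exists>C\<ge>0. \<forall>N. \<forall>t\<in>{0..1}. p (s N t - x t) \<le> C * (1/8) ^ N \<and> p (s N t) \<le> C" if p: "cseminorm p" for p
  proof -
    obtain C where C: "C \<ge> 0" "\<And>n t. t \<in> {0..1} \<Longrightarrow> p (u n t) \<le> C * (1/8) ^ n" using decay[OF p] by blast
    \<comment> \<open>A geometric tail. The subtracted term strengthens the claim so that the
      induction on \<open>k\<close> closes.\<close>
    have *: "p (s (N + k) t - s N t) \<le> 2 * C * (1/8) ^ N - 2 * C * (1/8) ^ (N + k)" if t: "t \<in> {0..1}" for N k t
    proof (induction k)
      case (Suc k)
      have eq: "s (N + Suc k) t - s N t = (s (N + k) t - s N t) + u (N + k) t" by (simp add: s_def)
      have "p (s (N + Suc k) t - s N t) \<le> p (s (N + k) t - s N t) + p (u (N + k) t)"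
        unfolding eq by (rule cseminorm_add[OF p])
      also have "\<dots> \<le> (2 * C * (1/8) ^ N - 2 * C * (1/8) ^ (N + k)) + C * (1/8) ^ (N + k)"
        by (intro add_mono Suc C t)
      also have "\<dots> \<le> 2 * C * (1/8) ^ N - 2 * C * (1/8) ^ (N + Suc k)"
        using C(1) by (simp add: field_simps)
      finally show ?case .
    qed (simp add: cseminorm_zero[OF p])
    have le: "p (s M t - s N t) \<le> 2 * C * (1/8) ^ N" if "t \<in> {0..1}" "N \<le> M" for M N t
      using *[OF that(1), of N "M - N"] that(2) C(1)
      by (simp add: add_increasing2 order_trans[OF _ diff_left_mono[of 0, simplified]])
         (smt (verit) zero_le_power divide_nonneg_nonneg mult_nonneg_nonneg zero_le_mult_iff)
    have "p (s N t - x t) \<le> 2 * C * (1/8) ^ N" if t: "t \<in> {0..1}" for N t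
    proof (rule tendsto_upperbound)
      have "(\<lambda>M. s N t + (-1) *\<^sub>R s M t) \<longlonglongrightarrow> s N t + (-1) *\<^sub>R x t"
        by (intro tendsto_add_seminormed tendsto_scaleR_seminormed tendsto_const x t)
      from tendsto_cseminorm_comp[OF this p] show "(\<lambda>M. p (s N t - s M t)) \<longlonglongrightarrow> p (s N t - x t)" by simp
      show "\<forall>\<^sub>F M in sequentially. p (s N t - s M t) \<le> 2 * C * (1/8) ^ N"
        using eventually_ge_at_top[of N]
        by eventually_elim (subst cseminorm_commute[OF p], rule le[OF t])
    qed simp
    moreover have "p (s N t) \<le> 2 * C" if t: "t \<in> {0..1}" for N t
      using le[OF t, of 0 N] by (simp add: s_def)
    ultimately show ?thesis using C(1) by (intro exI[of _ "2 * C"]) auto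
  qed
  \<comment> \<open>The index shifts by one: differentiating \<open>s (Suc N)\<close> produces
    \<open>s N\<close> on the right-hand side, as in Picard iteration.\<close>
  have sd: "has_curve_deriv (s (Suc N)) (m (s N t) (\<gamma> t) + w t) t" if t: "t \<in> {0..1}" for N t
  proof (induction N)
    case 0
    then show ?case using ud0[OF t] by (simp add: s_def[abs_def] mult_zero)
  next
    case (Suc N)
    have "has_curve_deriv (\<lambda>t. s (Suc N) t + u (Suc N) t) ((m (s N t) (\<gamma> t) + w t) + m (u N t) (\<gamma> t)) t"
      by (rule has_curve_deriv_add[OF Suc udS[OF t]])
    then show ?case by (simp add: s_def[abs_def] mult_add_left algebra_simps)
  qed
  have xout: "x t = 0" if "t \<notin> {0..1}" for t using that unfolding x_def by (rule if_not_P)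
  \<comment> \<open>Uniform convergence would only make \<open>x\<close> continuous, too little if
    \<open>X\<close> consists of Lipschitz curves. The partial sums have a common Lipschitz constant
    for each seminorm, which the limit inherits; closure of \<open>X\<close> under products then
    makes the right-hand side of the equation continuous.\<close>
  have "x \<in> lipschitz_curves"
    unfolding lipschitz_curves_def
  proof (intro CollectI conjI allI impI)
    show "x t = 0" if "t \<notin> {0..1}" for t by (rule xout[OF that])
    fix p :: "'b \<Rightarrow> real" assume p: "cseminorm p"
    obtain p' q' where pq: "cseminorm p'" "cseminorm q'" "\<And>x. p x \<le> p' x"
      "\<And>x y. p' (m x y) \<le> p' x * q' y"
      using mult_bound[OF p] by meson
    obtain C where C: "C \<ge> 0" "\<And>N t. t \<in> {0..1} \<Longrightarrow> p' (s N t) \<le> C" using tail[OF pq(1)] by blast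
    define L where "L = C * curve_sup q' \<gamma> + curve_sup p' w"
    have sL: "p (s (Suc N) t - s (Suc N) r) \<le> L * \<bar>t - r\<bar>" if rt: "r \<in> {0..1}" "t \<in> {0..1}" for N r t
    proof -
      have "p (s (Suc N) t - s (Suc N) r - (t - r) *\<^sub>R 0) \<le> L * \<bar>t - r\<bar>"
      proof (rule curve_lipschitz_bound[OF p rt(2,1)])
        fix v assume "v \<in> {min t r..max t r}"
        then have v: "v \<in> {0..1}" using rt by auto
        show "has_curve_deriv (s (Suc N)) (m (s N v) (\<gamma> v) + w v) v" by (rule sd[OF v])
        have "p (m (s N v) (\<gamma> v) + w v) \<le> p' (m (s N v) (\<gamma> v)) + p' (w v)"
          using pq(3) cseminorm_add[OF pq(1)] order_trans by blast
        also have "\<dots> \<le> C * curve_sup q' \<gamma> + curve_sup p' w"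
        proof (intro add_mono)
          have "p' (m (s N v) (\<gamma> v)) \<le> p' (s N v) * q' (\<gamma> v)" by (rule pq(4))
          also have "\<dots> \<le> C * curve_sup q' \<gamma>"
            using C v by (intro mult_mono curve_sup_upper[OF X_C0[OF \<gamma>] pq(2)] cseminorm_nonneg[OF pq(2)]) auto
          finally show "p' (m (s N v) (\<gamma> v)) \<le> C * curve_sup q' \<gamma>" .
          show "p' (w v) \<le> curve_sup p' w" by (rule curve_sup_upper[OF X_C0[OF w] pq(1) v])
        qed
        finally show "p (m (s N v) (\<gamma> v) + w v - 0) \<le> L" by (simp add: L_def)
      qed
      then show ?thesis by simp
    qed
    have "p (x t - x r) \<le> L * \<bar>t - r\<bar>" if rt: "r \<in> {0..1}" "t \<in> {0..1}" for r t
    proof (rule tendsto_upperbound)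
      have "(\<lambda>N. s (Suc N) t + (-1) *\<^sub>R s (Suc N) r) \<longlonglongrightarrow> x t + (-1) *\<^sub>R x r"
        by (intro tendsto_add_seminormed tendsto_scaleR_seminormed LIMSEQ_Suc x rt)
      from tendsto_cseminorm_comp[OF this p]
      show "(\<lambda>N. p (s (Suc N) t - s (Suc N) r)) \<longlonglongrightarrow> p (x t - x r)" by simp
      show "\<forall>\<^sub>F N in sequentially. p (s (Suc N) t - s (Suc N) r) \<le> L * \<bar>t - r\<bar>"
        using sL[OF rt] by simp
    qed simp
    then show "\<exists>L. \<forall>s\<in>{0..1}. \<forall>t\<in>{0..1}. p (x t - x s) \<le> L * \<bar>t - s\<bar>" by blast
  qed
  then have xX: "x \<in> X" using lipschitz_subset by blast
  have cont: "continuous_on {0..1} (\<lambda>t. m (x t) (\<gamma> t) + w t)"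
    using X_C0[OF X_add[OF X_pmul[OF xX \<gamma>] w]] by (simp add: C_curves_0_iff pmul_def plus_fun_def)
  have xd: "has_curve_deriv x (m (x t) (\<gamma> t) + w t) t" if t: "t \<in> {0..1}" for t
  proof (rule has_curve_deriv_limit[OF sd _ _ cont t])
    show "(\<lambda>n. s (Suc n) t) \<longlonglongrightarrow> x t" if "t \<in> {0..1}" for t by (intro LIMSEQ_Suc x that)
    fix p e assume p: "cseminorm (p :: 'b \<Rightarrow> real)" and e: "(e::real) > 0"
    obtain p' q' where pq: "cseminorm p'" "cseminorm q'" "\<And>x. p x \<le> p' x"
      "\<And>x y. p' (m x y) \<le> p' x * q' y"
      using mult_bound[OF p] by meson
    obtain C where C: "C \<ge> 0" "\<And>N t. t \<in> {0..1} \<Longrightarrow> p' (s N t - x t) \<le> C * (1/8) ^ N"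
      using tail[OF pq(1)] by blast
    have "(\<lambda>N. C * (1/8) ^ N * curve_sup q' \<gamma>) \<longlonglongrightarrow> C * 0 * curve_sup q' \<gamma>"
      by (intro tendsto_intros LIMSEQ_power_zero) auto
    then have "\<forall>\<^sub>F N in sequentially. C * (1/8) ^ N * curve_sup q' \<gamma> < e"
      using e by (intro order_tendstoD) auto
    then show "\<forall>\<^sub>F N in sequentially. \<forall>t\<in>{0..1}. p (m (s N t) (\<gamma> t) + w t - (m (x t) (\<gamma> t) + w t)) \<le> e"
    proof eventually_elim
      case (elim N)
      show ?case
      proof
        fix t assume t: "t \<in> {0..1::real}"
        have "m (s N t) (\<gamma> t) + w t - (m (x t) (\<gamma> t) + w t) = m (s N t - x t) (\<gamma> t)"
          by (simp add: mult_diff)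
        also have "p \<dots> \<le> p' (s N t - x t) * q' (\<gamma> t)" using pq(3,4) order_trans by blast
        also have "\<dots> \<le> (C * (1/8) ^ N) * curve_sup q' \<gamma>"
          using C t by (intro mult_mono curve_sup_upper[OF X_C0[OF \<gamma>] pq(2)] cseminorm_nonneg[OF pq(2)]) auto
        finally show "p (m (s N t) (\<gamma> t) + w t - (m (x t) (\<gamma> t) + w t)) \<le> e" using elim by simp
      qed
    qed
  qed
  have "x 0 = 0"
  proof -
    have "s N 0 = 0" for N by (simp add: s_def uz)
    then have "(\<lambda>_::nat. 0) \<longlonglongrightarrow> x 0" using x[of 0] by simp
    then show ?thesis by (simp add: LIMSEQ_const_iff)
  qed
  moreover have "x \<in> C_curves 1" by (rule C_curves_1I[OF xout xd cont])
  ultimately show ?thesis using xd unfolding solves_def by blast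
qed

lemma solves_sol: "\<gamma> \<in> X \<Longrightarrow> w \<in> X \<Longrightarrow> solves \<gamma> w (sol \<gamma> w)"
  using solution_exists sol_eqI by metis

lemma sol_C1: "\<gamma> \<in> X \<Longrightarrow> w \<in> X \<Longrightarrow> sol \<gamma> w \<in> C_curves 1"
  using solves_sol by (simp add: solves_def)

text \<open>Limits are taken along an arbitrary filter, so that the same lemmas serve for continuity
  at a point (\<open>atin\<close>), for series (\<open>sequentially\<close>) and for difference
  quotients (\<open>at 0\<close>).\<close>

lemma limitin_TE_I:
  assumes l: "l \<in> X" and f: "\<forall>\<^sub>F z in Fl. f z \<in> X"
    and lim: "\<And>p. cseminorm p \<Longrightarrow> \<exists>h. (h \<longlongrightarrow> 0) Fl \<and> (\<forall>\<^sub>F z in Fl. \<forall>t\<in>{0..1}. p (f z t - l t) \<le> h z)"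
  shows "limitin TE f l Fl"
  unfolding E.limitin_iff
proof (intro conjI l f ballI)
  fix Q assume "Q \<in> curve_sup ` {p :: 'b \<Rightarrow> real. cseminorm p}"
  then obtain p where p: "Q = curve_sup p" "cseminorm (p :: 'b \<Rightarrow> real)" by blast
  obtain h where h: "(h \<longlongrightarrow> 0) Fl" "\<forall>\<^sub>F z in Fl. \<forall>t\<in>{0..1}. p (f z t - l t) \<le> h z"
    using lim[OF p(2)] by blast
  have "\<forall>\<^sub>F z in Fl. norm (curve_sup p (f z - l)) \<le> h z"
    using h(2) f
  proof eventually_elim
    case (elim z)
    have "curve_sup p (f z - l) \<ge> 0" using elim l p X_C0[OF X_diff] by (intro curve_sup_nonneg) auto
    moreover have "curve_sup p (f z - l) \<le> h z" using elim by (intro curve_sup_least) simp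
    ultimately show ?case by simp
  qed
  then show "((\<lambda>z. Q (f z - l)) \<longlongrightarrow> 0) Fl"
    unfolding p(1) by (rule Lim_null_comparison[OF _ h(1)])
qed

lemma limitin_TE_D:
  assumes "limitin TE f l Fl" "cseminorm p"
  shows "((\<lambda>z. curve_sup p (f z - l)) \<longlongrightarrow> 0) Fl"
    and "\<forall>\<^sub>F z in Fl. f z \<in> X \<and> curve_sup p (f z - l) \<ge> 0 \<and> (\<forall>t\<in>{0..1}. p (f z t - l t) \<le> curve_sup p (f z - l))"
proof -
  show "((\<lambda>z. curve_sup p (f z - l)) \<longlongrightarrow> 0) Fl" using assms unfolding E.limitin_iff by blast
  have l: "l \<in> X" using assms unfolding E.limitin_iff by blast
  have "\<forall>\<^sub>F z in Fl. f z \<in> X" using assms unfolding E.limitin_iff by blast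
  then show "\<forall>\<^sub>F z in Fl. f z \<in> X \<and> curve_sup p (f z - l) \<ge> 0 \<and> (\<forall>t\<in>{0..1}. p (f z t - l t) \<le> curve_sup p (f z - l))"
  proof eventually_elim
    case (elim z)
    have "f z - l \<in> C_curves 0" using elim l X_C0[OF X_diff] by blast
    then show ?case using elim curve_sup_upper[OF _ assms(2), of "f z - l"] curve_sup_nonneg[OF _ assms(2)] by auto
  qed
qed

lemma limitin_pmul:
  assumes u: "limitin TE u U Fl" and g: "limitin TE g \<gamma> Fl"
  shows "limitin TE (\<lambda>z. pmul (u z) (g z)) (pmul U \<gamma>) Fl"
proof (rule limitin_TE_I)
  have U: "U \<in> X" and G: "\<gamma> \<in> X" using u g unfolding E.limitin_iff by blast+
  have uX: "\<forall>\<^sub>F z in Fl. u z \<in> X" and gX: "\<forall>\<^sub>F z in Fl. g z \<in> X" using u g unfolding E.limitin_iff by blast+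
  show "pmul U \<gamma> \<in> X" by (rule X_pmul[OF U G])
  show "\<forall>\<^sub>F z in Fl. pmul (u z) (g z) \<in> X" using uX gX by eventually_elim (rule X_pmul)
  fix p :: "'b \<Rightarrow> real" assume p: "cseminorm p"
  obtain p' q' where pq: "cseminorm p'" "cseminorm q'" "\<And>x. p x \<le> p' x"
    "\<And>x y. p' (m x y) \<le> p' x * q' y"
    using mult_bound[OF p] by meson
  define h where "h z = curve_sup p' (u z - U) * (curve_sup q' (g z - \<gamma>) + curve_sup q' \<gamma>) +
    curve_sup p' U * curve_sup q' (g z - \<gamma>)" for z
  have "(h \<longlongrightarrow> 0 * (0 + curve_sup q' \<gamma>) + curve_sup p' U * 0) Fl"
    unfolding h_def[abs_def] using limitin_TE_D(1)[OF u pq(1)] limitin_TE_D(1)[OF g pq(2)]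
    by (intro tendsto_intros)
  moreover have "\<forall>\<^sub>F z in Fl. \<forall>t\<in>{0..1}. p (pmul (u z) (g z) t - pmul U \<gamma> t) \<le> h z"
    using limitin_TE_D(2)[OF u pq(1)] limitin_TE_D(2)[OF g pq(2)]
  proof eventually_elim
    case (elim z)
    show ?case
    proof
      fix t assume t: "t \<in> {0..1::real}"
      have "pmul (u z) (g z) t - pmul U \<gamma> t = m (u z t - U t) (g z t) + m (U t) (g z t - \<gamma> t)"
        by (simp add: pmul_def mult_diff)
      also have "p \<dots> \<le> p' (m (u z t - U t) (g z t)) + p' (m (U t) (g z t - \<gamma> t))"
        using pq(3) cseminorm_add[OF pq(1)] order_trans by blast
      also have "\<dots> \<le> h z"
        unfolding h_def
      proof (intro add_mono)
        have "q' (g z t) \<le> q' (g z t - \<gamma> t) + q' (\<gamma> t)"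
          using cseminorm_add[OF pq(2), of "g z t - \<gamma> t" "\<gamma> t"] by simp
        also have "\<dots> \<le> curve_sup q' (g z - \<gamma>) + curve_sup q' \<gamma>"
          using elim t curve_sup_upper[OF X_C0[OF G] pq(2) t] by (intro add_mono) auto
        finally have "p' (u z t - U t) * q' (g z t) \<le> curve_sup p' (u z - U) * (curve_sup q' (g z - \<gamma>) + curve_sup q' \<gamma>)"
          using elim t by (intro mult_mono) (auto simp: cseminorm_nonneg[OF pq(2)])
        then show "p' (m (u z t - U t) (g z t)) \<le> \<dots>" using pq(4) order_trans by blast
        have "p' (U t) * q' (g z t - \<gamma> t) \<le> curve_sup p' U * curve_sup q' (g z - \<gamma>)"
          using elim t curve_sup_upper[OF X_C0[OF U] pq(1) t] curve_sup_nonneg[OF X_C0[OF U] pq(1)]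
          by (intro mult_mono) (auto simp: cseminorm_nonneg[OF pq(2)])
        then show "p' (m (U t) (g z t - \<gamma> t)) \<le> \<dots>" using pq(4) order_trans by blast
      qed
      finally show "p (pmul (u z) (g z) t - pmul U \<gamma> t) \<le> h z" .
    qed
  qed
  ultimately show "\<exists>h. (h \<longlongrightarrow> 0) Fl \<and> (\<forall>\<^sub>F z in Fl. \<forall>t\<in>{0..1}. p (pmul (u z) (g z) t - pmul U \<gamma> t) \<le> h z)"
    by auto
qed

lemma limitin_sol_TE:
  assumes g: "limitin TE g \<gamma> Fl" and w: "limitin TE w \<omega> Fl"
  shows "limitin TE (\<lambda>z. sol (g z) (w z)) (sol \<gamma> \<omega>) Fl"
proof (rule limitin_TE_I)
  have G: "\<gamma> \<in> X" and O: "\<omega> \<in> X" using g w unfolding E.limitin_iff by blast+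
  have gX: "\<forall>\<^sub>F z in Fl. g z \<in> X" and wX: "\<forall>\<^sub>F z in Fl. w z \<in> X" using g w unfolding E.limitin_iff by blast+
  define x where "x = sol \<gamma> \<omega>"
  have x: "solves \<gamma> \<omega> x" unfolding x_def by (rule solves_sol[OF G O])
  have xX: "x \<in> X" using x C1_X by (simp add: solves_def)
  show "sol \<gamma> \<omega> \<in> X" using xX by (simp add: x_def)
  show "\<forall>\<^sub>F z in Fl. sol (g z) (w z) \<in> X"
    using gX wX by eventually_elim (rule C1_X[OF sol_C1])
  fix p :: "'b \<Rightarrow> real" assume p: "cseminorm p"
  obtain p' q' where pq: "cseminorm p'" "cseminorm q'" "\<And>x. p x \<le> p' x"
    "\<And>x y. p' (m x y) \<le> p' x * q' y"
    using mult_bound[OF p] by meson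
  \<comment> \<open>\<open>g z\<close> is eventually within 1 of \<open>\<gamma>\<close>, so
    \<open>R\<close> eventually bounds all coefficients \<open>g z\<close>; with weight
    \<open>R + 1\<close> the denominator in \<open>solves_bound\<close> is 1.\<close>
  define R where "R = curve_sup q' \<gamma> + 1"
  define W where "W z = curve_sup p' x * curve_sup q' (g z - \<gamma>) + curve_sup p' (w z - \<omega>)" for z
  have R: "R \<ge> 0" using curve_sup_nonneg[OF X_C0[OF G] pq(2)] by (simp add: R_def)
  have "(W \<longlongrightarrow> curve_sup p' x * 0 + 0) Fl"
    unfolding W_def[abs_def] using limitin_TE_D(1)[OF w pq(1)] limitin_TE_D(1)[OF g pq(2)]
    by (intro tendsto_intros)
  then have "((\<lambda>z. W z * exp (R + 1)) \<longlongrightarrow> 0 * exp (R + 1)) Fl" by (intro tendsto_mult_right) simp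
  moreover have "\<forall>\<^sub>F z in Fl. \<forall>t\<in>{0..1}. p (sol (g z) (w z) t - sol \<gamma> \<omega> t) \<le> W z * exp (R + 1)"
    using limitin_TE_D(2)[OF w pq(1)] limitin_TE_D(2)[OF g pq(2)]
      order_tendstoD(2)[OF limitin_TE_D(1)[OF g pq(2)] zero_less_one]
  proof eventually_elim
    case (elim z)
    have W0: "W z \<ge> 0" using elim curve_sup_nonneg[OF X_C0[OF xX] pq(1)] by (auto simp: W_def)
    define y where "y = sol (g z) (w z)"
    have y: "solves (g z) (w z) y" unfolding y_def using elim by (intro solves_sol) auto
    show ?case
    proof
      fix t assume t: "t \<in> {0..1::real}"
      have "p' ((y - x) t) \<le> W z / (R + 1 - R) * exp ((R + 1) * t)"
      proof (rule solves_bound[OF solves_diff[OF x y] pq(1,4) _ R _ _ W0 t])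
        fix s assume s: "s \<in> {0..1::real}"
        show "q' (g z s) \<le> R"
          using cseminorm_add[OF pq(2), of "g z s - \<gamma> s" "\<gamma> s"] elim s curve_sup_upper[OF X_C0[OF G] pq(2) s]
          by (fastforce simp: R_def)
        have "p' ((pmul x (g z - \<gamma>) + (w z - \<omega>)) s) \<le> p' (m (x s) (g z s - \<gamma> s)) + p' (w z s - \<omega> s)"
          using cseminorm_add[OF pq(1)] by (simp add: pmul_def)
        also have "\<dots> \<le> W z"
          unfolding W_def
        proof (intro add_mono)
          have "p' (x s) * q' (g z s - \<gamma> s) \<le> curve_sup p' x * curve_sup q' (g z - \<gamma>)"
            using elim s curve_sup_upper[OF X_C0[OF xX] pq(1) s] curve_sup_nonneg[OF X_C0[OF xX] pq(1)]
            by (intro mult_mono) (auto simp: cseminorm_nonneg[OF pq(2)])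
          then show "p' (m (x s) (g z s - \<gamma> s)) \<le> \<dots>" using pq(4) order_trans by blast
          show "p' (w z s - \<omega> s) \<le> curve_sup p' (w z - \<omega>)" using elim s by blast
        qed
        also have "\<dots> \<le> W z * exp ((R + 1) * s)"
          using W0 R s mult_left_mono[of 1 "exp ((R + 1) * s)" "W z"] by simp
        finally show "p' ((pmul x (g z - \<gamma>) + (w z - \<omega>)) s) \<le> W z * exp ((R + 1) * s)" .
      qed simp
      also have "\<dots> \<le> W z * exp (R + 1)"
        using W0 R t by (auto intro!: mult_left_mono simp: mult_left_le)
      finally have "p' ((y - x) t) \<le> W z * exp (R + 1)" .
      then show "p (sol (g z) (w z) t - sol \<gamma> \<omega> t) \<le> W z * exp (R + 1)"
        using pq(3)[of "(y - x) t"] by (simp add: x_def y_def)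
    qed
  qed
  ultimately show "\<exists>h. (h \<longlongrightarrow> 0) Fl \<and> (\<forall>\<^sub>F z in Fl. \<forall>t\<in>{0..1}. p (sol (g z) (w z) t - sol \<gamma> \<omega> t) \<le> h z)"
    by auto
qed

lemma limitin_TF_I:
  assumes f: "limitin TE f l Fl" and d: "limitin TE (\<lambda>z. curve_deriv (f z)) (curve_deriv l) Fl"
    and l: "l \<in> C_curves 1" and ev: "\<forall>\<^sub>F z in Fl. f z \<in> C_curves 1"
  shows "limitin TF f l Fl"
  unfolding F.limitin_iff
proof (intro conjI l ev ballI)
  fix Q assume "Q \<in> curve_sup1 ` {p :: 'b \<Rightarrow> real. cseminorm p}"
  then obtain p where p: "Q = curve_sup1 p" "cseminorm (p :: 'b \<Rightarrow> real)" by blast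
  have "((\<lambda>z. curve_sup p (f z - l) + curve_sup p (curve_deriv (f z) - curve_deriv l)) \<longlongrightarrow> 0 + 0) Fl"
    by (intro tendsto_add limitin_TE_D(1)[OF f p(2)] limitin_TE_D(1)[OF d p(2)])
  then have lim: "((\<lambda>z. curve_sup p (f z - l) + curve_sup p (curve_deriv (f z) - curve_deriv l)) \<longlongrightarrow> 0) Fl"
    by simp
  have "\<forall>\<^sub>F z in Fl. curve_sup p (f z - l) + curve_sup p (curve_deriv (f z) - curve_deriv l) = Q (f z - l)"
    using ev
  proof eventually_elim
    case (elim z)
    have "curve_deriv (f z + (-1) *\<^sub>R l) = curve_deriv (f z) + (-1) *\<^sub>R curve_deriv l"
      using elim l subspace_scale[OF subspace_C_curves_1 l] by (simp only: curve_deriv_plus curve_deriv_scaleR)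
    then show ?case by (simp add: p(1) curve_sup1_def)
  qed
  then show "((\<lambda>z. Q (f z - l)) \<longlongrightarrow> 0) Fl" by (rule Lim_transform_eventually[OF lim])
qed

lemma limitin_TF_imp_TE:
  assumes f: "limitin TF f l Fl"
  shows "limitin TE f l Fl"
  unfolding E.limitin_iff
proof (intro conjI ballI)
  have l: "l \<in> C_curves 1" and ev: "\<forall>\<^sub>F z in Fl. f z \<in> C_curves 1" using f unfolding F.limitin_iff by blast+
  show "l \<in> X" by (rule C1_X[OF l])
  show "\<forall>\<^sub>F z in Fl. f z \<in> X" using ev by eventually_elim (rule C1_X)
  fix Q assume "Q \<in> curve_sup ` {p :: 'b \<Rightarrow> real. cseminorm p}"
  then obtain p where p: "Q = curve_sup p" "cseminorm (p :: 'b \<Rightarrow> real)" by blast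
  have lim: "((\<lambda>z. curve_sup1 p (f z - l)) \<longlongrightarrow> 0) Fl" using f p(2) unfolding F.limitin_iff by blast
  have "\<forall>\<^sub>F z in Fl. norm (Q (f z - l)) \<le> curve_sup1 p (f z - l)"
    using ev
  proof eventually_elim
    case (elim z)
    have d: "f z - l \<in> C_curves 1" by (rule subspace_diff[OF subspace_C_curves_1 elim l])
    show ?case
      using curve_sup_nonneg[OF C_curves_1D(2)[OF d] p(2)] curve_sup_nonneg[OF C_curves_1D(3)[OF d] p(2)]
      by (simp add: p(1) curve_sup1_def)
  qed
  then show "((\<lambda>z. Q (f z - l)) \<longlongrightarrow> 0) Fl" by (rule Lim_null_comparison[OF _ lim])
qed

lemma curve_deriv_solves:
  assumes x: "solves \<gamma> w x" and g: "\<gamma> \<in> X" and w: "w \<in> X"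
  shows "curve_deriv x = pmul x \<gamma> + w"
proof
  fix t
  have xX: "x \<in> X" using x C1_X by (simp add: solves_def)
  show "curve_deriv x t = (pmul x \<gamma> + w) t"
  proof (cases "t \<in> {0..1}")
    case True
    then show ?thesis using x curve_deriv_eq by (simp add: solves_def pmul_def)
  next
    case False
    then show ?thesis
      using C_curves_outside[OF X_C0[OF X_add[OF X_pmul[OF xX g] w]] False] by (simp add: curve_deriv_outside)
  qed
qed

text \<open>The derivative of a solution is \<open>pmul x \<gamma> + w\<close>, so uniform
  convergence of the data and of the solutions already forces convergence in
  \<open>C\<^sup>1\<close>.\<close>

lemma limitin_sol:
  assumes g: "limitin TE g \<gamma> Fl" and w: "limitin TE w \<omega> Fl"
  shows "limitin TF (\<lambda>z. sol (g z) (w z)) (sol \<gamma> \<omega>) Fl"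
proof (rule limitin_TF_I[OF limitin_sol_TE[OF g w]])
  have G: "\<gamma> \<in> X" and O: "\<omega> \<in> X" using g w unfolding E.limitin_iff by blast+
  have gX: "\<forall>\<^sub>F z in Fl. g z \<in> X" and wX: "\<forall>\<^sub>F z in Fl. w z \<in> X" using g w unfolding E.limitin_iff by blast+
  show "sol \<gamma> \<omega> \<in> C_curves 1" by (rule sol_C1[OF G O])
  show "\<forall>\<^sub>F z in Fl. sol (g z) (w z) \<in> C_curves 1" using gX wX by eventually_elim (rule sol_C1)
  have "limitin TE (\<lambda>z. pmul (sol (g z) (w z)) (g z) + w z) (pmul (sol \<gamma> \<omega>) \<gamma> + \<omega>) Fl"
    by (intro E.limitin_plus limitin_pmul limitin_sol_TE g w)
  moreover have "\<forall>\<^sub>F z in Fl. pmul (sol (g z) (w z)) (g z) + w z = curve_deriv (sol (g z) (w z))"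
    using gX wX by eventually_elim (simp add: curve_deriv_solves[OF solves_sol])
  moreover have "curve_deriv (sol \<gamma> \<omega>) = pmul (sol \<gamma> \<omega>) \<gamma> + \<omega>"
    by (rule curve_deriv_solves[OF solves_sol[OF G O] G O])
  ultimately show "limitin TE (\<lambda>z. curve_deriv (sol (g z) (w z))) (curve_deriv (sol \<gamma> \<omega>)) Fl"
    using limitin_transform_eventually by force
qed

end

section \<open>Orderings of a list by repeated insertion\<close>

primrec inserts :: "'c \<Rightarrow> 'c list \<Rightarrow> 'c list list" where
  "inserts y [] = [[y]]"
| "inserts y (v # ws) = (y # v # ws) # map ((#) v) (inserts y ws)"

text \<open>All orderings of \<open>ys\<close>, built by inserting one entry after another, as
  successive differentiation does. A list and not a set, because equal directions must be counted
  with multiplicity.\<close>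

definition arrangements :: "'c list \<Rightarrow> 'c list list" where
  "arrangements ys = foldl (\<lambda>L y. concat (map (inserts y) L)) [[]] ys"

lemma arrangements_simps:
  "arrangements [] = [[]]"
  "arrangements (ys @ [y]) = concat (map (inserts y) (arrangements ys))"
  by (simp_all add: arrangements_def)

lemma set_inserts: "u \<in> set (inserts y ws) \<Longrightarrow> set u = insert y (set ws)"
  by (induction ws arbitrary: u) auto

lemma set_arrangements: "u \<in> set (arrangements ys) \<Longrightarrow> set u = set ys"
  by (induction ys arbitrary: u rule: rev_induct) (auto simp: arrangements_simps dest: set_inserts)

lemma inserts_map: "inserts (f y) (map f ws) = map (map f) (inserts y ws)"
  by (induction ws) auto

text \<open>Lets the directions be indexed by \<open>[0..<k]\<close>, so that one fixed finite list
  of orderings serves all choices of directions when continuity of a derivative is proved.\<close>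

lemma arrangements_map: "arrangements (map f ys) = map (map f) (arrangements ys)"
  by (induction ys rule: rev_induct)
    (simp_all add: arrangements_simps inserts_map map_concat o_def)

lemma sum_list_map_concat:
  fixes f :: "'c \<Rightarrow> 'd::comm_monoid_add"
  shows "(\<Sum>x\<leftarrow>concat xss. f x) = (\<Sum>xs\<leftarrow>xss. \<Sum>x\<leftarrow>xs. f x)"
  by (induction xss) auto

section \<open>Evolutions with a prescribed initial value\<close>

context curve_ode
begin

lemma sol_add: "\<gamma> \<in> X \<Longrightarrow> v \<in> X \<Longrightarrow> w \<in> X \<Longrightarrow> sol \<gamma> (v + w) = sol \<gamma> v + sol \<gamma> w"
  by (intro sol_eqI solves_add solves_sol)

lemma sol_scaleR: "\<gamma> \<in> X \<Longrightarrow> w \<in> X \<Longrightarrow> sol \<gamma> (r *\<^sub>R w) = r *\<^sub>R sol \<gamma> w"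
  by (intro sol_eqI solves_scaleR solves_sol)

lemma zero_X: "0 \<in> X"
  using subspace_0[OF subspace_X] .

lemma sol_zero: "\<gamma> \<in> X \<Longrightarrow> sol \<gamma> 0 = 0"
  using sol_scaleR[of \<gamma> 0 0] zero_X by simp

lemma topspace_TE: "topspace TE = X" by (rule E.topspace_eq)

lemma topspace_TF: "topspace TF = C_curves 1" by (rule F.topspace_eq)

definition const_curve :: "'b \<Rightarrow> real \<Rightarrow> 'b" where
  "const_curve a t = (if t \<in> {0..1} then a else 0)"

lemma has_curve_deriv_const_curve: "t \<in> {0..1} \<Longrightarrow> has_curve_deriv (const_curve a) 0 t"
  by (rule has_curve_deriv_cong[OF has_curve_deriv_const[of a]]) (simp_all add: const_curve_def)

lemma const_curve_C1: "const_curve a \<in> C_curves 1"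
  by (rule C_curves_1I[OF _ has_curve_deriv_const_curve]) (auto simp: const_curve_def)

text \<open>Subtracting the constant reduces \<open>x' = x \<gamma>\<close>, \<open>x 0 = a\<close>
  to a problem with initial value 0. Values \<open>a\<close> other than 1 occur when an evolution is
  restarted or reversed at one of its own points, and as \<open>(a, 0)\<close> in the
  complexification.\<close>

definition evo :: "'b \<Rightarrow> (real \<Rightarrow> 'b) \<Rightarrow> real \<Rightarrow> 'b" where
  "evo a \<gamma> = const_curve a + sol \<gamma> (pmul (const_curve a) \<gamma>)"

lemma pmul_const_X: "\<gamma> \<in> X \<Longrightarrow> pmul (const_curve a) \<gamma> \<in> X"
  by (rule X_pmul[OF C1_X[OF const_curve_C1]])

lemma evo_C1: "\<gamma> \<in> X \<Longrightarrow> evo a \<gamma> \<in> C_curves 1"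
  unfolding evo_def by (intro subspace_add subspace_C_curves_1 const_curve_C1 sol_C1 pmul_const_X)

lemma evo_X: "\<gamma> \<in> X \<Longrightarrow> evo a \<gamma> \<in> X"
  by (rule C1_X[OF evo_C1])

lemma evo_0: "\<gamma> \<in> X \<Longrightarrow> evo a \<gamma> 0 = a"
  using solves_sol[OF _ pmul_const_X] by (simp add: evo_def const_curve_def solves_def)

lemma has_curve_deriv_evo:
  assumes g: "\<gamma> \<in> X" and t: "t \<in> {0..1}"
  shows "has_curve_deriv (evo a \<gamma>) (m (evo a \<gamma> t) (\<gamma> t)) t"
proof -
  have "has_curve_deriv (\<lambda>t. const_curve a t + sol \<gamma> (pmul (const_curve a) \<gamma>) t)
      (0 + (m (sol \<gamma> (pmul (const_curve a) \<gamma>) t) (\<gamma> t) + pmul (const_curve a) \<gamma> t)) t"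
    using solves_sol[OF g pmul_const_X[OF g]] t
    by (intro has_curve_deriv_add has_curve_deriv_const_curve) (auto simp: solves_def)
  then show ?thesis by (simp add: evo_def plus_fun_def mult_add_left pmul_def algebra_simps)
qed

lemma evo_eqI:
  assumes g: "\<gamma> \<in> X" and y: "y \<in> C_curves 1" "y 0 = a"
    and der: "\<And>t. t \<in> {0..1} \<Longrightarrow> has_curve_deriv y (m (y t) (\<gamma> t)) t"
  shows "evo a \<gamma> = y"
proof -
  have "solves \<gamma> (pmul (const_curve a) \<gamma>) (y - const_curve a)"
    unfolding solves_def
  proof (intro conjI ballI)
    show "y - const_curve a \<in> C_curves 1" by (intro subspace_diff subspace_C_curves_1 y const_curve_C1)
    show "(y - const_curve a) 0 = 0" by (simp add: y const_curve_def)
    fix t assume t: "t \<in> {0..1::real}"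
    have "has_curve_deriv (\<lambda>t. y t - const_curve a t) (m (y t) (\<gamma> t) - 0) t"
      by (intro has_curve_deriv_diff der has_curve_deriv_const_curve t)
    then show "has_curve_deriv (y - const_curve a)
        (m ((y - const_curve a) t) (\<gamma> t) + pmul (const_curve a) \<gamma> t) t"
      by (simp add: fun_diff_def mult_diff pmul_def)
  qed
  from sol_eqI[OF this g] show ?thesis by (simp add: evo_def)
qed

lemma limitin_evo:
  assumes "limitin TE g \<gamma> Fl"
  shows "limitin TF (\<lambda>z. evo a (g z)) (evo a \<gamma>) Fl"
  unfolding evo_def
proof (intro F.limitin_plus limitin_sol limitin_pmul assms)
  show "limitin TF (\<lambda>_. const_curve a) (const_curve a) Fl"
    by (simp add: topspace_TF const_curve_C1)
  show "limitin TE (\<lambda>_. const_curve a) (const_curve a) Fl"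
    by (simp add: topspace_TE C1_X const_curve_C1)
qed

lemma solves_evo_diff:
  assumes "\<gamma> \<in> X" "\<delta> \<in> X"
  shows "solves \<delta> (pmul (evo a \<gamma>) (\<delta> - \<gamma>)) (evo a \<delta> - evo a \<gamma>)"
  unfolding solves_def
proof (intro conjI ballI)
  show "evo a \<delta> - evo a \<gamma> \<in> C_curves 1" by (intro subspace_diff subspace_C_curves_1 evo_C1 assms)
  show "(evo a \<delta> - evo a \<gamma>) 0 = 0" by (simp add: evo_0 assms)
  fix t assume t: "t \<in> {0..1::real}"
  have "has_curve_deriv (\<lambda>t. evo a \<delta> t - evo a \<gamma> t) (m (evo a \<delta> t) (\<delta> t) - m (evo a \<gamma> t) (\<gamma> t)) t"
    by (intro has_curve_deriv_diff has_curve_deriv_evo t assms)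
  then show "has_curve_deriv (evo a \<delta> - evo a \<gamma>)
      (m ((evo a \<delta> - evo a \<gamma>) t) (\<delta> t) + pmul (evo a \<gamma>) (\<delta> - \<gamma>) t) t"
    by (simp add: fun_diff_def mult_diff pmul_def)
qed


subsection \<open>Power series expansion of the evolution map\<close>

text \<open>The directions form a sequence, of which the \<open>n\<close>-th term uses the first
  \<open>n\<close> entries. Constant sequences give the homogeneous polynomials of the expansion,
  arbitrary ones the multilinear maps behind them.\<close>

primrec evo_term :: "'b \<Rightarrow> (real \<Rightarrow> 'b) \<Rightarrow> (nat \<Rightarrow> real \<Rightarrow> 'b) \<Rightarrow> nat \<Rightarrow> real \<Rightarrow> 'b" where
  "evo_term a \<gamma> d 0 = evo a \<gamma>"
| "evo_term a \<gamma> d (Suc n) = sol \<gamma> (pmul (evo_term a \<gamma> d n) (d n))"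

lemma evo_term_C1:
  assumes "\<gamma> \<in> X" "\<And>i. i < n \<Longrightarrow> d i \<in> X"
  shows "evo_term a \<gamma> d n \<in> C_curves 1"
  using assms(2)
proof (induction n)
  case 0
  show ?case by (simp add: evo_C1 assms(1))
next
  case (Suc n)
  then show ?case by (simp add: sol_C1 assms(1) X_pmul C1_X)
qed

lemma evo_term_X:
  assumes "\<gamma> \<in> X" "\<And>i. i < n \<Longrightarrow> d i \<in> X"
  shows "evo_term a \<gamma> d n \<in> X"
  by (rule C1_X[OF evo_term_C1[OF assms]])

lemma evo_term_cong: "(\<And>i. i < n \<Longrightarrow> d i = d' i) \<Longrightarrow> evo_term a \<gamma> d n = evo_term a \<gamma> d' n"
  by (induction n) auto

text \<open>Each slot enters exactly once: in the step to \<open>Suc n\<close>, slot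
  \<open>n\<close> through the last product and every other slot through the preceding term.\<close>

lemma evo_term_add:
  assumes g: "\<gamma> \<in> X" and uv: "u \<in> X" "v \<in> X"
  shows "i < n \<Longrightarrow> (\<And>j. j < n \<Longrightarrow> d j \<in> X) \<Longrightarrow>
    evo_term a \<gamma> (d(i := u + v)) n = evo_term a \<gamma> (d(i := u)) n + evo_term a \<gamma> (d(i := v)) n"
proof (induction n)
  case (Suc n)
  have X: "evo_term a \<gamma> (d(i := w)) n \<in> X" if "w \<in> X" for w
    using Suc.prems that by (intro evo_term_X g) auto
  have dn: "d n \<in> X" using Suc.prems by simp
  show ?case
  proof (cases "i = n")
    case True
    have e: "evo_term a \<gamma> (d(n := w)) n = evo_term a \<gamma> d n" for w
      by (rule evo_term_cong) simp
    have E: "evo_term a \<gamma> d n \<in> X"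
      using Suc.prems by (intro evo_term_X g) auto
    show ?thesis unfolding True evo_term.simps fun_upd_same e pmul_simps(2)
      by (rule sol_add[OF g X_pmul[OF E uv(1)] X_pmul[OF E uv(2)]])
  next
    case False
    then have ni: "n \<noteq> i" by simp
    have eq: "evo_term a \<gamma> (d(i := u + v)) n = evo_term a \<gamma> (d(i := u)) n + evo_term a \<gamma> (d(i := v)) n"
    proof (rule Suc.IH)
      show "i < n" using False Suc.prems(1) by simp
      show "d j \<in> X" if "j < n" for j using Suc.prems(2) that by simp
    qed
    show ?thesis unfolding evo_term.simps fun_upd_other[OF ni] eq pmul_simps(1)
      by (rule sol_add[OF g X_pmul[OF X[OF uv(1)] dn] X_pmul[OF X[OF uv(2)] dn]])
  qed
qed simp

text \<open>\<open>L\<close> is multiplication by a complex scalar in the applications. Since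
  \<open>L\<close> passes through products, it maps solutions to solutions, and uniqueness does the
  rest; this is how complex linearity of the Taylor terms is obtained.\<close>

lemma sol_commute_linear:
  assumes L: "linear L" "continuous_on UNIV L" and mL: "\<And>x y. m (L x) y = L (m x y)"
    and g: "\<gamma> \<in> X" and w: "w \<in> X"
  shows "sol \<gamma> (\<lambda>t. L (w t)) = (\<lambda>t. L (sol \<gamma> w t))"
proof (rule sol_eqI[OF _ g])
  have s: "solves \<gamma> w (sol \<gamma> w)" by (rule solves_sol[OF g w])
  show "solves \<gamma> (\<lambda>t. L (w t)) (\<lambda>t. L (sol \<gamma> w t))"
    unfolding solves_def
  proof (intro conjI ballI)
    have C: "sol \<gamma> w \<in> C_curves 1" by (rule sol_C1[OF g w])
    show "(\<lambda>t. L (sol \<gamma> w t)) \<in> C_curves 1"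
    proof (rule C_curves_1I)
      show "has_curve_deriv (\<lambda>t. L (sol \<gamma> w t)) (L (curve_deriv (sol \<gamma> w) t)) t" if "t \<in> {0..1}" for t
        by (rule has_curve_deriv_linear[OF C_curves_1D(1)[OF C that] L])
      show "continuous_on {0..1} (\<lambda>t. L (curve_deriv (sol \<gamma> w) t))"
        using C_curves_1D(2)[OF C]
        by (intro continuous_on_compose2[OF L(2)]) (auto simp: C_curves_0_iff)
    qed (simp add: C_curves_outside[OF C] linear_0[OF L(1)])
    show "L (sol \<gamma> w 0) = 0" using s by (simp add: solves_def linear_0[OF L(1)])
    fix t assume "t \<in> {0..1::real}"
    then have "has_curve_deriv (sol \<gamma> w) (m (sol \<gamma> w t) (\<gamma> t) + w t) t"
      using s by (simp add: solves_def)
    from has_curve_deriv_linear[OF this L] show "has_curve_deriv (\<lambda>t. L (sol \<gamma> w t)) (m (L (sol \<gamma> w t)) (\<gamma> t) + L (w t)) t"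
      by (simp add: linear_add[OF L(1)] mL)
  qed
qed

lemma evo_term_commute_linear:
  assumes L: "linear L" "continuous_on UNIV L"
    and mL: "\<And>x y. m (L x) y = L (m x y)" "\<And>x y. m x (L y) = L (m x y)"
    and g: "\<gamma> \<in> X" and u: "u \<in> X" and LX: "\<And>w. w \<in> X \<Longrightarrow> (\<lambda>t. L (w t)) \<in> X"
  shows "i < n \<Longrightarrow> (\<And>j. j < n \<Longrightarrow> d j \<in> X) \<Longrightarrow>
    evo_term a \<gamma> (d(i := (\<lambda>t. L (u t)))) n = (\<lambda>t. L (evo_term a \<gamma> (d(i := u)) n t))"
proof (induction n)
  case (Suc n)
  have dn: "d n \<in> X" using Suc.prems by simp
  have pl: "pmul (\<lambda>t. L (v t)) w = (\<lambda>t. L (pmul v w t))" "pmul v (\<lambda>t. L (w t)) = (\<lambda>t. L (pmul v w t))" for v w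
    by (simp_all add: pmul_def mL)
  show ?case
  proof (cases "i = n")
    case True
    have e: "evo_term a \<gamma> (d(n := w)) n = evo_term a \<gamma> d n" for w
      by (rule evo_term_cong) simp
    have E: "evo_term a \<gamma> d n \<in> X"
      using Suc.prems by (intro evo_term_X g) auto
    show ?thesis unfolding True evo_term.simps fun_upd_same e pl(2)
      by (rule sol_commute_linear[OF L mL(1) g X_pmul[OF E u]])
  next
    case False
    then have ni: "n \<noteq> i" by simp
    have E: "evo_term a \<gamma> (d(i := u)) n \<in> X"
      using Suc.prems u by (intro evo_term_X g) auto
    have eq: "evo_term a \<gamma> (d(i := (\<lambda>t. L (u t)))) n = (\<lambda>t. L (evo_term a \<gamma> (d(i := u)) n t))"
    proof (rule Suc.IH)
      show "i < n" using False Suc.prems(1) by simp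
      show "d j \<in> X" if "j < n" for j using Suc.prems(2) that by simp
    qed
    show ?thesis unfolding evo_term.simps fun_upd_other[OF ni] eq pl(1)
      by (rule sol_commute_linear[OF L mL(1) g X_pmul[OF E dn]])
  qed
qed simp

lemma limitin_evo_term:
  assumes g: "\<gamma> \<in> X" and d: "\<And>i. i < n \<Longrightarrow> limitin TE (\<lambda>z. d z i) (D i) Fl"
  shows "limitin TF (\<lambda>z. evo_term a \<gamma> (d z) n) (evo_term a \<gamma> D n) Fl"
  using d
proof (induction n)
  case 0
  show ?case by (simp add: topspace_TF evo_C1 g)
next
  case (Suc n)
  have "limitin TE (\<lambda>_. \<gamma>) \<gamma> Fl" by (simp add: topspace_TE g)
  moreover have "limitin TE (\<lambda>z. pmul (evo_term a \<gamma> (d z) n) (d z n)) (pmul (evo_term a \<gamma> D n) (D n)) Fl"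
    using Suc by (intro limitin_pmul limitin_TF_imp_TE[of "\<lambda>z. evo_term a \<gamma> (d z) n"]) auto
  ultimately show ?case by (simp add: limitin_sol)
qed

text \<open>Subtracting the equation of the next term, with coefficient \<open>\<gamma>\<close>,
  from that of the current remainder, with coefficient \<open>\<gamma> + \<delta>\<close>, cancels
  the old inhomogeneity and leaves the product of the next term with
  \<open>\<delta>\<close>.\<close>

lemma evo_remainder:
  assumes "\<gamma> \<in> X" "\<delta> \<in> X"
  shows "solves (\<gamma> + \<delta>) (pmul (evo_term a \<gamma> (\<lambda>_. \<delta>) N) \<delta>)
    (evo a (\<gamma> + \<delta>) - (\<Sum>n<Suc N. evo_term a \<gamma> (\<lambda>_. \<delta>) n))"
proof (induction N)
  case 0
  have "(\<Sum>n<Suc 0. evo_term a \<gamma> (\<lambda>_. \<delta>) n) = evo a \<gamma>" by simp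
  then show ?case
    using solves_evo_diff[OF assms(1) X_add[OF assms]] by (simp only: evo_term.simps add_diff_cancel_left')
next
  case (Suc N)
  have "evo_term a \<gamma> (\<lambda>_. \<delta>) N \<in> X" using assms by (intro evo_term_X)
  then have s: "solves \<gamma> (pmul (evo_term a \<gamma> (\<lambda>_. \<delta>) N) \<delta>) (evo_term a \<gamma> (\<lambda>_. \<delta>) (Suc N))"
    using assms by (simp add: solves_sol X_pmul)
  show ?case using solves_diff[OF s Suc]
    by (simp only: sum.lessThan_Suc[of _ "Suc N"] diff_diff_eq add_diff_cancel_left' diff_self add_0_right)
qed

lemma evo_term_tendsto_zero:
  assumes g: "\<gamma> \<in> X" and d: "\<delta> \<in> X"
  shows "limitin TE (\<lambda>n. evo_term a \<gamma> (\<lambda>_. \<delta>) n) 0 sequentially"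
proof (rule limitin_TE_I[OF zero_X])
  have X: "evo_term a \<gamma> (\<lambda>_. \<delta>) n \<in> X" for n using assms by (intro evo_term_X)
  then show "\<forall>\<^sub>F n in sequentially. evo_term a \<gamma> (\<lambda>_. \<delta>) n \<in> X" by simp
  fix p :: "'b \<Rightarrow> real" assume p: "cseminorm p"
  obtain p' q' where pq: "cseminorm p'" "cseminorm q'" "\<And>x. p x \<le> p' x"
    "\<And>x y. p' (m x y) \<le> p' x * q' y"
    using mult_bound[OF p] by meson
  define R where "R = curve_sup q' \<gamma>"
  define S where "S = curve_sup q' \<delta>"
  define M where "M = curve_sup p' (evo a \<gamma>)"
  \<comment> \<open>The weight grows with \<open>\<delta>\<close>, so the terms halve at each step
    whatever the size of \<open>\<delta>\<close>.\<close>
  define l where "l = R + 2 * S + 1"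
  have R: "R \<ge> 0" and S: "S \<ge> 0" and M: "M \<ge> 0"
    unfolding R_def S_def M_def using g d pq X_C0 C1_X[OF evo_C1] by (auto intro: curve_sup_nonneg)
  have l: "R < l" "l > 0" "S / (l - R) \<le> 1 / 2" using R S by (auto simp: l_def field_simps)
  have *: "p' (evo_term a \<gamma> (\<lambda>_. \<delta>) n t) \<le> M * (1/2) ^ n * exp (l * t)" if t: "t \<in> {0..1}" for n t
    using t
  proof (induction n arbitrary: t)
    case 0
    have "M * 1 \<le> M * exp (l * t)" using 0 l M by (intro mult_left_mono) auto
    then show ?case using curve_sup_upper[OF X_C0[OF C1_X[OF evo_C1[OF g]]] pq(1) 0, of a] by (simp add: M_def)
  next
    case (Suc n)
    have s: "solves \<gamma> (pmul (evo_term a \<gamma> (\<lambda>_. \<delta>) n) \<delta>) (evo_term a \<gamma> (\<lambda>_. \<delta>) (Suc n))"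
      using assms X by (simp add: solves_sol X_pmul)
    have "p' (evo_term a \<gamma> (\<lambda>_. \<delta>) (Suc n) t) \<le> (M * (1/2) ^ n * S) / (l - R) * exp (l * t)"
    proof (rule solves_bound[OF s pq(1,4) _ R l(1) _ _ Suc.prems])
      show "q' (\<gamma> s) \<le> R" if "s \<in> {0..1}" for s
        unfolding R_def by (rule curve_sup_upper[OF X_C0[OF g] pq(2) that])
      show "0 \<le> M * (1/2) ^ n * S" using M S by simp
      fix s assume s: "s \<in> {0..1::real}"
      have "p' (pmul (evo_term a \<gamma> (\<lambda>_. \<delta>) n) \<delta> s) \<le> p' (evo_term a \<gamma> (\<lambda>_. \<delta>) n s) * q' (\<delta> s)"
        unfolding pmul_def by (rule pq(4))
      also have "\<dots> \<le> (M * (1/2) ^ n * exp (l * s)) * S"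
        using Suc.IH[OF s] curve_sup_upper[OF X_C0[OF d] pq(2) s] M
        by (intro mult_mono) (auto simp: S_def cseminorm_nonneg pq)
      finally show "p' (pmul (evo_term a \<gamma> (\<lambda>_. \<delta>) n) \<delta> s) \<le> M * (1/2) ^ n * S * exp (l * s)"
        by (simp add: mult_ac)
    qed
    also have "(M * (1/2) ^ n * S) / (l - R) = M * (1/2) ^ n * (S / (l - R))" by simp
    also have "\<dots> \<le> M * (1/2) ^ n * (1/2)" using l M by (intro mult_left_mono) auto
    finally show ?case by (simp add: mult_ac)
  qed
  have "p (evo_term a \<gamma> (\<lambda>_. \<delta>) n t - 0) \<le> M * exp l * (1/2) ^ n" if t: "t \<in> {0..1}" for n t
  proof -
    have "exp (l * t) \<le> exp l" using t l by (simp add: mult_left_le)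
    then have "M * (1/2) ^ n * exp (l * t) \<le> M * (1/2) ^ n * exp l"
      using M by (intro mult_left_mono) auto
    then show ?thesis using *[OF t, of n] pq(3)[of "evo_term a \<gamma> (\<lambda>_. \<delta>) n t"] by (simp add: mult_ac)
  qed
  moreover have "(\<lambda>n. M * exp l * (1/2) ^ n) \<longlonglongrightarrow> M * exp l * 0"
    by (intro tendsto_intros LIMSEQ_power_zero) simp
  ultimately show "\<exists>h. h \<longlonglongrightarrow> 0 \<and>
      (\<forall>\<^sub>F n in sequentially. \<forall>t\<in>{0..1}. p (evo_term a \<gamma> (\<lambda>_. \<delta>) n t - 0 t) \<le> h n)"
    by (intro exI[of _ "\<lambda>n. M * exp l * (1/2) ^ n"]) simp
qed

text \<open>The remainder solves a linear equation whose inhomogeneity tends uniformly to 0, so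
  continuity of \<open>sol\<close> makes it vanish in \<open>C\<^sup>1\<close>. Convergence of the
  series does not have to be established beforehand.\<close>

lemma evo_series:
  assumes g: "\<gamma> \<in> X" and d: "\<delta> \<in> X"
  shows "limitin TF (\<lambda>N. \<Sum>n<N. evo_term a \<gamma> (\<lambda>_. \<delta>) n) (evo a (\<gamma> + \<delta>)) sequentially"
proof (rule limitin_sequentially_offset_rev)
  have X: "evo_term a \<gamma> (\<lambda>_. \<delta>) n \<in> X" for n using assms by (intro evo_term_X)
  have gd: "\<gamma> + \<delta> \<in> X" by (rule X_add[OF g d])
  \<comment> \<open>The sign of the remainder is moved into \<open>\<delta>\<close>, so that only
    limits of sums are needed.\<close>
  have nd: "(-1) *\<^sub>R \<delta> \<in> X" by (rule X_scaleR[OF d])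
  have eq: "(\<Sum>n<Suc N. evo_term a \<gamma> (\<lambda>_. \<delta>) n) =
      evo a (\<gamma> + \<delta>) + sol (\<gamma> + \<delta>) (pmul (evo_term a \<gamma> (\<lambda>_. \<delta>) N) ((-1) *\<^sub>R \<delta>))" for N
  proof -
    have "sol (\<gamma> + \<delta>) (pmul (evo_term a \<gamma> (\<lambda>_. \<delta>) N) \<delta>) = evo a (\<gamma> + \<delta>) - (\<Sum>n<Suc N. evo_term a \<gamma> (\<lambda>_. \<delta>) n)"
      by (rule sol_eqI[OF evo_remainder[OF g d] gd])
    then show ?thesis
      unfolding pmul_simps sol_scaleR[OF gd X_pmul[OF X d]] by simp
  qed
  have "limitin TF (\<lambda>N. evo a (\<gamma> + \<delta>) + sol (\<gamma> + \<delta>) (pmul (evo_term a \<gamma> (\<lambda>_. \<delta>) N) ((-1) *\<^sub>R \<delta>)))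
      (evo a (\<gamma> + \<delta>) + sol (\<gamma> + \<delta>) (pmul 0 ((-1) *\<^sub>R \<delta>))) sequentially"
    using gd nd
    by (intro F.limitin_plus limitin_sol limitin_pmul evo_term_tendsto_zero g d)
       (simp_all add: topspace_TF topspace_TE evo_C1)
  then show "limitin TF (\<lambda>N. \<Sum>n<N + 1. evo_term a \<gamma> (\<lambda>_. \<delta>) n) (evo a (\<gamma> + \<delta>)) sequentially"
    by (simp add: eq sol_zero[OF gd] pmul_simps(7) del: sum.lessThan_Suc)
qed

text \<open>\<open>\<Phi>\<close> and \<open>\<Psi>\<close> are identities over the complex field.
  In the real case they translate between pairs of curves, which make up the complexified function
  spaces, and curves of pairs, on which the differential equation lives.\<close>

lemma complex_analytic_evo:
  fixes \<Phi> :: "'e::real_vector \<Rightarrow> real \<Rightarrow> 'b" and \<Psi> :: "(real \<Rightarrow> 'b) \<Rightarrow> 'f::real_vector"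
  assumes U: "topspace TX = U" "subspace U" and \<Phi>: "continuous_map TX TE \<Phi>"
    and \<Phi>_add: "\<And>x y. x \<in> U \<Longrightarrow> y \<in> U \<Longrightarrow> \<Phi> (x + y) = \<Phi> x + \<Phi> y"
    and \<Phi>_scale: "\<And>c x. x \<in> U \<Longrightarrow> \<Phi> (sE c x) = pointwise_scale cs c (\<Phi> x)"
    and \<Psi>: "continuous_map TF TY \<Psi>"
    and \<Psi>_add: "\<And>x y. x \<in> C_curves 1 \<Longrightarrow> y \<in> C_curves 1 \<Longrightarrow> \<Psi> (x + y) = \<Psi> x + \<Psi> y"
    and \<Psi>_scale: "\<And>c x. x \<in> C_curves 1 \<Longrightarrow> \<Psi> (pointwise_scale cs c x) = sF c (\<Psi> x)"
    and cs: "\<And>c. linear (cs c)" "\<And>c. continuous_on UNIV (cs c)"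
      "\<And>c x y. m (cs c x) y = cs c (m x y)" "\<And>c x y. m x (cs c y) = cs c (m x y)"
      "\<And>c w. w \<in> X \<Longrightarrow> pointwise_scale cs c w \<in> X"
    and f: "\<And>x. x \<in> U \<Longrightarrow> f x = \<Psi> (evo a (\<Phi> x))"
  shows "complex_analytic_map sE TX sF TY U f"
  unfolding complex_analytic_map_def
proof (intro conjI ballI)
  have oU: "openin TX U" using openin_topspace[of TX] U(1) by simp
  show "openin TX U" by (rule oU)
  have \<Phi>X: "\<Phi> x \<in> X" if "x \<in> U" for x
    using continuous_map_image_subset_topspace[OF \<Phi>] that U(1) topspace_TE by blast
  have "continuous_map TX TF (\<lambda>x. evo a (\<Phi> x))"
    unfolding continuous_map_atin using \<Phi> by (auto simp: continuous_map_atin intro!: limitin_evo)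
  from continuous_map_compose[OF this \<Psi>] have "continuous_map TX TY (\<lambda>x. \<Psi> (evo a (\<Phi> x)))"
    by (simp add: o_def)
  then have "continuous_map TX TY f"
    by (rule continuous_map_eq) (simp add: U(1) f)
  then show "continuous_map (subtopology TX U) TY f" using U(1) by (simp add: subtopology_superset)
  fix x assume x: "x \<in> U"
  define p where "p n y = \<Psi> (evo_term a (\<Phi> x) (\<lambda>_. \<Phi> y) n)" for n y
  have "homogeneous_polynomial n sE TX sF TY (p n)" for n
    unfolding homogeneous_polynomial_def
  proof (intro exI conjI ballI)
    \<comment> \<open>One slot per direction gives an explicit multilinear map, not symmetric in
      general; the polynomial is its restriction to the diagonal.\<close>
    define \<beta> where "\<beta> z = \<Psi> (evo_term a (\<Phi> x) (\<lambda>i. \<Phi> (z i)) n)" for z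
    show "p n y = \<beta> (\<lambda>i\<in>{..<n}. y)" for y
      unfolding p_def \<beta>_def by (rule arg_cong[where f = \<Psi>], rule evo_term_cong) simp
    show "continuous_multilinear n sE TX sF TY \<beta>"
      unfolding continuous_multilinear_def
    proof (intro conjI allI ballI impI)
      have "continuous_map (product_topology (\<lambda>_. TX) {..<n}) TF (\<lambda>z. evo_term a (\<Phi> x) (\<lambda>i. \<Phi> (z i)) n)"
        unfolding continuous_map_atin
      proof (intro ballI limitin_evo_term \<Phi>X x)
        fix z i assume z: "z \<in> topspace (product_topology (\<lambda>_. TX) {..<n})" and i: "i < n"
        have "continuous_map (product_topology (\<lambda>_. TX) {..<n}) TX (\<lambda>z. z i)"
          using i by (intro continuous_map_product_projection) simp
        from continuous_map_compose[OF this \<Phi>]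
        show "limitin TE (\<lambda>z. \<Phi> (z i)) (\<Phi> (z i)) (atin (product_topology (\<lambda>_. TX) {..<n}) z)"
          using z by (auto simp: o_def continuous_map_atin)
      qed
      from continuous_map_compose[OF this \<Psi>]
      show "continuous_map (product_topology (\<lambda>_. TX) {..<n}) TY \<beta>"
        by (simp add: o_def \<beta>_def[abs_def])
      fix i z u assume i: "i < n" and z: "z \<in> {..<n} \<rightarrow>\<^sub>E topspace TX" and u: "u \<in> topspace TX"
      have zX: "\<Phi> (z j) \<in> X" if "j < n" for j using z that U(1) by (intro \<Phi>X) auto
      have uX: "\<Phi> u \<in> X" using u U(1) by (intro \<Phi>X) auto
      have upd: "(\<lambda>j. \<Phi> ((z(i := w)) j)) = (\<lambda>j. \<Phi> (z j))(i := \<Phi> w)" for w by auto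
      have C1: "evo_term a (\<Phi> x) ((\<lambda>j. \<Phi> (z j))(i := w)) n \<in> C_curves 1" if "w \<in> X" for w
        using zX that by (intro evo_term_C1 \<Phi>X x) auto
      {
        fix v assume v: "v \<in> topspace TX"
        have vX: "\<Phi> v \<in> X" using v U(1) by (intro \<Phi>X) auto
        have "\<Phi> (u + v) = \<Phi> u + \<Phi> v" using u v U(1) by (intro \<Phi>_add) auto
        then have "\<beta> (z(i := u + v)) = \<Psi> (evo_term a (\<Phi> x) ((\<lambda>j. \<Phi> (z j))(i := \<Phi> u)) n +
            evo_term a (\<Phi> x) ((\<lambda>j. \<Phi> (z j))(i := \<Phi> v)) n)"
          unfolding \<beta>_def upd by (simp add: evo_term_add[OF \<Phi>X[OF x] uX vX i zX])
        also have "\<dots> = \<beta> (z(i := u)) + \<beta> (z(i := v))"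
          unfolding \<beta>_def upd by (rule \<Psi>_add[OF C1[OF uX] C1[OF vX]])
        finally show "\<beta> (z(i := u + v)) = \<beta> (z(i := u)) + \<beta> (z(i := v))" .
      }
      fix c
      have "\<Phi> (sE c u) = (\<lambda>t. cs c (\<Phi> u t))" using \<Phi>_scale u U(1) by (simp add: pointwise_scale_def)
      then have "\<beta> (z(i := sE c u)) =
          \<Psi> (pointwise_scale cs c (evo_term a (\<Phi> x) ((\<lambda>j. \<Phi> (z j))(i := \<Phi> u)) n))"
        unfolding \<beta>_def upd
        by (simp add: pointwise_scale_def
            evo_term_commute_linear[OF cs(1,2,3,4) \<Phi>X[OF x] uX cs(5)[unfolded pointwise_scale_def] i zX])
      also have "\<dots> = sF c (\<beta> (z(i := u)))"
        unfolding \<beta>_def upd by (rule \<Psi>_scale[OF C1[OF uX]])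
      finally show "\<beta> (z(i := sE c u)) = sF c (\<beta> (z(i := u)))" .
    qed
  qed
  moreover have "limitin TY (\<lambda>N. \<Sum>n<N. p n y) (f (x + y)) sequentially" if y: "y \<in> U" for y
  proof -
    have C1: "evo_term a (\<Phi> x) (\<lambda>_. \<Phi> y) n \<in> C_curves 1" for n
      by (intro evo_term_C1 \<Phi>X x y)
    have xy: "x + y \<in> U" by (rule subspace_add[OF U(2) x y])
    have z: "\<Psi> 0 = 0"
    proof (rule add_left_imp_eq)
      show "\<Psi> 0 + \<Psi> 0 = \<Psi> 0 + 0"
        using \<Psi>_add[OF subspace_0[OF subspace_C_curves_1] subspace_0[OF subspace_C_curves_1]]
        by (simp only: add_0_right)
    qed
    have "\<Psi> (\<Sum>n<N. evo_term a (\<Phi> x) (\<lambda>_. \<Phi> y) n) = (\<Sum>n<N. p n y)" for N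
    proof (induction N)
      case (Suc N)
      have "(\<Sum>n<N. evo_term a (\<Phi> x) (\<lambda>_. \<Phi> y) n) \<in> C_curves 1"
        by (intro subspace_sum subspace_C_curves_1 C1)
      from \<Psi>_add[OF this C1] Suc show ?case unfolding sum.lessThan_Suc by (simp only: p_def)
    qed (simp only: lessThan_0 sum.empty z)
    moreover have "f (x + y) = \<Psi> (evo a (\<Phi> x + \<Phi> y))" using f[OF xy] \<Phi>_add[OF x y] by simp
    ultimately show ?thesis
      using continuous_map_limit[OF \<Psi> evo_series[OF \<Phi>X[OF x] \<Phi>X[OF y], of a]] by (simp add: o_def)
  qed
  \<comment> \<open>The expansion about \<open>x\<close> holds for every increment, so all of
    \<open>U\<close> serves as the 0-neighbourhood.\<close>
  ultimately show "\<exists>Y p. (\<exists>V. openin TX V \<and> 0 \<in> V \<and> V \<subseteq> Y) \<and> Y \<subseteq> topspace TX \<and> (\<forall>y\<in>Y. x + y \<in> U) \<and>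
      (\<forall>n. homogeneous_polynomial n sE TX sF TY (p n)) \<and>
      (\<forall>y\<in>Y. limitin TY (\<lambda>N. \<Sum>n<N. p n y) (f (x + y)) sequentially)"
    using oU U subspace_0[OF U(2)] subspace_add[OF U(2) x]
    by (intro exI[of _ U] exI[of _ p]) auto
qed


subsection \<open>Directional derivatives of the evolution map\<close>

text \<open>
  Differentiating the equations that define \<open>evo_word a \<gamma> ws\<close> in a new direction \<open>y\<close> puts \<open>y\<close> at every
  possible position of the word, so the \<open>k\<close>-th derivative of the evolution map is a sum over the
  orderings of the \<open>k\<close> directions.
\<close>

primrec evo_word :: "'b \<Rightarrow> (real \<Rightarrow> 'b) \<Rightarrow> (real \<Rightarrow> 'b) list \<Rightarrow> real \<Rightarrow> 'b" where
  "evo_word a \<gamma> [] = evo a \<gamma>"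
| "evo_word a \<gamma> (y # ws) = sol \<gamma> (pmul (evo_word a \<gamma> ws) y)"

lemma evo_word_C1: "\<gamma> \<in> X \<Longrightarrow> set ws \<subseteq> X \<Longrightarrow> evo_word a \<gamma> ws \<in> C_curves 1"
  by (induction ws) (auto simp: evo_C1 C1_X intro!: sol_C1 X_pmul)

lemma evo_word_X: "\<gamma> \<in> X \<Longrightarrow> set ws \<subseteq> X \<Longrightarrow> evo_word a \<gamma> ws \<in> X"
  by (rule C1_X[OF evo_word_C1])

lemma limitin_evo_word:
  assumes g: "limitin TE g \<gamma> Fl" and d: "\<And>i. i \<in> set is \<Longrightarrow> limitin TE (\<lambda>z. d z i) (D i) Fl"
  shows "limitin TF (\<lambda>z. evo_word a (g z) (map (d z) is)) (evo_word a \<gamma> (map D is)) Fl"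
  using d
proof (induction "is")
  case Nil
  show ?case by (simp add: limitin_evo g)
next
  case (Cons i "is")
  then have "limitin TE (\<lambda>z. evo_word a (g z) (map (d z) is)) (evo_word a \<gamma> (map D is)) Fl"
    by (intro limitin_TF_imp_TE) simp
  with Cons.prems show ?case by (simp add: limitin_sol g limitin_pmul)
qed

lemma limitin_line:
  assumes g: "\<gamma> \<in> X" and y: "y \<in> X"
  shows "limitin TE (\<lambda>h. \<gamma> + h *\<^sub>R y) \<gamma> (at 0)"
proof (rule limitin_TE_I[OF g])
  show "\<forall>\<^sub>F h in at 0. \<gamma> + h *\<^sub>R y \<in> X" using g y by (simp add: X_add X_scaleR)
  fix p :: "'b \<Rightarrow> real" assume p: "cseminorm p"
  have "((\<lambda>h. \<bar>h\<bar> * curve_sup p y) \<longlongrightarrow> \<bar>0\<bar> * curve_sup p y) (at 0)" by (intro tendsto_intros)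
  moreover have "p ((\<gamma> + h *\<^sub>R y) t - \<gamma> t) \<le> \<bar>h\<bar> * curve_sup p y" if "t \<in> {0..1}" for h t
    using curve_sup_upper[OF X_C0[OF y] p that]
    by (simp add: scaleR_fun_def cseminorm_scale[OF p] mult_left_mono)
  ultimately show "\<exists>k. (k \<longlongrightarrow> 0) (at 0) \<and> (\<forall>\<^sub>F h in at 0. \<forall>t\<in>{0..1}. p ((\<gamma> + h *\<^sub>R y) t - \<gamma> t) \<le> k h)"
    by (intro exI[of _ "\<lambda>h. \<bar>h\<bar> * curve_sup p y"]) simp
qed

text \<open>For \<open>h \<noteq> 0\<close> the difference quotient is itself a value of
  \<open>sol\<close> with coefficient \<open>\<gamma> + h *\<^sub>R y\<close>, so its limit comes
  from continuous dependence instead of a Taylor estimate.\<close>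

lemma limitin_evo_word_deriv:
  assumes g: "\<gamma> \<in> X" and y: "y \<in> X"
  shows "set ws \<subseteq> X \<Longrightarrow> limitin TE (\<lambda>h. inverse h *\<^sub>R (evo_word a (\<gamma> + h *\<^sub>R y) ws - evo_word a \<gamma> ws))
    (\<Sum>u\<leftarrow>inserts y ws. evo_word a \<gamma> u) (at 0)"
proof (induction ws)
  case Nil
  have eq: "sol (\<gamma> + h *\<^sub>R y) (pmul (evo a \<gamma>) y) = inverse h *\<^sub>R (evo_word a (\<gamma> + h *\<^sub>R y) [] - evo_word a \<gamma> [])"
    if "h \<noteq> 0" for h
  proof (rule sol_eqI)
    have gh: "\<gamma> + h *\<^sub>R y \<in> X" by (intro X_add X_scaleR g y)
    then show "\<gamma> + h *\<^sub>R y \<in> X" .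
    show "solves (\<gamma> + h *\<^sub>R y) (pmul (evo a \<gamma>) y) (inverse h *\<^sub>R (evo_word a (\<gamma> + h *\<^sub>R y) [] - evo_word a \<gamma> []))"
      using solves_scaleR[OF solves_evo_diff[OF g gh, of a], of "inverse h"] that by (simp add: pmul_simps)
  qed
  have lim: "limitin TE (\<lambda>h. sol (\<gamma> + h *\<^sub>R y) (pmul (evo a \<gamma>) y)) (sol \<gamma> (pmul (evo a \<gamma>) y)) (at 0)"
    by (intro limitin_sol_TE limitin_line g y) (simp add: topspace_TE X_pmul evo_X g y)
  have ev: "\<forall>\<^sub>F h in at 0. sol (\<gamma> + h *\<^sub>R y) (pmul (evo a \<gamma>) y) =
      inverse h *\<^sub>R (evo_word a (\<gamma> + h *\<^sub>R y) [] - evo_word a \<gamma> [])"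
    using eventually_neq_at_within[of 0 0] by eventually_elim (rule eq)
  show ?case using limitin_transform_eventually[OF ev lim]
    by (simp only: inserts.simps list.map sum_list.Cons sum_list.Nil add_0_right evo_word.simps)
next
  case (Cons v ws)
  let ?\<Delta> = "\<lambda>ws h. inverse h *\<^sub>R (evo_word a (\<gamma> + h *\<^sub>R y) ws - evo_word a \<gamma> ws)"
  have v: "v \<in> X" and ws: "set ws \<subseteq> X" using Cons.prems by auto
  have W: "evo_word a \<delta> u \<in> X" if "\<delta> \<in> X" "set u \<subseteq> X" for \<delta> u
    by (rule evo_word_X[OF that])
  have gh: "\<gamma> + h *\<^sub>R y \<in> X" for h by (intro X_add X_scaleR g y)
  \<comment> \<open>By \<open>solves_diff\<close> the inhomogeneity has two parts: the change of the
    coefficient puts \<open>y\<close> in front of the word, the change of the tail puts it somewhere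
    behind \<open>v\<close>.\<close>
  have eq: "sol (\<gamma> + h *\<^sub>R y) (pmul (evo_word a \<gamma> (v # ws)) y + pmul (?\<Delta> ws h) v) = ?\<Delta> (v # ws) h"
    if "h \<noteq> 0" for h
  proof (rule sol_eqI[OF _ gh])
    have s1: "solves \<gamma> (pmul (evo_word a \<gamma> ws) v) (evo_word a \<gamma> (v # ws))"
      by (simp add: solves_sol g X_pmul W ws v)
    have s2: "solves (\<gamma> + h *\<^sub>R y) (pmul (evo_word a (\<gamma> + h *\<^sub>R y) ws) v) (evo_word a (\<gamma> + h *\<^sub>R y) (v # ws))"
      by (simp add: solves_sol gh X_pmul W ws v)
    have "inverse h *\<^sub>R (pmul (evo_word a \<gamma> (v # ws)) (\<gamma> + h *\<^sub>R y - \<gamma>) +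
        (pmul (evo_word a (\<gamma> + h *\<^sub>R y) ws) v - pmul (evo_word a \<gamma> ws) v)) =
        pmul (evo_word a \<gamma> (v # ws)) y + pmul (?\<Delta> ws h) v"
      using that by (simp add: pmul_simps scaleR_add_right scaleR_diff_right)
    with solves_scaleR[OF solves_diff[OF s1 s2], of "inverse h"]
    show "solves (\<gamma> + h *\<^sub>R y) (pmul (evo_word a \<gamma> (v # ws)) y + pmul (?\<Delta> ws h) v) (?\<Delta> (v # ws) h)"
      by (simp only:)
  qed
  have ins: "set u \<subseteq> X" if "u \<in> set (inserts y ws)" for u using set_inserts[OF that] y ws by simp
  have lim: "limitin TE (\<lambda>h. sol (\<gamma> + h *\<^sub>R y) (pmul (evo_word a \<gamma> (v # ws)) y + pmul (?\<Delta> ws h) v))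
      (sol \<gamma> (pmul (evo_word a \<gamma> (v # ws)) y + pmul (\<Sum>u\<leftarrow>inserts y ws. evo_word a \<gamma> u) v)) (at 0)"
  proof (intro limitin_sol_TE limitin_line g y E.limitin_plus limitin_pmul)
    show "limitin TE (\<lambda>h. ?\<Delta> ws h) (\<Sum>u\<leftarrow>inserts y ws. evo_word a \<gamma> u) (at 0)"
      by (rule Cons.IH[OF ws])
    show "limitin TE (\<lambda>h. v) v (at 0)" by (simp add: topspace_TE v)
    show "limitin TE (\<lambda>h. y) y (at 0)" by (simp add: topspace_TE y)
    show "limitin TE (\<lambda>h. evo_word a \<gamma> (v # ws)) (evo_word a \<gamma> (v # ws)) (at 0)"
      using W[OF g Cons.prems] by (simp add: topspace_TE)
  qed
  have sum: "sol \<gamma> (pmul (\<Sum>u\<leftarrow>us. evo_word a \<gamma> u) v) = (\<Sum>u\<leftarrow>us. evo_word a \<gamma> (v # u)) \<and>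
      (\<Sum>u\<leftarrow>us. evo_word a \<gamma> u) \<in> X"
    if "\<And>u. u \<in> set us \<Longrightarrow> set u \<subseteq> X" for us
    using that
    by (induction us) (auto simp: pmul_simps sol_zero g zero_X sol_add X_pmul W v X_add)
  have "sol \<gamma> (pmul (evo_word a \<gamma> (v # ws)) y + pmul (\<Sum>u\<leftarrow>inserts y ws. evo_word a \<gamma> u) v) =
      sol \<gamma> (pmul (evo_word a \<gamma> (v # ws)) y) + sol \<gamma> (pmul (\<Sum>u\<leftarrow>inserts y ws. evo_word a \<gamma> u) v)"
    by (rule sol_add[OF g X_pmul[OF W[OF g Cons.prems] y] X_pmul[OF conjunct2[OF sum[OF ins]] v]])
  also have "\<dots> = evo_word a \<gamma> (y # v # ws) + (\<Sum>u\<leftarrow>inserts y ws. evo_word a \<gamma> (v # u))"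
    by (simp only: conjunct1[OF sum[OF ins]] evo_word.simps)
  also have "\<dots> = (\<Sum>u\<leftarrow>inserts y (v # ws). evo_word a \<gamma> u)"
    by (simp only: inserts.simps list.map sum_list.Cons map_map o_def)
  finally have lim': "limitin TE (\<lambda>h. sol (\<gamma> + h *\<^sub>R y) (pmul (evo_word a \<gamma> (v # ws)) y + pmul (?\<Delta> ws h) v))
      (\<Sum>u\<leftarrow>inserts y (v # ws). evo_word a \<gamma> u) (at 0)"
    using lim by (simp only:)
  have "\<forall>\<^sub>F h in at 0. sol (\<gamma> + h *\<^sub>R y) (pmul (evo_word a \<gamma> (v # ws)) y + pmul (?\<Delta> ws h) v) = ?\<Delta> (v # ws) h"
    using eventually_neq_at_within[of 0 0] by eventually_elim (rule eq)
  then show ?case by (rule limitin_transform_eventually[OF _ lim'])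
qed

lemma limitin_TE_eval:
  assumes "limitin TE f l Fl" "t \<in> {0..1}"
  shows "((\<lambda>z. f z t) \<longlongrightarrow> l t) Fl"
  unfolding tendsto_iff_cseminorm
proof (intro allI impI)
  fix p :: "'b \<Rightarrow> real" assume p: "cseminorm p"
  have "\<forall>\<^sub>F z in Fl. norm (p (f z t - l t)) \<le> curve_sup p (f z - l)"
    using limitin_TE_D(2)[OF assms(1) p]
    by eventually_elim (use assms(2) in \<open>simp add: cseminorm_nonneg[OF p]\<close>)
  then show "((\<lambda>z. p (f z t - l t)) \<longlongrightarrow> 0) Fl"
    by (rule Lim_null_comparison[OF _ limitin_TE_D(1)[OF assms(1) p]])
qed

lemma sum_list_fun_apply: "(\<Sum>u\<leftarrow>us. f u) t = (\<Sum>u\<leftarrow>us. f u t)"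
  by (induction us) auto

lemma iter_dir_deriv_evo:
  assumes f: "\<And>\<gamma>. \<gamma> \<in> X \<Longrightarrow> f \<gamma> = evo a \<gamma> 1"
  shows "set ys \<subseteq> X \<Longrightarrow> \<gamma> \<in> X \<Longrightarrow>
      iter_dir_deriv euclidean f ys \<gamma> = (\<Sum>u\<leftarrow>arrangements ys. evo_word a \<gamma> u 1)"
    and "set ys \<subseteq> X \<Longrightarrow> y \<in> X \<Longrightarrow> \<gamma> \<in> X \<Longrightarrow>
      has_dir_deriv euclidean y (iter_dir_deriv euclidean f ys) \<gamma> (\<Sum>u\<leftarrow>arrangements (ys @ [y]). evo_word a \<gamma> u 1)"
proof -
  \<comment> \<open>\<open>F\<close> is prescribed on \<open>X\<close> only; this suffices because
    the line \<open>\<gamma> + h *\<^sub>R y\<close> stays in \<open>X\<close>. It suits iterated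
    derivatives, which are descriptions without a known value elsewhere.\<close>
  have step: "has_dir_deriv euclidean y F \<gamma> (\<Sum>u\<leftarrow>arrangements (ys @ [y]). evo_word a \<gamma> u 1)"
    if ys: "set ys \<subseteq> X" and y: "y \<in> X" and g: "\<gamma> \<in> X"
      and F: "\<And>\<gamma>. \<gamma> \<in> X \<Longrightarrow> F \<gamma> = (\<Sum>u\<leftarrow>arrangements ys. evo_word a \<gamma> u 1)" for F ys y \<gamma>
  proof -
    have "limitin TE (\<lambda>h. \<Sum>u\<leftarrow>arrangements ys. inverse h *\<^sub>R (evo_word a (\<gamma> + h *\<^sub>R y) u - evo_word a \<gamma> u))
        (\<Sum>u\<leftarrow>arrangements ys. \<Sum>v\<leftarrow>inserts y u. evo_word a \<gamma> v) (at 0)"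
      using ys set_arrangements[of _ ys] by (intro E.limitin_sum_list limitin_evo_word_deriv g y) auto
    from limitin_TE_eval[OF this, of 1]
    have lim: "((\<lambda>h. (\<Sum>u\<leftarrow>arrangements ys. inverse h *\<^sub>R (evo_word a (\<gamma> + h *\<^sub>R y) u - evo_word a \<gamma> u)) 1) \<longlongrightarrow>
        (\<Sum>u\<leftarrow>arrangements ys. \<Sum>v\<leftarrow>inserts y u. evo_word a \<gamma> v) 1) (at 0)" by simp
    have "(\<Sum>u\<leftarrow>us. inverse h *\<^sub>R (evo_word a (\<gamma> + h *\<^sub>R y) u - evo_word a \<gamma> u)) 1 =
        ((\<Sum>u\<leftarrow>us. evo_word a (\<gamma> + h *\<^sub>R y) u 1) - (\<Sum>u\<leftarrow>us. evo_word a \<gamma> u 1)) /\<^sub>R h" for us h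
      by (induction us) (auto simp: scaleR_fun_def algebra_simps)
    moreover have "\<gamma> + h *\<^sub>R y \<in> X" for h by (intro X_add X_scaleR g y)
    ultimately have "((\<lambda>h. (F (\<gamma> + h *\<^sub>R y) - F \<gamma>) /\<^sub>R h) \<longlongrightarrow>
        (\<Sum>u\<leftarrow>arrangements ys. \<Sum>v\<leftarrow>inserts y u. evo_word a \<gamma> v) 1) (at 0)"
      using lim F g by simp
    then show ?thesis
      by (simp add: has_dir_deriv_def arrangements_simps sum_list_map_concat sum_list_fun_apply o_def)
  qed
  have iter: "iter_dir_deriv euclidean f ys \<gamma> = (\<Sum>u\<leftarrow>arrangements ys. evo_word a \<gamma> u 1)"
    if "set ys \<subseteq> X" "\<gamma> \<in> X" for ys \<gamma>
    using that
  proof (induction ys arbitrary: \<gamma> rule: rev_induct)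
    case Nil
    then show ?case by (simp add: iter_dir_deriv_def arrangements_simps f)
  next
    case (snoc y ys)
    have h: "has_dir_deriv euclidean y (iter_dir_deriv euclidean f ys) \<gamma>
        (\<Sum>u\<leftarrow>arrangements (ys @ [y]). evo_word a \<gamma> u 1)"
      using snoc by (intro step) auto
    have "iter_dir_deriv euclidean f (ys @ [y]) \<gamma> = dir_deriv euclidean y (iter_dir_deriv euclidean f ys) \<gamma>"
      by (simp add: iter_dir_deriv_def)
    also have "\<dots> = (\<Sum>u\<leftarrow>arrangements (ys @ [y]). evo_word a \<gamma> u 1)"
      unfolding dir_deriv_def
      using h by (rule the_equality)
        (use h in \<open>auto simp: has_dir_deriv_def intro: tendsto_unique[OF trivial_limit_at]\<close>)
    finally show ?case .
  qed
  show "set ys \<subseteq> X \<Longrightarrow> \<gamma> \<in> X \<Longrightarrow>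
      iter_dir_deriv euclidean f ys \<gamma> = (\<Sum>u\<leftarrow>arrangements ys. evo_word a \<gamma> u 1)"
    by (rule iter)
  show "set ys \<subseteq> X \<Longrightarrow> y \<in> X \<Longrightarrow> \<gamma> \<in> X \<Longrightarrow>
      has_dir_deriv euclidean y (iter_dir_deriv euclidean f ys) \<gamma> (\<Sum>u\<leftarrow>arrangements (ys @ [y]). evo_word a \<gamma> u 1)"
    by (rule step) (auto intro: iter)
qed

lemma smooth_evo:
  assumes TX: "continuous_map TX TE (\<lambda>\<gamma>. \<gamma>)" and f: "\<And>\<gamma>. \<gamma> \<in> X \<Longrightarrow> f \<gamma> = evo a \<gamma> 1"
  shows "smooth_map TX euclidean (topspace TX) f"
  unfolding C_map_def
proof (intro conjI allI impI ballI)
  interpret A: seminorm_topology "euclidean :: 'b topology" UNIV "{p. cseminorm p}"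
    by (rule seminorm_topology_euclidean)
  have sub: "topspace TX \<subseteq> X"
    using continuous_map_image_subset_topspace[OF TX] topspace_TE by simp
  show "openin TX (topspace TX)" by simp
  have ev1: "((\<lambda>z. g z 1) \<longlongrightarrow> l 1) Fl" if "limitin TF g l Fl" for g l and Fl :: "'z filter"
    using limitin_TE_eval[OF limitin_TF_imp_TE[OF that]] by simp
  have "continuous_map TX euclidean (\<lambda>\<gamma>. evo a \<gamma> 1)"
    unfolding continuous_map_atin limitin_canonical_iff
  proof
    fix \<gamma> assume "\<gamma> \<in> topspace TX"
    then have "limitin TE (\<lambda>\<gamma>. \<gamma>) \<gamma> (atin TX \<gamma>)" using TX by (simp add: continuous_map_atin)
    from limitin_TE_eval[OF limitin_TF_imp_TE[OF limitin_evo[OF this]], of 1]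
    show "((\<lambda>\<gamma>. evo a \<gamma> 1) \<longlongrightarrow> evo a \<gamma> 1) (atin TX \<gamma>)" by simp
  qed
  then have "continuous_map TX euclidean f"
    by (rule continuous_map_eq) (use sub f in auto)
  then show "continuous_map (subtopology TX (topspace TX)) euclidean f" by simp
  show "\<exists>l. has_dir_deriv euclidean y (iter_dir_deriv euclidean f ys) x l"
    if "set ys \<subseteq> topspace TX \<and> y \<in> topspace TX \<and> enat (Suc (length ys)) \<le> \<infinity>" "x \<in> topspace TX" for ys y x
    using iter_dir_deriv_evo(2)[OF f, of ys y x] that sub by blast
  fix k :: nat
  let ?Z = "prod_topology TX (product_topology (\<lambda>_. TX) {..<k})"
  have "continuous_map ?Z euclidean (\<lambda>z. \<Sum>u\<leftarrow>arrangements [0..<k]. evo_word a (fst z) (map (snd z) u) 1)"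
    unfolding continuous_map_atin
  proof
    fix z assume z: "z \<in> topspace ?Z"
    have 1: "limitin TE fst (fst z) (atin ?Z z)"
      using continuous_map_compose[OF continuous_map_fst TX, of "product_topology (\<lambda>_. TX) {..<k}"] z
      by (auto simp: continuous_map_atin o_def)
    have 2: "limitin TE (\<lambda>z. snd z i) (snd z i) (atin ?Z z)" if "i \<in> {..<k}" for i
      using continuous_map_compose[OF continuous_map_compose[OF continuous_map_snd[of TX]
          continuous_map_product_projection[OF that, of "\<lambda>_. TX"]] TX] z
      by (auto simp: continuous_map_atin o_def)
    show "limitin euclidean (\<lambda>z. \<Sum>u\<leftarrow>arrangements [0..<k]. evo_word a (fst z) (map (snd z) u) 1)
        (\<Sum>u\<leftarrow>arrangements [0..<k]. evo_word a (fst z) (map (snd z) u) 1) (atin ?Z z)"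
    proof (rule A.limitin_sum_list)
      fix u assume "u \<in> set (arrangements [0..<k])"
      then have u: "set u = {..<k}" using set_arrangements by fastforce
      have "limitin TF (\<lambda>z. evo_word a (fst z) (map (snd z) u)) (evo_word a (fst z) (map (snd z) u)) (atin ?Z z)"
        using 1 2 u by (intro limitin_evo_word) auto
      from limitin_TE_eval[OF limitin_TF_imp_TE[OF this], of 1]
      show "limitin euclidean (\<lambda>z. evo_word a (fst z) (map (snd z) u) 1) (evo_word a (fst z) (map (snd z) u) 1) (atin ?Z z)"
        by simp
    qed
  qed
  then have "continuous_map ?Z euclidean (\<lambda>(x, y). iter_dir_deriv euclidean f (map y [0..<k]) x)"
  proof (rule continuous_map_eq)
    fix z assume z: "z \<in> topspace ?Z"
    obtain x y where xy: "z = (x, y)" by (cases z)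
    have "x \<in> X" "set (map y [0..<k]) \<subseteq> X" using z sub by (auto simp: xy)
    then show "(\<Sum>u\<leftarrow>arrangements [0..<k]. evo_word a (fst z) (map (snd z) u) 1) =
        (case z of (x, y) \<Rightarrow> iter_dir_deriv euclidean f (map y [0..<k]) x)"
      by (simp add: xy iter_dir_deriv_evo(1)[OF f] arrangements_map o_def)
  qed
  then show "continuous_map (prod_topology (subtopology TX (topspace TX)) (product_topology (\<lambda>_. TX) {..<k}))
      euclidean (\<lambda>(x, y). iter_dir_deriv euclidean f (map y [0..<k]) x)" by simp
qed

end

section \<open>Antiderivatives\<close>

definition riemann_sum :: "nat \<Rightarrow> (real \<Rightarrow> 'b::real_vector) \<Rightarrow> 'b" where
  "riemann_sum N h = (1 / real N) *\<^sub>R (\<Sum>k<N. h (real k / real N))"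

text \<open>Freezing the curve at time \<open>t\<close> instead of cutting it off keeps it
  continuous, and Lipschitz if it was, so that integrability over \<open>[0,1]\<close> can be
  applied to it.\<close>

definition stop_curve :: "real \<Rightarrow> (real \<Rightarrow> 'b::zero) \<Rightarrow> real \<Rightarrow> 'b" where
  "stop_curve t \<gamma> s = (if s \<in> {0..1} then \<gamma> (min s t) else 0)"

lemma grid_in_unit: "k < N \<Longrightarrow> real k / real N \<in> {0..1}"
  by (simp add: divide_le_eq)

text \<open>The grid points \<open>k / N\<close> below \<open>t\<close> are those with
  \<open>k\<close> below the ceiling of \<open>t * N\<close>.\<close>

lemma grid_count_bound:
  assumes t: "t \<in> {0..1}" and N: "N > 0"
  shows "\<bar>(\<Sum>k<N. if real k / real N < t then 1 else 0) / real N - t\<bar> \<le> 1 / real N"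
proof -
  have "{k\<in>{..<N}. real k / real N < t} = {..<nat \<lceil>t * real N\<rceil>}"
  proof (intro equalityI subsetI)
    fix k assume "k \<in> {k\<in>{..<N}. real k / real N < t}"
    then have "real k < t * real N" using N by (simp add: field_simps)
    then have "int k < \<lceil>t * real N\<rceil>" by (simp add: less_ceiling_iff)
    then show "k \<in> {..<nat \<lceil>t * real N\<rceil>}" by simp
  next
    fix k assume "k \<in> {..<nat \<lceil>t * real N\<rceil>}"
    then have "int k < \<lceil>t * real N\<rceil>" by (simp add: zless_nat_eq_int_zless)
    then have k: "real k < t * real N" by (simp add: less_ceiling_iff)
    also have "\<dots> \<le> 1 * real N" using t by (intro mult_right_mono) auto
    finally show "k \<in> {k\<in>{..<N}. real k / real N < t}" using k N by (simp add: field_simps)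
  qed
  then have "(\<Sum>k<N. if real k / real N < t then 1 else 0) = real (nat \<lceil>t * real N\<rceil>)"
    by (simp flip: sum.inter_filter)
  moreover have "\<bar>real (nat \<lceil>t * real N\<rceil>) - t * real N\<bar> \<le> 1"
  proof -
    have "\<lceil>t * real N\<rceil> \<ge> 0" using t by (simp add: order_less_le_trans[of _ 0])
    then show ?thesis by linarith
  qed
  then have "\<bar>real (nat \<lceil>t * real N\<rceil>) - t * real N\<bar> / real N \<le> 1 / real N"
    using N by (simp add: divide_right_mono)
  moreover have "real (nat \<lceil>t * real N\<rceil>) / real N - t = (real (nat \<lceil>t * real N\<rceil>) - t * real N) / real N"
    using N by (simp add: field_simps)
  ultimately show ?thesis by simp
qed

lemma grid_count_tendsto:
  assumes t: "t \<in> {0..1}"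
  shows "(\<lambda>n. (\<Sum>k<Suc n. if real k / real (Suc n) < t then 1 else 0) / real (Suc n)) \<longlonglongrightarrow> t"
proof -
  have "(\<lambda>n. (\<Sum>k<Suc n. if real k / real (Suc n) < t then 1 else 0) / real (Suc n) - t) \<longlonglongrightarrow> 0"
  proof (rule Lim_null_comparison)
    show "(\<lambda>n. 1 / real (Suc n)) \<longlonglongrightarrow> 0" by (rule LIMSEQ_Suc[OF lim_1_over_n])
    show "\<forall>\<^sub>F n in sequentially. norm ((\<Sum>k<Suc n. if real k / real (Suc n) < t then 1 else 0) / real (Suc n) - t) \<le> 1 / real (Suc n)"
      using grid_count_bound[OF t] by (intro always_eventually allI) (simp only: real_norm_def zero_less_Suc)
  qed
  then show ?thesis by (simp only: LIM_zero_iff)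
qed

section \<open>Antiderivatives from integrals of stopped curves\<close>

context seminormed_space
begin

text \<open>At grid points below \<open>s\<close> the two stopped curves agree, and from
  \<open>t\<close> on they differ by \<open>\<gamma> t - \<gamma> s\<close>. Only the grid points in
  between contribute an error, each at most \<open>B\<close>; their proportion is
  \<open>c t - c s\<close>.\<close>

lemma riemann_stop_bound:
  fixes \<gamma> :: "real \<Rightarrow> 'b"
  assumes p: "cseminorm p" and st: "0 \<le> s" "s \<le> t" "t \<le> 1" and N: "N > 0"
    and B: "\<And>u. u \<in> {s..t} \<Longrightarrow> p (\<gamma> u - \<gamma> s) \<le> B"
  defines "c \<equiv> \<lambda>r. (\<Sum>k<N. if real k / real N < r then 1 else 0) / real N"
  shows "p (riemann_sum N (stop_curve t \<gamma>) - riemann_sum N (stop_curve s \<gamma>) - (1 - c t) *\<^sub>R (\<gamma> t - \<gamma> s))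
    \<le> B * (c t - c s)"
proof -
  define ind where "ind r k = (if real k / real N < r then 1 else (0::real))" for r k
  have c: "c r = (\<Sum>k<N. ind r k) / real N" for r by (simp add: c_def ind_def)
  have B0: "B \<ge> 0" using B[of s] st by (simp add: cseminorm_zero[OF p])
  have term_bound: "p (stop_curve t \<gamma> (real k / real N) - stop_curve s \<gamma> (real k / real N) - (1 - ind t k) *\<^sub>R (\<gamma> t - \<gamma> s))
      \<le> B * (ind t k - ind s k)" if "k < N" for k
  proof -
    let ?k = "real k / real N"
    have k: "?k \<in> {0..1}" by (rule grid_in_unit[OF that])
    consider "?k < s" | "s \<le> ?k" "?k < t" | "t \<le> ?k" by linarith
    then show ?thesis
    proof cases
      case 1
      then show ?thesis using k st by (simp add: stop_curve_def ind_def cseminorm_zero[OF p] min_def)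
    next
      case 2
      then have "min ?k t = ?k" "min ?k s = s" by auto
      then show ?thesis using 2 k st B[of ?k] by (simp add: stop_curve_def ind_def)
    next
      case 3
      then show ?thesis using k st by (simp add: stop_curve_def ind_def cseminorm_zero[OF p] min_def)
    qed
  qed
  have "(\<Sum>k<N. (1 - ind t k) *\<^sub>R (\<gamma> t - \<gamma> s)) = (real N - (\<Sum>k<N. ind t k)) *\<^sub>R (\<gamma> t - \<gamma> s)"
    by (simp add: sum_subtractf flip: scaleR_left.sum)
  then have "(1 - c t) *\<^sub>R (\<gamma> t - \<gamma> s) = (1 / real N) *\<^sub>R (\<Sum>k<N. (1 - ind t k) *\<^sub>R (\<gamma> t - \<gamma> s))"
    using N by (simp add: c diff_divide_distrib)
  then have "riemann_sum N (stop_curve t \<gamma>) - riemann_sum N (stop_curve s \<gamma>) - (1 - c t) *\<^sub>R (\<gamma> t - \<gamma> s)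
      = (1 / real N) *\<^sub>R (\<Sum>k<N. stop_curve t \<gamma> (real k / real N) - stop_curve s \<gamma> (real k / real N) - (1 - ind t k) *\<^sub>R (\<gamma> t - \<gamma> s))"
    by (simp add: riemann_sum_def sum_subtractf scaleR_diff_right)
  also have "p \<dots> \<le> (1 / real N) * (\<Sum>k<N. B * (ind t k - ind s k))"
    unfolding cseminorm_scale[OF p]
    using term_bound by (intro mult_mono order_trans[OF cseminorm_sum_le[OF p] sum_mono]) (auto simp: cseminorm_nonneg[OF p])
  also have "\<dots> = B * (c t - c s)"
  proof -
    have "(\<Sum>k<N. B * (ind t k - ind s k)) = B * ((\<Sum>k<N. ind t k) - (\<Sum>k<N. ind s k))"
      by (simp only: sum_distrib_left[symmetric] sum_subtractf)
    then show ?thesis by (simp add: c flip: diff_divide_distrib)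
  qed
  finally show ?thesis .
qed

lemma antiderivative_from_riemann_sums:
  fixes \<gamma> :: "real \<Rightarrow> 'b"
  assumes g: "\<gamma> \<in> C_curves 0"
    and conv: "\<And>t. t \<in> {0..1} \<Longrightarrow> \<exists>I. (\<lambda>n. riemann_sum (Suc n) (stop_curve t \<gamma>)) \<longlonglongrightarrow> I"
  shows "\<exists>F\<in>C_curves 1. F 0 = 0 \<and> (\<forall>t\<in>{0..1}. has_curve_deriv F (\<gamma> t) t)"
proof -
  obtain I where I: "\<And>t. t \<in> {0..1} \<Longrightarrow> (\<lambda>n. riemann_sum (Suc n) (stop_curve t \<gamma>)) \<longlonglongrightarrow> I t"
    using conv by metis
  text \<open>The integral of the stopped curve is \<open>F t + (1 - t) \<gamma> t\<close>.\<close>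
  define F where "F t = (if t \<in> {0..1} then I t - (1 - t) *\<^sub>R \<gamma> t else 0)" for t
  \<comment> \<open>The limit of \<open>riemann_stop_bound\<close>, where the proportion of grid
    points below \<open>t\<close> becomes \<open>t\<close>. The reference point is always the left
    endpoint \<open>s\<close>.\<close>
  have bound: "p (F t - F s - (t - s) *\<^sub>R \<gamma> s) \<le> B * (t - s)"
    if p: "cseminorm p" and st: "0 \<le> s" "s \<le> t" "t \<le> 1"
      and B: "\<And>u. u \<in> {s..t} \<Longrightarrow> p (\<gamma> u - \<gamma> s) \<le> B" for p s t B
  proof -
    define c where "c n r = (\<Sum>k<Suc n. if real k / real (Suc n) < r then 1 else 0) / real (Suc n)" for n and r :: real
    have c: "(\<lambda>n. c n r) \<longlonglongrightarrow> r" if "r \<in> {0..1}" for r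
      unfolding c_def by (rule grid_count_tendsto[OF that])
    have "(\<lambda>n. riemann_sum (Suc n) (stop_curve t \<gamma>) + (-1) *\<^sub>R riemann_sum (Suc n) (stop_curve s \<gamma>) + (- ((1 - t) *\<^sub>R (\<gamma> t - \<gamma> s))))
        \<longlonglongrightarrow> I t + (-1) *\<^sub>R I s + (- ((1 - t) *\<^sub>R (\<gamma> t - \<gamma> s)))"
      using st by (intro tendsto_add_seminormed tendsto_scaleR_seminormed tendsto_const I) auto
    from tendsto_cseminorm_comp[OF this p]
    have l1: "(\<lambda>n. p (riemann_sum (Suc n) (stop_curve t \<gamma>) - riemann_sum (Suc n) (stop_curve s \<gamma>) - (1 - t) *\<^sub>R (\<gamma> t - \<gamma> s)))
        \<longlonglongrightarrow> p (I t - I s - (1 - t) *\<^sub>R (\<gamma> t - \<gamma> s))" by simp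
    have l2: "(\<lambda>n. B * (c n t - c n s) + \<bar>t - c n t\<bar> * p (\<gamma> t - \<gamma> s)) \<longlonglongrightarrow> B * (t - s) + \<bar>t - t\<bar> * p (\<gamma> t - \<gamma> s)"
      using st by (intro tendsto_intros c) auto
    have le: "p (riemann_sum (Suc n) (stop_curve t \<gamma>) - riemann_sum (Suc n) (stop_curve s \<gamma>) - (1 - t) *\<^sub>R (\<gamma> t - \<gamma> s))
        \<le> B * (c n t - c n s) + \<bar>t - c n t\<bar> * p (\<gamma> t - \<gamma> s)" for n
    proof -
      let ?d = "riemann_sum (Suc n) (stop_curve t \<gamma>) - riemann_sum (Suc n) (stop_curve s \<gamma>)"
      have "?d - (1 - t) *\<^sub>R (\<gamma> t - \<gamma> s) = (?d - (1 - c n t) *\<^sub>R (\<gamma> t - \<gamma> s)) + (t - c n t) *\<^sub>R (\<gamma> t - \<gamma> s)"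
        by (simp add: algebra_simps)
      then have "p (?d - (1 - t) *\<^sub>R (\<gamma> t - \<gamma> s)) \<le> p (?d - (1 - c n t) *\<^sub>R (\<gamma> t - \<gamma> s)) + p ((t - c n t) *\<^sub>R (\<gamma> t - \<gamma> s))"
        using cseminorm_add[OF p] by metis
      also have "\<dots> \<le> B * (c n t - c n s) + \<bar>t - c n t\<bar> * p (\<gamma> t - \<gamma> s)"
        using riemann_stop_bound[where p = p and \<gamma> = \<gamma> and s = s and t = t and B = B and N = "Suc n", OF p st zero_less_Suc B]
        unfolding cseminorm_scale[OF p] c_def by (intro add_mono) auto
      finally show ?thesis .
    qed
    have "p (I t - I s - (1 - t) *\<^sub>R (\<gamma> t - \<gamma> s)) \<le> B * (t - s) + \<bar>t - t\<bar> * p (\<gamma> t - \<gamma> s)"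
      using le by (intro LIMSEQ_le[OF l1 l2]) blast
    moreover have "F t - F s - (t - s) *\<^sub>R \<gamma> s = I t - I s - (1 - t) *\<^sub>R (\<gamma> t - \<gamma> s)"
      using st by (simp add: F_def algebra_simps)
    ultimately show ?thesis by simp
  qed
  have der: "has_curve_deriv F (\<gamma> x) x" if x: "x \<in> {0..1}" for x
    unfolding has_curve_deriv_iff
  proof (intro allI impI)
    fix p e assume "cseminorm (p :: 'b \<Rightarrow> real) \<and> (e :: real) > 0"
    then have p: "cseminorm p" and e: "e / 3 > 0" by auto
    obtain d where d: "d > 0" "\<And>u. u \<in> {0..1} \<Longrightarrow> \<bar>u - x\<bar> < d \<Longrightarrow> p (\<gamma> u - \<gamma> x) < e / 3"
      using g x p e unfolding C_curves_0_iff continuous_on_curve_iff by meson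
    have "p (F s - F x - (s - x) *\<^sub>R \<gamma> x) \<le> e * \<bar>s - x\<bar>" if s: "s \<in> {0..1}" "\<bar>s - x\<bar> < d" for s
    proof (cases "x \<le> s")
      case True
      have "p (\<gamma> u - \<gamma> x) \<le> e / 3" if "u \<in> {x..s}" for u
      proof -
        have "u \<in> {0..1}" "\<bar>u - x\<bar> < d" using that x s by auto
        then show ?thesis using d(2) less_imp_le by blast
      qed
      then have "p (F s - F x - (s - x) *\<^sub>R \<gamma> x) \<le> e / 3 * (s - x)"
        using x s True by (intro bound[OF p]) auto
      also have "\<dots> \<le> e * \<bar>s - x\<bar>" using True e by (intro mult_mono) auto
      finally show ?thesis .
    next
      case False
      have near: "p (\<gamma> u - \<gamma> x) \<le> e / 3" if "u \<in> {s..x}" for u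
      proof -
        have "u \<in> {0..1}" "\<bar>u - x\<bar> < d" using that x s by auto
        then show ?thesis using d(2) less_imp_le by blast
      qed
      have sx: "p (\<gamma> s - \<gamma> x) \<le> e / 3" using False by (intro near) auto
      \<comment> \<open>To the left of \<open>x\<close> the bound is anchored at \<open>s\<close>
        and not at \<open>x\<close>; exchanging \<open>\<gamma> s\<close> for
        \<open>\<gamma> x\<close> costs a third of \<open>e\<close> here and another one in the
        linear term below.\<close>
      have "p (\<gamma> u - \<gamma> s) \<le> 2 * (e / 3)" if "u \<in> {s..x}" for u
        using cseminorm_triangle[OF p, of "\<gamma> u" "\<gamma> s" "\<gamma> x"] cseminorm_commute[OF p, of "\<gamma> x" "\<gamma> s"] near[OF that] sx
        by linarith
      then have b: "p (F x - F s - (x - s) *\<^sub>R \<gamma> s) \<le> 2 * (e / 3) * (x - s)"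
        using x s False by (intro bound[OF p]) auto
      have "F s - F x - (s - x) *\<^sub>R \<gamma> x = - (F x - F s - (x - s) *\<^sub>R \<gamma> s) - (x - s) *\<^sub>R (\<gamma> s - \<gamma> x)"
        by (simp add: algebra_simps)
      then have "p (F s - F x - (s - x) *\<^sub>R \<gamma> x) \<le> p (- (F x - F s - (x - s) *\<^sub>R \<gamma> s)) + p ((x - s) *\<^sub>R (\<gamma> s - \<gamma> x))"
        using cseminorm_diff[OF p] by metis
      also have "\<dots> \<le> 2 * (e / 3) * (x - s) + (x - s) * (e / 3)"
        unfolding cseminorm_minus[OF p] cseminorm_scale[OF p]
        using b sx False by (intro add_mono mult_mono) (auto simp: cseminorm_nonneg[OF p])
      also have "\<dots> = e * \<bar>s - x\<bar>" using False by (simp add: field_simps)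
      finally show ?thesis .
    qed
    then show "\<exists>d>0. \<forall>s\<in>{0..1}. \<bar>s - x\<bar> < d \<longrightarrow> p (F s - F x - (s - x) *\<^sub>R \<gamma> x) \<le> e * \<bar>s - x\<bar>"
      using d(1) by blast
  qed
  have "F \<in> C_curves 1"
    by (rule C_curves_1I[OF _ der]) (use g in \<open>auto simp: F_def C_curves_0_iff\<close>)
  \<comment> \<open>Stopped at time 0 the curve is constant, so every Riemann sum equals
    \<open>\<gamma> 0\<close>, which the correction term in \<open>F\<close> removes.\<close>
  moreover have "F 0 = 0"
  proof -
    have "riemann_sum (Suc n) (stop_curve 0 \<gamma>) = \<gamma> 0" for n
    proof -
      have "stop_curve 0 \<gamma> (real k / real (Suc n)) = \<gamma> 0" if "k < Suc n" for k
      proof -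
        have k: "real k / real (Suc n) \<in> {0..1}" by (rule grid_in_unit[OF that])
        have "0 \<le> real k / real (Suc n)" by (intro divide_nonneg_nonneg of_nat_0_le_iff)
        then have "min (real k / real (Suc n)) 0 = 0" by (rule min_absorb2)
        then show ?thesis unfolding stop_curve_def if_P[OF k] by (rule arg_cong)
      qed
      then have "(\<Sum>k<Suc n. stop_curve 0 \<gamma> (real k / real (Suc n))) = (\<Sum>k<Suc n. \<gamma> 0)"
        by (intro sum.cong) blast+
      also have "\<dots> = real (Suc n) *\<^sub>R \<gamma> 0"
        unfolding sum_constant_scaleR card_lessThan ..
      finally have "(\<Sum>k<Suc n. stop_curve 0 \<gamma> (real k / real (Suc n))) = real (Suc n) *\<^sub>R \<gamma> 0" .
      then show ?thesis by (simp add: riemann_sum_def del: sum.lessThan_Suc)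
    qed
    then have "(\<lambda>_::nat. \<gamma> 0) \<longlonglongrightarrow> I 0" using I[of 0] by simp
    then show ?thesis by (simp add: F_def LIMSEQ_const_iff)
  qed
  ultimately show ?thesis using der by blast
qed

section \<open>Convergence of equidistant Riemann sums\<close>

lemma uniformly_continuous_curve:
  fixes h :: "real \<Rightarrow> 'b"
  assumes h: "continuous_on {0..1} h" and p: "cseminorm p" and e: "e > 0"
  obtains d where "d > 0" "\<And>x y. x \<in> {0..1} \<Longrightarrow> y \<in> {0..1} \<Longrightarrow> \<bar>x - y\<bar> < d \<Longrightarrow> p (h x - h y) < e"
proof -
  have "\<exists>d>0. \<forall>y\<in>{0..1}. \<bar>y - x\<bar> < d \<longrightarrow> p (h y - h x) < e / 2" if "x \<in> {0..1}" for x
    using h that p e unfolding continuous_on_curve_iff by (metis half_gt_zero)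
  then obtain d where d: "\<And>x. x \<in> {0..1} \<Longrightarrow> d x > 0"
    "\<And>x y. x \<in> {0..1} \<Longrightarrow> y \<in> {0..1} \<Longrightarrow> \<bar>y - x\<bar> < d x \<Longrightarrow> p (h y - h x) < e / 2" by metis
  \<comment> \<open>A Lebesgue number for the cover by intervals on which \<open>h\<close> stays
    within \<open>e / 2\<close> of its value at the centre.\<close>
  obtain r where r: "r > 0" "\<And>x. x \<in> {0..1} \<Longrightarrow> \<exists>G\<in>(\<lambda>x. ball x (d x)) ` {0..1}. ball x r \<subseteq> G"
  proof (rule Heine_Borel_lemma[of "{0..1::real}" "(\<lambda>x. ball x (d x)) ` {0..1}"])
    show "{0..1} \<subseteq> \<Union>((\<lambda>x. ball x (d x)) ` {0..1})"
    proof
      fix x :: real assume x: "x \<in> {0..1}"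
      then have "x \<in> ball x (d x)" using d(1) by simp
      then show "x \<in> \<Union>((\<lambda>x. ball x (d x)) ` {0..1})" using x by blast
    qed
  qed auto
  have "p (h x - h y) < e" if xy: "x \<in> {0..1}" "y \<in> {0..1}" "\<bar>x - y\<bar> < r" for x y
  proof -
    obtain z where z: "z \<in> {0..1}" "ball x r \<subseteq> ball z (d z)" using r(2)[OF xy(1)] by blast
    have "x \<in> ball x r" "y \<in> ball x r" using r(1) xy(3) by (auto simp: dist_real_def)
    then have "x \<in> ball z (d z)" "y \<in> ball z (d z)" using z(2) by blast+
    then have "p (h x - h z) < e / 2" "p (h y - h z) < e / 2"
      using d(2)[OF z(1) xy(1)] d(2)[OF z(1) xy(2)] by (auto simp: dist_real_def abs_minus_commute)
    then show ?thesis
      using cseminorm_triangle[OF p, of "h x" "h y" "h z"] cseminorm_commute[OF p, of "h z" "h y"] by linarith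
  qed
  then show ?thesis using r(1) that by blast
qed

text \<open>On the grid with \<open>N * M\<close> points each coarse value is repeated
  \<open>M\<close> times, so the sums are compared termwise. Two arbitrary step numbers are then
  compared through their product.\<close>

lemma riemann_sum_refine:
  fixes h :: "real \<Rightarrow> 'b"
  assumes p: "cseminorm p" and NM: "N > 0" "M > 0"
    and h: "\<And>x y. x \<in> {0..1} \<Longrightarrow> y \<in> {0..1} \<Longrightarrow> \<bar>x - y\<bar> < d \<Longrightarrow> p (h x - h y) < e"
    and d: "1 / real N \<le> d"
  shows "p (riemann_sum (N * M) h - riemann_sum N h) \<le> e"
proof -
  define K where "K = N * M"
  have K: "K > 0" using NM by (simp add: K_def)
  have "(\<Sum>i<K. h (real i / real K)) = (\<Sum>k<N. \<Sum>i=k*M..<k*M+M. h (real i / real K))"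
    unfolding K_def by (rule sum.nat_group[symmetric])
  moreover have "(\<Sum>k<N. h (real k / real N)) = (1 / real M) *\<^sub>R (\<Sum>k<N. \<Sum>i=k*M..<k*M+M. h (real k / real N))"
    using NM by (simp add: scaleR_sum_right sum_constant_scaleR)
  ultimately have "riemann_sum K h - riemann_sum N h =
      (1 / real K) *\<^sub>R (\<Sum>k<N. \<Sum>i=k*M..<k*M+M. h (real i / real K) - h (real k / real N))"
    by (simp add: riemann_sum_def K_def sum_subtractf scaleR_diff_right)
  also have "p \<dots> \<le> (1 / real K) * (\<Sum>k<N. \<Sum>i=k*M..<k*M+M. e)"
  proof -
    have le: "p (h (real i / real K) - h (real k / real N)) \<le> e" if k: "k < N" and i: "i \<in> {k*M..<k*M+M}" for k i
    proof -
      have "i < (k + 1) * M" using i by simp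
      also have "\<dots> \<le> N * M" using k by (intro mult_le_mono1) simp
      finally have iK: "i < K" by (simp add: K_def)
      have "real i / real K - real k / real N = (real i - real (k * M)) / real K"
        using NM by (simp add: K_def field_simps)
      also have "\<bar>\<dots>\<bar> < real M / real K"
        using i K by (simp add: divide_strict_right_mono flip: of_nat_mult)
      also have "\<dots> = 1 / real N" using NM by (simp add: K_def)
      finally have "\<bar>real i / real K - real k / real N\<bar> < d" using d by simp
      then show ?thesis using h[OF grid_in_unit[OF iK] grid_in_unit[OF k]] by simp
    qed
    show ?thesis
      unfolding cseminorm_scale[OF p]
      by (intro mult_mono order_trans[OF cseminorm_sum_le[OF p] sum_mono] le)
        (auto simp: cseminorm_nonneg[OF p])
  qed
  also have "\<dots> = e" using NM by (simp add: K_def)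
  finally show ?thesis by (simp add: K_def)
qed

lemma riemann_sums_converge_if_sequentially_complete:
  fixes h :: "real \<Rightarrow> 'b"
  assumes sc: "sequentially_complete TYPE('b)" and h: "continuous_on {0..1} h"
  shows "\<exists>I. (\<lambda>n. riemann_sum (Suc n) h) \<longlonglongrightarrow> I"
proof -
  have "\<exists>N. \<forall>m\<ge>N. \<forall>n\<ge>N. riemann_sum (Suc m) h - riemann_sum (Suc n) h \<in> U"
    if U: "open U" "(0::'b) \<in> U" for U
  proof -
    obtain p where p: "cseminorm p" "\<And>y. p (y - 0) < 1 \<Longrightarrow> y \<in> U"
      using open_contains_seminorm_ball[OF U] by blast
    obtain d where d: "d > 0" "\<And>x y. x \<in> {0..1} \<Longrightarrow> y \<in> {0..1} \<Longrightarrow> \<bar>x - y\<bar> < d \<Longrightarrow> p (h x - h y) < 1 / 3"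
      using uniformly_continuous_curve[OF h p(1), of "1/3"] by auto
    obtain N where N: "inverse (real (Suc N)) < d" using reals_Archimedean[OF d(1)] by blast
    have small: "1 / real (Suc n) \<le> d" if "n \<ge> N" for n
    proof -
      have "1 / real (Suc n) \<le> 1 / real (Suc N)" using that by (intro divide_left_mono) auto
      then show ?thesis using N by (simp add: inverse_eq_divide)
    qed
    have "riemann_sum (Suc m) h - riemann_sum (Suc n) h \<in> U" if "m \<ge> N" "n \<ge> N" for m n
    proof -
      have 1: "p (riemann_sum (Suc m * Suc n) h - riemann_sum (Suc m) h) \<le> 1 / 3"
        by (rule riemann_sum_refine[OF p(1) _ _ d(2) small[OF that(1)]]) auto
      have 2: "p (riemann_sum (Suc m * Suc n) h - riemann_sum (Suc n) h) \<le> 1 / 3"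
        unfolding mult.commute[of "Suc m"]
        by (rule riemann_sum_refine[OF p(1) _ _ d(2) small[OF that(2)]]) auto
      have "p (riemann_sum (Suc m) h - riemann_sum (Suc n) h) < 1"
        using 1 2 cseminorm_triangle[OF p(1), of "riemann_sum (Suc m) h" "riemann_sum (Suc n) h" "riemann_sum (Suc m * Suc n) h"]
          cseminorm_commute[OF p(1), of "riemann_sum (Suc m) h" "riemann_sum (Suc m * Suc n) h"] by linarith
      then show ?thesis using p(2) by simp
    qed
    then show ?thesis by blast
  qed
  then have "\<forall>U. open U \<and> 0 \<in> U \<longrightarrow>
      (\<exists>N. \<forall>m\<ge>N. \<forall>n\<ge>N. riemann_sum (Suc m) h - riemann_sum (Suc n) h \<in> U)" by blast
  with sc[unfolded sequentially_complete_def, rule_format, of "\<lambda>n. riemann_sum (Suc n) h"]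
  have "convergent (\<lambda>n. riemann_sum (Suc n) h)" by blast
  then show ?thesis unfolding convergent_def .
qed

lemma stop_curve_lipschitz:
  assumes g: "\<gamma> \<in> (lipschitz_curves :: (real \<Rightarrow> 'b) set)" and t: "t \<in> {0..1}"
  shows "stop_curve t \<gamma> \<in> lipschitz_curves"
  unfolding lipschitz_curves_def
proof (intro CollectI conjI allI impI)
  show "stop_curve t \<gamma> s = 0" if "s \<notin> {0..1}" for s
    unfolding stop_curve_def using that by (rule if_not_P)
  fix p :: "'b \<Rightarrow> real" assume p: "cseminorm p"
  obtain L where L: "\<forall>s\<in>{0..1}. \<forall>t\<in>{0..1}. p (\<gamma> t - \<gamma> s) \<le> L * \<bar>t - s\<bar>"
    using g p unfolding lipschitz_curves_def by blast
  have L0: "L \<ge> 0" using L[rule_format, of 0 1] cseminorm_nonneg[OF p, of "\<gamma> 1 - \<gamma> 0"] by simp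
  have "p (stop_curve t \<gamma> u - stop_curve t \<gamma> s) \<le> L * \<bar>u - s\<bar>" if "s \<in> {0..1}" "u \<in> {0..1}" for s u
  proof -
    have "p (stop_curve t \<gamma> u - stop_curve t \<gamma> s) = p (\<gamma> (min u t) - \<gamma> (min s t))"
      using that by (simp add: stop_curve_def)
    also have "\<dots> \<le> L * \<bar>min u t - min s t\<bar>"
      using that t by (intro L[rule_format]) auto
    also have "\<dots> \<le> L * \<bar>u - s\<bar>" using L0 by (intro mult_left_mono) auto
    finally show ?thesis .
  qed
  then show "\<exists>L. \<forall>s\<in>{0..1}. \<forall>u\<in>{0..1}. p (stop_curve t \<gamma> u - stop_curve t \<gamma> s) \<le> L * \<bar>u - s\<bar>" by blast
qed

lemma stop_curve_C0:
  assumes g: "\<gamma> \<in> (C_curves 0 :: (real \<Rightarrow> 'b) set)" and t: "t \<in> {0..1}"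
  shows "continuous_on {0..1} (stop_curve t \<gamma>)"
proof -
  have "continuous_on {0..1} (\<lambda>s. \<gamma> (min s t))"
  proof (rule continuous_on_compose2[of "{0..1}" \<gamma>])
    show "continuous_on {0..1} \<gamma>" using g by (simp add: C_curves_0_iff)
    show "continuous_on {0..1} (\<lambda>s. min s t)" by (intro continuous_intros)
    show "(\<lambda>s. min s t) ` {0..1} \<subseteq> {0..1}" using t by auto
  qed
  moreover have "continuous_on {0..1} (stop_curve t \<gamma>) \<longleftrightarrow> continuous_on {0..1} (\<lambda>s. \<gamma> (min s t))"
    by (rule continuous_on_cong[OF refl]) (simp add: stop_curve_def)
  ultimately show ?thesis by blast
qed

end

lemma grid_interval_subset:
  assumes "N > 0" "k < N"
  shows "{real k / real N..real (Suc k) / real N} \<subseteq> {0..1}"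
proof -
  have "real (Suc k) / real N \<le> 1" using assms by (simp add: divide_le_eq del: of_nat_Suc)
  then show ?thesis by auto
qed

lemma grid_tagged_division:
  assumes N: "N > 0"
  defines "J \<equiv> \<lambda>k::nat. {real k / real N..real (Suc k) / real N}"
  shows "(\<lambda>k. (real k / real N, J k)) ` {..<N} tagged_division_of {0..1}"
proof (rule tagged_division_ofI)
  have Ji: "J i \<subseteq> {0..1}" if "i < N" for i
    unfolding J_def by (rule grid_interval_subset[OF N that])
  show "finite ((\<lambda>k. (real k / real N, J k)) ` {..<N})" by simp
  fix x k assume "(x, k) \<in> (\<lambda>k. (real k / real N, J k)) ` {..<N}"
  then obtain i where i: "i < N" "x = real i / real N" "k = J i" by auto
  show "x \<in> k" "k \<subseteq> {0..1}" using i Ji[of i] N by (auto simp: J_def divide_right_mono)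
  show "\<exists>a b. k = cbox a b" using i by (auto simp: J_def)
  fix x' k' assume "(x', k') \<in> (\<lambda>k. (real k / real N, J k)) ` {..<N}" and ne: "(x, k) \<noteq> (x', k')"
  then obtain j where j: "j < N" "x' = real j / real N" "k' = J j" by auto
  have "i \<noteq> j" using ne i j by auto
  have disj: "interior (J a) \<inter> interior (J b) = {}" if "a < b" for a b
  proof -
    have "real (Suc a) / real N \<le> real b / real N" using that by (intro divide_right_mono) auto
    then show ?thesis unfolding J_def by (auto simp: interior_atLeastAtMost_real)
  qed
  show "interior k \<inter> interior k' = {}"
    using disj[of i j] disj[of j i] \<open>i \<noteq> j\<close> i j by (cases "i < j") auto
next
  show "\<Union>{k. \<exists>x. (x, k) \<in> (\<lambda>k. (real k / real N, J k)) ` {..<N}} = {0..1}"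
  proof
    show "\<Union>{k. \<exists>x. (x, k) \<in> (\<lambda>k. (real k / real N, J k)) ` {..<N}} \<subseteq> {0..1}"
      using grid_interval_subset[OF N] unfolding J_def by blast
    show "{0..1} \<subseteq> \<Union>{k. \<exists>x. (x, k) \<in> (\<lambda>k. (real k / real N, J k)) ` {..<N}}"
    proof
      fix x assume x: "x \<in> {0..1::real}"
      \<comment> \<open>The minimum assigns the right endpoint \<open>x = 1\<close> to the last
        interval.\<close>
      define i where "i = min (nat \<lfloor>x * real N\<rfloor>) (N - 1)"
      have iN: "i < N" using N by (simp add: i_def)
      have fl: "real (nat \<lfloor>x * real N\<rfloor>) \<le> x * real N" "x * real N < real (nat \<lfloor>x * real N\<rfloor>) + 1"
      proof -
        have y: "0 \<le> x * real N" using x by simp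
        then have "real (nat \<lfloor>x * real N\<rfloor>) = of_int \<lfloor>x * real N\<rfloor>" by simp
        then show "real (nat \<lfloor>x * real N\<rfloor>) \<le> x * real N" "x * real N < real (nat \<lfloor>x * real N\<rfloor>) + 1"
          using floor_correct[of "x * real N"] by linarith+
      qed
      have "real i \<le> x * real N" using fl(1) by (simp add: i_def)
      moreover have "x * real N \<le> real (Suc i)"
      proof (cases "nat \<lfloor>x * real N\<rfloor> \<le> N - 1")
        case True
        then show ?thesis using fl(2) by (simp add: i_def)
      next
        case False
        then have "Suc i = N" using N by (simp add: i_def)
        then show ?thesis using x mult_right_mono[of x 1 "real N"] by simp
      qed
      ultimately have "x \<in> J i" using N unfolding J_def by (simp add: field_simps)
      then show "x \<in> \<Union>{k. \<exists>x. (x, k) \<in> (\<lambda>k. (real k / real N, J k)) ` {..<N}}" using iN by blast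
    qed
  qed
qed

lemma riemann_sums_converge_if_integrable:
  assumes I: "has_riemann_integral h I"
  shows "(\<lambda>n. riemann_sum (Suc n) h) \<longlonglongrightarrow> I"
proof (rule topological_tendstoI)
  fix U assume "open U" "I \<in> U"
  then obtain d where d: "d > 0" "\<And>\<D>. \<D> tagged_division_of {0..1} \<Longrightarrow> \<forall>(t, J)\<in>\<D>. diameter J < d \<Longrightarrow>
      (\<Sum>(t, J)\<in>\<D>. measure lborel J *\<^sub>R h t) \<in> U"
    using I unfolding has_riemann_integral_def by meson
  obtain n0 where n0: "inverse (real (Suc n0)) < d" using reals_Archimedean[OF d(1)] by blast
  have "riemann_sum (Suc n) h \<in> U" if "n \<ge> n0" for n
  proof -
    define N where "N = Suc n"
    define J where "J k = {real k / real N..real (Suc k) / real N}" for k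
    define \<D> where "\<D> = (\<lambda>k. (real k / real N, J k)) ` {..<N}"
    have N: "N > 0" by (simp add: N_def)
    have td: "\<D> tagged_division_of {0..1}"
      unfolding \<D>_def J_def by (rule grid_tagged_division[OF N])
    have len: "real (Suc k) / real N - real k / real N = 1 / real N" for k
      by (simp add: diff_divide_distrib[symmetric])
    have le: "real k / real N \<le> real (Suc k) / real N" for k by (intro divide_right_mono) auto
    have "1 / real N < d"
    proof -
      have "1 / real (Suc n) \<le> 1 / real (Suc n0)" using that by (intro divide_left_mono) auto
      then show ?thesis using n0 by (simp add: N_def inverse_eq_divide)
    qed
    then have "diameter (J k) < d" for k unfolding J_def using le[of k] len[of k] by simp
    then have "(\<Sum>(t, J)\<in>\<D>. measure lborel J *\<^sub>R h t) \<in> U"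
      by (intro d(2)[OF td]) (auto simp: \<D>_def)
    moreover have "(\<Sum>(t, J)\<in>\<D>. measure lborel J *\<^sub>R h t) = (\<Sum>k<N. (1 / real N) *\<^sub>R h (real k / real N))"
    proof -
      have inj: "inj_on (\<lambda>k. (real k / real N, J k)) {..<N}"
        using N by (auto simp: inj_on_def)
      have m: "measure lborel (J k) = 1 / real N" for k
        unfolding J_def measure_lborel_Icc[OF le] by (rule len)
      show ?thesis unfolding \<D>_def by (subst sum.reindex[OF inj]) (simp add: m)
    qed
    ultimately show ?thesis by (simp add: riemann_sum_def N_def scaleR_sum_right del: sum.lessThan_Suc)
  qed
  then show "\<forall>\<^sub>F n in sequentially. riemann_sum (Suc n) h \<in> U"
    unfolding eventually_sequentially by blast
qed

lemma (in seminormed_space) antiderivative_continuous: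
  assumes "sequentially_complete TYPE('b)" "\<gamma> \<in> (C_curves 0 :: (real \<Rightarrow> 'b) set)"
  shows "\<exists>F\<in>C_curves 1. F 0 = 0 \<and> (\<forall>t\<in>{0..1}. has_curve_deriv F (\<gamma> t) t)"
  by (intro antiderivative_from_riemann_sums[OF assms(2)]
      riemann_sums_converge_if_sequentially_complete[OF assms(1)] stop_curve_C0[OF assms(2)])

text \<open>Mackey completeness integrates every stopped curve, as it is again Lipschitz; the
  equidistant sums are one sequence converging to this integral.\<close>

lemma (in locally_convex_space) antiderivative_Lip:
  assumes K: "K = \<real> \<or> K = UNIV" and mc: "mackey_complete K cs" and g: "\<gamma> \<in> (lipschitz_curves :: (real \<Rightarrow> 'a) set)"
  shows "\<exists>F\<in>C_curves 1. F 0 = 0 \<and> (\<forall>t\<in>{0..1}. has_curve_deriv F (\<gamma> t) t)"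
proof -
  interpret seminormed_space "TYPE('a)" by (rule seminormed_space[OF K])
  have g0: "\<gamma> \<in> C_curves 0" using g lipschitz_curves_subset_C_curves_0 by blast
  show ?thesis
  proof (rule antiderivative_from_riemann_sums[OF g0])
    fix t :: real assume t: "t \<in> {0..1}"
    have "stop_curve t \<gamma> \<in> Lip K cs"
      using stop_curve_lipschitz[OF g t] Lip_eq_lipschitz_curves[OF K] by simp
    then obtain I where "has_riemann_integral (stop_curve t \<gamma>) I"
      using mc unfolding mackey_complete_def by blast
    then show "\<exists>I. (\<lambda>n. riemann_sum (Suc n) (stop_curve t \<gamma>)) \<longlonglongrightarrow> I"
      using riemann_sums_converge_if_integrable by blast
  qed
qed

section \<open>Complexification\<close>

lemma has_curve_deriv_Pair:
  assumes "has_curve_deriv f v t" "has_curve_deriv g w t"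
  shows "has_curve_deriv (\<lambda>s. (f s, g s)) (v, w) t"
  using tendsto_Pair[OF assms[unfolded has_curve_deriv_def]] by (simp add: has_curve_deriv_def)

lemma cseminorm_comp:
  fixes L :: "'c::{real_vector,t2_space} \<Rightarrow> 'b::{real_vector,t2_space}"
  assumes p: "cseminorm p" and L: "linear L" "continuous_on UNIV L"
  shows "cseminorm (\<lambda>x. p (L x))"
  unfolding cseminorm_def
  using cseminorm_add[OF p] cseminorm_scale[OF p] continuous_on_compose2[OF cseminorm_cont[OF p] L(2)]
  by (simp add: linear_add[OF L(1)] linear_scale[OF L(1)])

lemma continuous_on_inj_Pair:
  "continuous_on UNIV (\<lambda>x::'b::{zero,topological_space}. (x, 0::'b))"
  "continuous_on UNIV (\<lambda>x::'b. (0::'b, x))"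
  by (intro continuous_on_Pair continuous_on_id continuous_on_const)+

lemma linear_inj_Pair:
  "linear (\<lambda>x::'b::real_vector. (x, 0::'b))" "linear (\<lambda>x::'b. (0::'b, x))"
  by (auto simp: linear_iff)

lemma cseminorm_le_components:
  assumes P: "cseminorm (P :: 'b::{real_vector,t2_space} \<times> 'b \<Rightarrow> real)"
  shows "P z \<le> P (fst z, 0) + P (0, snd z)"
  using cseminorm_add[OF P, of "(fst z, 0)" "(0, snd z)"] by simp

lemma linear_comp_lipschitz_curves:
  assumes g: "\<gamma> \<in> lipschitz_curves" and L: "linear L" "continuous_on UNIV L"
  shows "(\<lambda>t. L (\<gamma> t)) \<in> lipschitz_curves"
  unfolding lipschitz_curves_def
proof (intro CollectI conjI allI impI)
  show "L (\<gamma> t) = 0" if "t \<notin> {0..1}" for t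
    using g that by (simp add: lipschitz_curves_def linear_0[OF L(1)])
  fix p :: "'b \<Rightarrow> real" assume "cseminorm p"
  from cseminorm_comp[OF this L] g
  show "\<exists>M. \<forall>s\<in>{0..1}. \<forall>t\<in>{0..1}. p (L (\<gamma> t) - L (\<gamma> s)) \<le> M * \<bar>t - s\<bar>"
    unfolding linear_diff[OF L(1), symmetric] lipschitz_curves_def by blast
qed

lemma linear_comp_C_curves_0:
  assumes g: "\<gamma> \<in> C_curves 0" and L: "linear L" "continuous_on UNIV L"
  shows "(\<lambda>t. L (\<gamma> t)) \<in> C_curves 0"
  using g by (auto simp: C_curves_0_iff linear_0[OF L(1)] intro!: continuous_on_compose2[OF L(2)])

lemma curve_sup_comp: "curve_sup p (\<lambda>t. L (\<gamma> t)) = curve_sup (\<lambda>x. p (L x)) \<gamma>"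
  by (simp add: curve_sup_def)

lemma linear_comp_C_curves_1:
  fixes L :: "'c::{real_vector,t2_space} \<Rightarrow> 'b::{real_vector,t2_space}"
  assumes "seminormed_space TYPE('b)" "seminormed_space TYPE('c)"
    and g: "\<gamma> \<in> C_curves 1" and L: "linear L" "continuous_on UNIV L"
  shows "(\<lambda>t. L (\<gamma> t)) \<in> C_curves 1"
    and "curve_deriv (\<lambda>t. L (\<gamma> t)) = (\<lambda>t. L (curve_deriv \<gamma> t))"
proof -
  interpret B: seminormed_space "TYPE('b)" by fact
  interpret C: seminormed_space "TYPE('c)" by fact
  have d: "has_curve_deriv (\<lambda>t. L (\<gamma> t)) (L (curve_deriv \<gamma> t)) t" if "t \<in> {0..1}" for t
    by (rule C.has_curve_deriv_linear[OF C.C_curves_1D(1)[OF g that] L])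
  have cont: "continuous_on {0..1} (\<lambda>t. L (curve_deriv \<gamma> t))"
    using linear_comp_C_curves_0[OF C.C_curves_1D(2)[OF g] L] by (simp add: C_curves_0_iff)
  have out: "L (\<gamma> t) = 0" if "t \<notin> {0..1}" for t
    using C_curves_outside[OF g that] by (simp add: linear_0[OF L(1)])
  show "(\<lambda>t. L (\<gamma> t)) \<in> C_curves 1" by (rule B.C_curves_1I[OF out d cont])
  show "curve_deriv (\<lambda>t. L (\<gamma> t)) = (\<lambda>t. L (curve_deriv \<gamma> t))"
  proof
    fix t
    show "curve_deriv (\<lambda>t. L (\<gamma> t)) t = L (curve_deriv \<gamma> t)"
    proof (cases "t \<in> {0..1}")
      case True
      show ?thesis by (rule B.curve_deriv_eq[OF d[OF True] True])
    next
      case False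
      show ?thesis
        unfolding B.curve_deriv_outside[OF False] C.curve_deriv_outside[OF False] by (simp add: linear_0[OF L(1)])
    qed
  qed
qed

lemma seminormed_space_Pair:
  assumes "seminormed_space TYPE('b::{real_vector,t2_space})"
  shows "seminormed_space TYPE('b \<times> 'b)"
proof
  interpret seminormed_space "TYPE('b)" by fact
  show "continuous_on UNIV (\<lambda>z. z + w)" for w :: "'b \<times> 'b"
  proof -
    have "continuous_on UNIV (\<lambda>z::'b \<times> 'b. (fst z + fst w, snd z + snd w))"
      by (intro continuous_on_Pair continuous_on_compose2[OF continuous_translation])
        (auto intro: continuous_intros)
    then show ?thesis by (simp add: plus_prod_def)
  qed
  fix U :: "('b \<times> 'b) set" and z assume "open U" "z \<in> U"
  then obtain A B where AB: "open A" "open B" "z \<in> A \<times> B" "A \<times> B \<subseteq> U"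
    using open_prod_elim[OF \<open>open U\<close> \<open>z \<in> U\<close>] by metis
  obtain p where p: "cseminorm p" "\<And>y. p (y - fst z) < 1 \<Longrightarrow> y \<in> A"
    using open_contains_seminorm_ball[OF AB(1), of "fst z"] AB(3) by auto
  obtain q where q: "cseminorm q" "\<And>y. q (y - snd z) < 1 \<Longrightarrow> y \<in> B"
    using open_contains_seminorm_ball[OF AB(2), of "snd z"] AB(3) by auto
  have "cseminorm (\<lambda>z. p (fst z) + q (snd z))"
    by (rule cseminorm_plus[OF cseminorm_comp[OF p(1) linear_fst] cseminorm_comp[OF q(1) linear_snd]])
      (intro continuous_on_fst continuous_on_snd continuous_on_id)+
  moreover have "y \<in> U" if "p (fst (y - z)) + q (snd (y - z)) < 1" for y
  proof -
    have "p (fst y - fst z) < 1" "q (snd y - snd z) < 1"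
      using that cseminorm_nonneg[OF p(1), of "fst (y - z)"] cseminorm_nonneg[OF q(1), of "snd (y - z)"] by auto
    then have "y \<in> A \<times> B" using p(2) q(2) by (simp add: mem_Times_iff)
    then show ?thesis using AB(4) by blast
  qed
  ultimately show "\<exists>p. cseminorm p \<and> (\<forall>y. p (y - z) < 1 \<longrightarrow> y \<in> U)"
    by (intro exI[of _ "\<lambda>z. p (fst z) + q (snd z)"]) blast
qed

definition complexified_mult :: "('b \<Rightarrow> 'b \<Rightarrow> 'b) \<Rightarrow> 'b::real_vector \<times> 'b \<Rightarrow> 'b \<times> 'b \<Rightarrow> 'b \<times> 'b" where
  "complexified_mult m z w =
     (m (fst z) (fst w) - m (snd z) (snd w), m (fst z) (snd w) + m (snd z) (fst w))"

text \<open>\<open>P\<close> is controlled by its restrictions to the two axes, whose sum,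
  transported to one copy of \<open>'b\<close>, is a seminorm there. The resulting \<open>p'\<close>
  and \<open>q'\<close>, summed over both components, bound the four products that make up a complex
  product.\<close>

lemma (in bounded_mult) bounded_mult_Pair: "bounded_mult (complexified_mult m)"
proof (intro bounded_mult.intro bounded_mult_axioms.intro)
  show "seminormed_space TYPE('b \<times> 'b)" by (rule seminormed_space_Pair[OF seminormed_space_axioms])
  fix x y z :: "'b \<times> 'b" and r :: real
  show "complexified_mult m (x + y) z = complexified_mult m x z + complexified_mult m y z"
    "complexified_mult m x (y + z) = complexified_mult m x y + complexified_mult m x z"
    "complexified_mult m (r *\<^sub>R x) y = r *\<^sub>R complexified_mult m x y"
    "complexified_mult m x (r *\<^sub>R y) = r *\<^sub>R complexified_mult m x y"
    by (simp_all add: complexified_mult_def mult_add_left mult_add_right mult_scaleR_left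
        mult_scaleR_right algebra_simps)
next
  fix P :: "'b \<times> 'b \<Rightarrow> real" assume P: "cseminorm P"
  have "cseminorm (\<lambda>x. P (x, 0) + P (0, x))"
    by (intro cseminorm_plus cseminorm_comp[OF P] linear_inj_Pair continuous_on_inj_Pair)
  then obtain p' q' where pq: "cseminorm p'" "cseminorm q'" "\<And>x. P (x, 0) + P (0, x) \<le> p' x"
    "\<And>x y. p' (m x y) \<le> p' x * q' y"
    using mult_bound by meson
  have c: "cseminorm (\<lambda>z::'b \<times> 'b. p (fst z) + p (snd z))" if "cseminorm p" for p :: "'b \<Rightarrow> real"
    by (rule cseminorm_plus[OF cseminorm_comp[OF that linear_fst] cseminorm_comp[OF that linear_snd]])
      (intro continuous_on_fst continuous_on_snd continuous_on_id)+
  have "P z \<le> p' (fst z) + p' (snd z)" for z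
    using cseminorm_le_components[OF P, of z] pq(3)[of "fst z"] pq(3)[of "snd z"]
      cseminorm_nonneg[OF P, of "(0, fst z)"] cseminorm_nonneg[OF P, of "(snd z, 0)"] by linarith
  moreover have "p' (fst (complexified_mult m z w)) + p' (snd (complexified_mult m z w)) \<le>
      (p' (fst z) + p' (snd z)) * (q' (fst w) + q' (snd w))" for z w
  proof -
    have "p' (fst (complexified_mult m z w)) \<le> p' (m (fst z) (fst w)) + p' (m (snd z) (snd w))"
      unfolding complexified_mult_def fst_conv by (rule cseminorm_diff[OF pq(1)])
    also have "\<dots> \<le> p' (fst z) * q' (fst w) + p' (snd z) * q' (snd w)" by (intro add_mono pq)
    finally have 1: "p' (fst (complexified_mult m z w)) \<le> p' (fst z) * q' (fst w) + p' (snd z) * q' (snd w)" .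
    have "p' (snd (complexified_mult m z w)) \<le> p' (m (fst z) (snd w)) + p' (m (snd z) (fst w))"
      unfolding complexified_mult_def snd_conv by (rule cseminorm_add[OF pq(1)])
    also have "\<dots> \<le> p' (fst z) * q' (snd w) + p' (snd z) * q' (fst w)" by (intro add_mono pq)
    finally have 2: "p' (snd (complexified_mult m z w)) \<le> p' (fst z) * q' (snd w) + p' (snd z) * q' (fst w)" .
    show ?thesis using 1 2 by (simp add: algebra_simps)
  qed
  ultimately show "\<exists>p' q'. cseminorm p' \<and> cseminorm q' \<and> (\<forall>z. P z \<le> p' z) \<and>
      (\<forall>z w. p' (complexified_mult m z w) \<le> p' z * q' w)"
    using c[OF pq(1)] c[OF pq(2)]
    by (intro exI[of _ "\<lambda>z. p' (fst z) + p' (snd z)"] exI[of _ "\<lambda>z. q' (fst z) + q' (snd z)"]) blast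
qed

section \<open>Pairs of curves as curves in the complexification\<close>

definition pair_curves :: "(real \<Rightarrow> 'b) set \<Rightarrow> (real \<Rightarrow> 'b \<times> 'b) set" where
  "pair_curves X = {w. (\<lambda>t. fst (w t)) \<in> X \<and> (\<lambda>t. snd (w t)) \<in> X}"

text \<open>Unlike \<open>C_topology\<close> it refers to no \<open>K\<close> and \<open>cs\<close>,
  so it applies to curves of pairs.\<close>

definition seminorm_generated :: "'e::real_vector set \<Rightarrow> ('e \<Rightarrow> real) set \<Rightarrow> 'e topology" where
  "seminorm_generated S \<Q> =
     topology_generated_by {{y\<in>S. Q (y - x) < e} |x Q e. x \<in> S \<and> Q \<in> \<Q> \<and> e > 0}"

lemma (in seminormed_space) seminorm_topology_curves:
  assumes S: "subspace S"
    and N: "S \<subseteq> C_curves 0 \<and> N = (curve_sup :: ('b \<Rightarrow> real) \<Rightarrow> _) \<or> S \<subseteq> C_curves 1 \<and> N = curve_sup1"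
  shows "seminorm_topology (seminorm_generated S (N ` {p. cseminorm p})) S (N ` {p. cseminorm p})"
proof (rule seminorm_topology_generated[OF S _ _ _ _ _ _ _ seminorm_generated_def])
  show "N ` {p. cseminorm p} \<noteq> {}" using cseminorm_null by blast
  then show "N ` {p. cseminorm p} \<noteq> {}" .
  show "seminorm_on S Q" if Q: "Q \<in> N ` {p. cseminorm p}" for Q
    using N Q seminorm_on_curve_sup seminorm_on_curve_sup1 seminorm_on_subset by blast
  then show "seminorm_on S Q" if "Q \<in> N ` {p. cseminorm p}" for Q using that .
  show "\<exists>R\<in>N ` {p. cseminorm p}. \<forall>x\<in>S. P x \<le> R x \<and> Q x \<le> R x"
    if PQ: "P \<in> N ` {p. cseminorm p}" "Q \<in> N ` {p. cseminorm p}" for P Q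
  proof -
    obtain p q where pq: "P = N p" "Q = N q" "cseminorm p" "cseminorm q" using PQ by blast
    have "N p \<gamma> \<le> N (\<lambda>x. p x + q x) \<gamma> \<and> N q \<gamma> \<le> N (\<lambda>x. p x + q x) \<gamma>" if "\<gamma> \<in> S" for \<gamma>
      using N that curve_sup_directed[OF pq(3,4), of \<gamma>] curve_sup_directed[OF pq(3,4), of "curve_deriv \<gamma>"]
        C_curves_1D(2,3)[of \<gamma>]
      by (auto simp: curve_sup1_def intro!: add_mono)
    moreover have "N (\<lambda>x. p x + q x) \<in> N ` {p. cseminorm p}" using cseminorm_plus[OF pq(3,4)] by blast
    ultimately show ?thesis using pq(1,2) by blast
  qed
qed auto

context curve_ode
begin

text \<open>The requirements can be checked componentwise. Antiderivatives in particular are simply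
  paired, so completeness of the complexification does not have to be discussed.\<close>

lemma curve_ode_Pair:
  "curve_ode (complexified_mult m) (pair_curves X)
     (seminorm_generated (pair_curves X) (curve_sup ` {p. cseminorm p}))
     (seminorm_generated (C_curves 1) (curve_sup1 ` {p. cseminorm p}))"
proof (intro curve_ode.intro bounded_mult_Pair curve_ode_axioms.intro)
  interpret P: seminormed_space "TYPE('b \<times> 'b)" by (rule seminormed_space_Pair[OF seminormed_space_axioms])
  note contfs = continuous_on_fst[OF continuous_on_id] continuous_on_snd[OF continuous_on_id]
  have comp: "(\<lambda>t. fst ((u + v) t)) = (\<lambda>t. fst (u t)) + (\<lambda>t. fst (v t))"
    "(\<lambda>t. snd ((u + v) t)) = (\<lambda>t. snd (u t)) + (\<lambda>t. snd (v t))"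
    "(\<lambda>t. fst ((r *\<^sub>R u) t)) = r *\<^sub>R (\<lambda>t. fst (u t))"
    "(\<lambda>t. snd ((r *\<^sub>R u) t)) = r *\<^sub>R (\<lambda>t. snd (u t))"
    "(\<lambda>t. fst ((0 :: real \<Rightarrow> 'b \<times> 'b) t)) = 0" "(\<lambda>t. snd ((0 :: real \<Rightarrow> 'b \<times> 'b) t)) = 0"
    for u v :: "real \<Rightarrow> 'b \<times> 'b" and r
    by (auto simp: scaleR_fun_def)
  show sub: "subspace (pair_curves X)"
    unfolding subspace_def pair_curves_def mem_Collect_eq comp
    by (auto simp: comp zero_X X_add X_scaleR)
  show "lipschitz_curves \<subseteq> pair_curves X"
    unfolding pair_curves_def
    using linear_comp_lipschitz_curves[OF _ linear_fst contfs(1)]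
      linear_comp_lipschitz_curves[OF _ linear_snd contfs(2)] lipschitz_subset by blast
  show X0: "pair_curves X \<subseteq> C_curves 0"
  proof
    fix w assume w: "w \<in> pair_curves X"
    have C: "(\<lambda>t. fst (w t)) \<in> C_curves 0" "(\<lambda>t. snd (w t)) \<in> C_curves 0"
      using w X_C0 by (auto simp: pair_curves_def)
    then have "continuous_on {0..1} (\<lambda>t. (fst (w t), snd (w t)))"
      unfolding C_curves_0_iff by (intro continuous_on_Pair) blast+
    moreover have "w t = 0" if "t \<notin> {0..1}" for t
      using C_curves_outside[OF C(1) that] C_curves_outside[OF C(2) that] by (simp add: prod_eq_iff)
    ultimately show "w \<in> C_curves 0" by (simp add: C_curves_0_iff)
  qed
  show "(\<lambda>t. complexified_mult m (u t) (\<gamma> t)) \<in> pair_curves X"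
    if u: "u \<in> pair_curves X" and g: "\<gamma> \<in> pair_curves X" for u \<gamma>
  proof -
    have X: "(\<lambda>t. m (fst (u t)) (fst (\<gamma> t))) \<in> X" "(\<lambda>t. m (snd (u t)) (snd (\<gamma> t))) \<in> X"
      "(\<lambda>t. m (fst (u t)) (snd (\<gamma> t))) \<in> X" "(\<lambda>t. m (snd (u t)) (fst (\<gamma> t))) \<in> X"
      using u g X_mult by (auto simp: pair_curves_def)
    show ?thesis using X_diff[OF X(1,2)] X_add[OF X(3,4)]
      by (simp add: pair_curves_def complexified_mult_def fun_diff_def plus_fun_def)
  qed
  show "\<exists>F\<in>C_curves 1. F 0 = 0 \<and> (\<forall>t\<in>{0..1}. has_curve_deriv F (\<gamma> t) t)" if g: "\<gamma> \<in> pair_curves X" for \<gamma>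
  proof -
    have g12: "(\<lambda>t. fst (\<gamma> t)) \<in> X" "(\<lambda>t. snd (\<gamma> t)) \<in> X" using g by (auto simp: pair_curves_def)
    from antiderivative[OF g12(1)] obtain F where F: "F \<in> C_curves 1" "F 0 = 0"
      "\<forall>t\<in>{0..1}. has_curve_deriv F (fst (\<gamma> t)) t" by (elim bexE conjE)
    from antiderivative[OF g12(2)] obtain G where G: "G \<in> C_curves 1" "G 0 = 0"
      "\<forall>t\<in>{0..1}. has_curve_deriv G (snd (\<gamma> t)) t" by (elim bexE conjE)
    have d: "has_curve_deriv (\<lambda>t. (F t, G t)) (\<gamma> t) t" if "t \<in> {0..1}" for t
      using has_curve_deriv_Pair[OF bspec[OF F(3) that] bspec[OF G(3) that]] by simp
    have "(\<lambda>t. (F t, G t)) \<in> C_curves 1"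
    proof (rule P.C_curves_1I[OF _ d])
      show "(F t, G t) = 0" if "t \<notin> {0..1}" for t
        using C_curves_outside[OF F(1) that] C_curves_outside[OF G(1) that] by (simp add: zero_prod_def)
      show "continuous_on {0..1} \<gamma>" using X0 g by (auto simp: C_curves_0_iff)
    qed
    then show ?thesis using F(2) G(2) d by (intro bexI[of _ "\<lambda>t. (F t, G t)"]) (auto simp: zero_prod_def)
  qed
  show "seminorm_topology (seminorm_generated (pair_curves X) (curve_sup ` {p. cseminorm p}))
      (pair_curves X) (curve_sup ` {p. cseminorm p})"
    by (rule P.seminorm_topology_curves[OF sub]) (use X0 in blast)
  show "seminorm_topology (seminorm_generated (C_curves 1) (curve_sup1 ` {p. cseminorm p}))
      (C_curves 1 :: (real \<Rightarrow> 'b \<times> 'b) set) (curve_sup1 ` {p. cseminorm p})"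
    by (rule P.seminorm_topology_curves[OF P.subspace_C_curves_1]) blast
qed

text \<open>
  The extension to the complexification consists of arbitrary \<open>C\<^sup>1\<close>-curves, so it is irrelevant whether
  it takes invertible values.
\<close>

lemma real_analytic_evo: "real_analytic_map TE TF X (evo a)"
proof -
  define TE2 where "TE2 = seminorm_generated (pair_curves X) (curve_sup ` {p. cseminorm p})"
  define TF2 :: "(real \<Rightarrow> 'b \<times> 'b) topology" where
    "TF2 = seminorm_generated (C_curves 1) (curve_sup1 ` {p. cseminorm p})"
  interpret P: curve_ode "TYPE('b \<times> 'b)" "complexified_mult m" "pair_curves X" TE2 TF2
    unfolding TE2_def TF2_def by (rule curve_ode_Pair)
  note contfs = continuous_on_fst[OF continuous_on_id] continuous_on_snd[OF continuous_on_id]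
  note C1L = linear_comp_C_curves_1[OF seminormed_space_axioms P.seminormed_space_axioms]
  define \<Phi> where "\<Phi> uv = (\<lambda>t. (fst uv t, snd uv t))" for uv :: "(real \<Rightarrow> 'b) \<times> (real \<Rightarrow> 'b)"
  define \<Psi> where "\<Psi> w = ((\<lambda>t. fst (w t)), (\<lambda>t. snd (w t)))" for w :: "real \<Rightarrow> 'b \<times> 'b"
  define g where "g uv = \<Psi> (P.evo (a, 0) (\<Phi> uv))" for uv
  have \<Phi>X: "\<Phi> uv \<in> pair_curves X \<longleftrightarrow> uv \<in> X \<times> X" for uv
    by (simp add: \<Phi>_def pair_curves_def mem_Times_iff)
  have "complex_analytic_map complexification_scale (prod_topology TE TE)
      complexification_scale (prod_topology TF TF) (X \<times> X) g"
  proof (rule P.complex_analytic_evo[where \<Phi> = \<Phi> and \<Psi> = \<Psi> and cs = complexification_scale and a = "(a, 0)"])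
    show "topspace (prod_topology TE TE) = X \<times> X" by (simp add: topspace_TE)
    show "subspace (X \<times> X)"
      unfolding subspace_def by (auto simp: zero_X X_add X_scaleR zero_prod_def)
    show "continuous_map (prod_topology TE TE) TE2 \<Phi>"
      unfolding continuous_map_atin
    proof
      fix uv assume uv: "uv \<in> topspace (prod_topology TE TE)"
      let ?F = "atin (prod_topology TE TE) uv"
      have 1: "limitin TE fst (fst uv) ?F" and 2: "limitin TE snd (snd uv) ?F"
        using continuous_map_fst[of TE TE] continuous_map_snd[of TE TE] uv by (auto simp: continuous_map_atin)
      show "limitin TE2 \<Phi> (\<Phi> uv) ?F"
      proof (rule P.limitin_TE_I)
        show "\<Phi> uv \<in> pair_curves X" using uv by (simp add: \<Phi>X topspace_TE)
        have "\<forall>\<^sub>F z in ?F. fst z \<in> X" "\<forall>\<^sub>F z in ?F. snd z \<in> X" using 1 2 unfolding E.limitin_iff by blast+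
        then show "\<forall>\<^sub>F z in ?F. \<Phi> z \<in> pair_curves X"
          by eventually_elim (simp add: \<Phi>X mem_Times_iff)
        fix p :: "'b \<times> 'b \<Rightarrow> real" assume p: "cseminorm p"
        define p1 where "p1 x = p (x, 0)" for x
        define p2 where "p2 x = p (0, x)" for x
        have c: "cseminorm p1" "cseminorm p2"
          unfolding p1_def[abs_def] p2_def[abs_def]
          by (intro cseminorm_comp[OF p] linear_inj_Pair continuous_on_inj_Pair)+
        have "((\<lambda>z. curve_sup p1 (fst z - fst uv) + curve_sup p2 (snd z - snd uv)) \<longlongrightarrow> 0 + 0) ?F"
          by (intro tendsto_add limitin_TE_D(1)[OF 1 c(1)] limitin_TE_D(1)[OF 2 c(2)])
        moreover have "\<forall>\<^sub>F z in ?F. \<forall>t\<in>{0..1}. p (\<Phi> z t - \<Phi> uv t) \<le>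
            curve_sup p1 (fst z - fst uv) + curve_sup p2 (snd z - snd uv)"
          using limitin_TE_D(2)[OF 1 c(1)] limitin_TE_D(2)[OF 2 c(2)]
        proof eventually_elim
          case (elim z)
          show ?case
          proof
            fix t assume t: "t \<in> {0..1::real}"
            have "p (\<Phi> z t - \<Phi> uv t) \<le> p1 (fst z t - fst uv t) + p2 (snd z t - snd uv t)"
              using cseminorm_le_components[OF p, of "\<Phi> z t - \<Phi> uv t"] by (simp add: \<Phi>_def p1_def p2_def)
            also have "\<dots> \<le> curve_sup p1 (fst z - fst uv) + curve_sup p2 (snd z - snd uv)"
              using elim t by (intro add_mono) auto
            finally show "p (\<Phi> z t - \<Phi> uv t) \<le> curve_sup p1 (fst z - fst uv) + curve_sup p2 (snd z - snd uv)" .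
          qed
        qed
        ultimately show "\<exists>h. (h \<longlongrightarrow> 0) ?F \<and> (\<forall>\<^sub>F z in ?F. \<forall>t\<in>{0..1}. p (\<Phi> z t - \<Phi> uv t) \<le> h z)" by auto
      qed
    qed
    show "\<Phi> (x + y) = \<Phi> x + \<Phi> y" for x y by (simp add: \<Phi>_def fun_eq_iff)
    show "\<Phi> (complexification_scale c x) = pointwise_scale complexification_scale c (\<Phi> x)" for c x
      by (simp add: \<Phi>_def complexification_scale_def pointwise_scale_def fun_eq_iff scaleR_fun_def split: prod.split)
    \<comment> \<open>Both components of \<open>\<Psi>\<close> are compositions with a continuous
      linear map, which commutes with differentiation and therefore respects
      \<open>C\<^sup>1\<close> convergence.\<close>
    have L: "continuous_map TF2 TF (\<lambda>w t. L (w t))" if L: "linear L" "continuous_on UNIV L" for L :: "'b \<times> 'b \<Rightarrow> 'b"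
      unfolding continuous_map_atin
    proof
      fix w assume "w \<in> topspace TF2"
      then have w: "w \<in> C_curves 1" by (simp add: P.topspace_TF)
      have lim: "limitin TF2 (\<lambda>w. w) w (atin TF2 w)"
        using bspec[OF continuous_map_id[of TF2, unfolded continuous_map_atin id_def]] w
        by (simp only: P.topspace_TF)
      have ev: "\<forall>\<^sub>F z in atin TF2 w. z \<in> C_curves 1" using lim unfolding P.F.limitin_iff by blast
      show "limitin TF (\<lambda>w t. L (w t)) (\<lambda>t. L (w t)) (atin TF2 w)"
        unfolding F.limitin_iff
      proof (intro conjI ballI)
        show "(\<lambda>t. L (w t)) \<in> C_curves 1" by (rule C1L(1)[OF w L])
        show "\<forall>\<^sub>F z in atin TF2 w. (\<lambda>t. L (z t)) \<in> C_curves 1"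
          using ev by eventually_elim (rule C1L(1)[OF _ L])
        fix Q assume "Q \<in> curve_sup1 ` {p :: 'b \<Rightarrow> real. cseminorm p}"
        then obtain p where p: "Q = curve_sup1 p" "cseminorm p" by blast
        have lim': "((\<lambda>z. curve_sup1 (\<lambda>x. p (L x)) (z - w)) \<longlongrightarrow> 0) (atin TF2 w)"
          using lim cseminorm_comp[OF p(2) L] unfolding P.F.limitin_iff by blast
        have "\<forall>\<^sub>F z in atin TF2 w. curve_sup1 (\<lambda>x. p (L x)) (z - w) = Q ((\<lambda>t. L (z t)) - (\<lambda>t. L (w t)))"
          using ev
        proof eventually_elim
          case (elim z)
          have zw: "z - w \<in> C_curves 1" by (rule subspace_diff[OF P.subspace_C_curves_1 elim w])
          have "(\<lambda>t. L (z t)) - (\<lambda>t. L (w t)) = (\<lambda>t. L ((z - w) t))"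
            by (simp add: fun_eq_iff linear_diff[OF L(1)])
          then show ?case
            by (simp only: p(1) curve_sup1_def curve_sup_comp C1L(2)[OF zw L])
        qed
        then show "((\<lambda>z. Q ((\<lambda>t. L (z t)) - (\<lambda>t. L (w t)))) \<longlongrightarrow> 0) (atin TF2 w)"
          by (rule Lim_transform_eventually[OF lim'])
      qed
    qed
    have "continuous_map TF2 (prod_topology TF TF) (\<lambda>w. ((\<lambda>t. fst (w t)), (\<lambda>t. snd (w t))))"
      by (intro continuous_map_pairedI L linear_fst linear_snd contfs)
    then show "continuous_map TF2 (prod_topology TF TF) \<Psi>" by (simp add: \<Psi>_def[abs_def])
    show "\<Psi> (x + y) = \<Psi> x + \<Psi> y" for x y by (simp add: \<Psi>_def fun_eq_iff)
    show "\<Psi> (pointwise_scale complexification_scale c x) = complexification_scale c (\<Psi> x)" for c x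
      by (simp add: \<Psi>_def complexification_scale_def pointwise_scale_def fun_eq_iff scaleR_fun_def split: prod.split)
    show "linear (complexification_scale c :: 'b \<times> 'b \<Rightarrow> _)" for c
      by (auto simp: linear_iff complexification_scale_def algebra_simps split: prod.split)
    show "continuous_on UNIV (complexification_scale c :: 'b \<times> 'b \<Rightarrow> _)" for c
    proof -
      have "continuous_on UNIV (\<lambda>z::'b \<times> 'b. (Re c *\<^sub>R fst z + (- Im c) *\<^sub>R snd z, Im c *\<^sub>R fst z + Re c *\<^sub>R snd z))"
        unfolding continuous_on_def
        by (intro ballI tendsto_Pair tendsto_add_seminormed tendsto_scaleR_seminormed tendsto_fst tendsto_snd tendsto_ident_at)
      moreover have "complexification_scale c = (\<lambda>z::'b \<times> 'b. (Re c *\<^sub>R fst z + (- Im c) *\<^sub>R snd z, Im c *\<^sub>R fst z + Re c *\<^sub>R snd z))"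
        by (auto simp: complexification_scale_def)
      ultimately show ?thesis by simp
    qed
    show "complexified_mult m (complexification_scale c x) y = complexification_scale c (complexified_mult m x y)"
      "complexified_mult m x (complexification_scale c y) = complexification_scale c (complexified_mult m x y)" for c x y
      by (simp_all add: complexified_mult_def complexification_scale_def mult_add_left mult_add_right mult_diff
          mult_scaleR_left mult_scaleR_right algebra_simps split: prod.split)
    show "pointwise_scale complexification_scale c w \<in> pair_curves X" if w: "w \<in> pair_curves X" for c w
    proof -
      have w12: "(\<lambda>t. fst (w t)) \<in> X" "(\<lambda>t. snd (w t)) \<in> X" using w by (auto simp: pair_curves_def)
      show ?thesis
        using X_diff[OF X_scaleR[OF w12(1), of "Re c"] X_scaleR[OF w12(2), of "Im c"]]
          X_add[OF X_scaleR[OF w12(1), of "Im c"] X_scaleR[OF w12(2), of "Re c"]]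
        by (simp add: pair_curves_def pointwise_scale_def complexification_scale_def fun_diff_def plus_fun_def
            scaleR_fun_def case_prod_beta)
    qed
    show "g x = \<Psi> (P.evo (a, 0) (\<Phi> x))" for x by (simp add: g_def)
  qed
  moreover have "g (\<gamma>, 0) = (evo a \<gamma>, 0)" if \<gamma>: "\<gamma> \<in> X" for \<gamma>
  proof -
    \<comment> \<open>By uniqueness: with vanishing imaginary part the complexified equation is the
      original one.\<close>
    have "P.evo (a, 0) (\<Phi> (\<gamma>, 0)) = (\<lambda>t. (evo a \<gamma> t, 0))"
    proof (rule P.evo_eqI)
      show "\<Phi> (\<gamma>, 0) \<in> pair_curves X" using \<gamma> zero_X by (simp add: \<Phi>X)
      show "(\<lambda>t. (evo a \<gamma> t, 0::'b)) \<in> C_curves 1"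
        using linear_comp_C_curves_1(1)[OF P.seminormed_space_axioms seminormed_space_axioms
            evo_C1[OF \<gamma>] linear_inj_Pair(1) continuous_on_inj_Pair(1), of a] by simp
      show "(evo a \<gamma> 0, 0::'b) = (a, 0)" by (simp add: evo_0 \<gamma>)
      fix t assume t: "t \<in> {0..1::real}"
      have "has_curve_deriv (\<lambda>t. (evo a \<gamma> t, 0::'b)) (m (evo a \<gamma> t) (\<gamma> t), 0) t"
        by (rule has_curve_deriv_linear[OF has_curve_deriv_evo[OF \<gamma> t] linear_inj_Pair(1) continuous_on_inj_Pair(1)])
      then show "has_curve_deriv (\<lambda>t. (evo a \<gamma> t, 0)) (complexified_mult m (evo a \<gamma> t, 0) (\<Phi> (\<gamma>, 0) t)) t"
        by (simp add: complexified_mult_def \<Phi>_def mult_zero)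
    qed
    then show ?thesis by (simp add: g_def \<Psi>_def zero_fun_def)
  qed
  moreover have "openin TE X" using openin_topspace[of TE] topspace_TE by simp
  ultimately show ?thesis
    unfolding real_analytic_map_def using zero_X by (intro conjI exI[of _ "X \<times> X"] exI[of _ g]) auto
qed

end

section \<open>Continuous inverse algebras\<close>

text \<open>\<open>a = 0\<close>, \<open>b = T\<close> stretches the part of the curve over
  \<open>[0, T]\<close> to the unit interval, and \<open>a = 1\<close>, \<open>b = -1\<close>
  reverses time.\<close>

definition reparam :: "real \<Rightarrow> real \<Rightarrow> (real \<Rightarrow> 'b::zero) \<Rightarrow> real \<Rightarrow> 'b" where
  "reparam a b \<gamma> s = (if s \<in> {0..1} then \<gamma> (a + b * s) else 0)"

lemma affine_in_unit:
  assumes "a \<in> {0..1}" "a + b \<in> {0..1}" "s \<in> {0..1::real}"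
  shows "a + b * s \<in> {0..1}"
proof -
  have "a + b * s = (1 - s) * a + s * (a + b)" by (simp add: algebra_simps)
  moreover have "(1 - s) * a + s * (a + b) \<in> {0..1}"
    using assms convexD[OF convex_real_interval(5), of a 0 1 "a + b" "1 - s" s] by simp
  ultimately show ?thesis by simp
qed

context seminormed_space
begin

lemma reparam_lipschitz:
  assumes g: "\<gamma> \<in> (lipschitz_curves :: (real \<Rightarrow> 'b) set)" and ab: "a \<in> {0..1}" "a + b \<in> {0..1}"
  shows "reparam a b \<gamma> \<in> lipschitz_curves"
  unfolding lipschitz_curves_def
proof (intro CollectI conjI allI impI)
  show "reparam a b \<gamma> s = 0" if "s \<notin> {0..1}" for s
    unfolding reparam_def using that by (rule if_not_P)
  fix p :: "'b \<Rightarrow> real" assume p: "cseminorm p"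
  obtain L where L: "\<forall>s\<in>{0..1}. \<forall>t\<in>{0..1}. p (\<gamma> t - \<gamma> s) \<le> L * \<bar>t - s\<bar>"
    using g p unfolding lipschitz_curves_def by blast
  have "p (reparam a b \<gamma> t - reparam a b \<gamma> s) \<le> (L * \<bar>b\<bar>) * \<bar>t - s\<bar>" if st: "s \<in> {0..1}" "t \<in> {0..1}" for s t
  proof -
    have "p (\<gamma> (a + b * t) - \<gamma> (a + b * s)) \<le> L * \<bar>(a + b * t) - (a + b * s)\<bar>"
      using L affine_in_unit[OF ab st(1)] affine_in_unit[OF ab st(2)] by blast
    also have "(a + b * t) - (a + b * s) = b * (t - s)" by (simp add: algebra_simps)
    finally show ?thesis unfolding reparam_def if_P[OF st(1)] if_P[OF st(2)] by (simp add: abs_mult mult.assoc)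
  qed
  then show "\<exists>L. \<forall>s\<in>{0..1}. \<forall>t\<in>{0..1}. p (reparam a b \<gamma> t - reparam a b \<gamma> s) \<le> L * \<bar>t - s\<bar>" by blast
qed

lemma reparam_C_curves_0:
  assumes g: "\<gamma> \<in> (C_curves 0 :: (real \<Rightarrow> 'b) set)" and ab: "a \<in> {0..1}" "a + b \<in> {0..1}"
  shows "reparam a b \<gamma> \<in> C_curves 0"
proof -
  have "continuous_on {0..1} (\<lambda>s. \<gamma> (a + b * s))"
  proof (rule continuous_on_compose2[of "{0..1}" \<gamma>])
    show "continuous_on {0..1} \<gamma>" using g by (simp add: C_curves_0_iff)
    show "continuous_on {0..1} (\<lambda>s. a + b * s)" by (intro continuous_intros)
    show "(\<lambda>s. a + b * s) ` {0..1} \<subseteq> {0..1}" using affine_in_unit[OF ab] by blast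
  qed
  moreover have "continuous_on {0..1} (reparam a b \<gamma>) \<longleftrightarrow> continuous_on {0..1} (\<lambda>s. \<gamma> (a + b * s))"
    by (rule continuous_on_cong[OF refl]) (simp add: reparam_def)
  moreover have "reparam a b \<gamma> s = 0" if "s \<notin> {0..1}" for s
    unfolding reparam_def using that by (rule if_not_P)
  ultimately show ?thesis by (simp only: C_curves_0_iff) blast
qed

lemma has_curve_deriv_reparam:
  fixes \<gamma> :: "real \<Rightarrow> 'b"
  assumes d: "has_curve_deriv \<gamma> v (a + b * s)" and ab: "a \<in> {0..1}" "a + b \<in> {0..1}" and s: "s \<in> {0..1}"
  shows "has_curve_deriv (reparam a b \<gamma>) (b *\<^sub>R v) s"
  unfolding has_curve_deriv_iff
proof (intro allI impI)
  fix p e assume "cseminorm (p :: 'b \<Rightarrow> real) \<and> (e :: real) > 0"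
  then have p: "cseminorm p" and e: "e / (\<bar>b\<bar> + 1) > 0" by (auto intro: divide_pos_pos)
  obtain r where r: "r > 0" "\<And>t. t \<in> {0..1} \<Longrightarrow> \<bar>t - (a + b * s)\<bar> < r \<Longrightarrow>
      p (\<gamma> t - \<gamma> (a + b * s) - (t - (a + b * s)) *\<^sub>R v) \<le> e / (\<bar>b\<bar> + 1) * \<bar>t - (a + b * s)\<bar>"
    using d p e unfolding has_curve_deriv_iff by meson
  have "p (reparam a b \<gamma> t - reparam a b \<gamma> s - (t - s) *\<^sub>R (b *\<^sub>R v)) \<le> e * \<bar>t - s\<bar>"
    if t: "t \<in> {0..1}" "\<bar>t - s\<bar> < r / (\<bar>b\<bar> + 1)" for t
  proof -
    have eq: "(a + b * t) - (a + b * s) = b * (t - s)" by (simp add: algebra_simps)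
    have "\<bar>b * (t - s)\<bar> \<le> (\<bar>b\<bar> + 1) * \<bar>t - s\<bar>" unfolding abs_mult by (intro mult_right_mono) auto
    also have "\<dots> < r" using t(2) by (simp add: field_simps)
    finally have "\<bar>(a + b * t) - (a + b * s)\<bar> < r" unfolding eq .
    from r(2)[OF affine_in_unit[OF ab t(1)] this]
    have "p (\<gamma> (a + b * t) - \<gamma> (a + b * s) - (b * (t - s)) *\<^sub>R v) \<le> e / (\<bar>b\<bar> + 1) * \<bar>b * (t - s)\<bar>"
      unfolding eq .
    also have "\<dots> \<le> e / (\<bar>b\<bar> + 1) * ((\<bar>b\<bar> + 1) * \<bar>t - s\<bar>)"
      unfolding abs_mult using e by (intro mult_left_mono mult_right_mono) auto
    also have "\<dots> = e * \<bar>t - s\<bar>" by (simp add: field_simps)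
    finally show ?thesis
      unfolding reparam_def if_P[OF s] if_P[OF t(1)] by (simp add: mult.commute)
  qed
  then show "\<exists>d>0. \<forall>t\<in>{0..1}. \<bar>t - s\<bar> < d \<longrightarrow>
      p (reparam a b \<gamma> t - reparam a b \<gamma> s - (t - s) *\<^sub>R (b *\<^sub>R v)) \<le> e * \<bar>t - s\<bar>"
    using r(1) by (intro exI[of _ "r / (\<bar>b\<bar> + 1)"]) (auto intro: divide_pos_pos)
qed

end

text \<open>
  For \<open>T \<in> [0,1]\<close> the value at time \<open>T\<close> is the value at time 1 for the rescaled equation, and the
  value at time 1 is inverted by the evolution of the reversed equation.
\<close>

lemma evo_invertible:
  fixes X :: "(real \<Rightarrow> 'a::{real_algebra,monoid_mult,t2_space}) set"
  assumes ode: "curve_ode (*) X TE TF"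
    and cont: "\<And>a::'a. continuous_on UNIV ((*) a)"
    and rep: "\<And>\<gamma> a b. \<gamma> \<in> X \<Longrightarrow> a \<in> {0..1} \<Longrightarrow> a + b \<in> {0..1} \<Longrightarrow> reparam a b \<gamma> \<in> X"
    and g: "\<gamma> \<in> X" and T: "T \<in> {0..1}"
  shows "curve_ode.evo (*) 1 \<gamma> T \<in> unit_group"
proof -
  interpret O: curve_ode "TYPE('a)" "(*)" X TE TF by (rule ode)
  have lin: "linear ((*) (a::'a))" for a by (simp add: linear_iff distrib_left)
  \<comment> \<open>Chain rule: running through the evolution from \<open>\<eta> a\<close> with
    speed \<open>b\<close> is again an evolution.\<close>
  have re: "O.evo (\<eta> a) (b *\<^sub>R reparam a b \<gamma>) = reparam a b \<eta>"
    if g: "\<gamma> \<in> X" and ab: "a \<in> {0..1}" "a + b \<in> {0..1}" and eta: "\<eta> = O.evo 1 \<gamma>" for \<gamma> \<eta> a b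
  proof (rule O.evo_eqI)
    show X: "b *\<^sub>R reparam a b \<gamma> \<in> X" by (intro O.X_scaleR rep g ab)
    have der: "has_curve_deriv (reparam a b \<eta>) (reparam a b \<eta> s * (b *\<^sub>R reparam a b \<gamma>) s) s"
      if s: "s \<in> {0..1}" for s
      using O.has_curve_deriv_reparam[OF O.has_curve_deriv_evo[OF g affine_in_unit[OF ab s]] ab s, of 1] s
      by (simp add: eta reparam_def scaleR_fun_def)
    have etaC: "\<eta> \<in> C_curves 1" unfolding eta by (rule O.evo_C1[OF g])
    have "reparam a b \<eta> \<in> C_curves 0" by (rule O.reparam_C_curves_0[OF O.C_curves_1D(3)[OF etaC] ab])
    then have "reparam a b \<eta> \<in> lipschitz_curves"
      using O.reparam_lipschitz[OF _ ab] O.C_curves_1_subset_lipschitz_curves etaC by blast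
    then have "(\<lambda>s. reparam a b \<eta> s * (b *\<^sub>R reparam a b \<gamma>) s) \<in> X"
      using O.X_mult X O.lipschitz_subset by blast
    then have "continuous_on {0..1} (\<lambda>s. reparam a b \<eta> s * (b *\<^sub>R reparam a b \<gamma>) s)"
      using O.X_C0 by (simp add: C_curves_0_iff)
    then show "reparam a b \<eta> \<in> C_curves 1"
      by (intro O.C_curves_1I[OF _ der]) (auto simp: reparam_def)
    show "reparam a b \<eta> 0 = \<eta> a" by (simp add: reparam_def)
    show "has_curve_deriv (reparam a b \<eta>) (reparam a b \<eta> s * (b *\<^sub>R reparam a b \<gamma>) s) s" if "s \<in> {0..1}" for s
      by (rule der[OF that])
  qed
  \<comment> \<open>\<open>\<gamma>\<close> acts from the right, so left multiplication by a
    constant preserves solutions.\<close>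
  have left_mult: "O.evo x \<gamma> = (\<lambda>t. x * O.evo 1 \<gamma> t)" if g: "\<gamma> \<in> X" for x \<gamma>
  proof (rule O.evo_eqI[OF g])
    show "(\<lambda>t. x * O.evo 1 \<gamma> t) \<in> C_curves 1"
      by (rule linear_comp_C_curves_1(1)[OF O.seminormed_space_axioms O.seminormed_space_axioms O.evo_C1[OF g] lin cont])
    show "x * O.evo 1 \<gamma> 0 = x" by (simp add: O.evo_0 g)
    show "has_curve_deriv (\<lambda>t. x * O.evo 1 \<gamma> t) (x * O.evo 1 \<gamma> t * \<gamma> t) t" if "t \<in> {0..1}" for t
      using O.has_curve_deriv_linear[OF O.has_curve_deriv_evo[OF g that] lin cont] by (simp add: mult.assoc)
  qed
  \<comment> \<open>The reversed evolution that starts at \<open>O.evo 1 \<gamma> 1\<close> ends at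
    1, and by \<open>left_mult\<close> it is that starting point times the reversed evolution from
    1.\<close>
  have right_inv: "O.evo 1 \<gamma> 1 * O.evo 1 ((-1) *\<^sub>R reparam 1 (-1) \<gamma>) 1 = 1" if g: "\<gamma> \<in> X" for \<gamma>
  proof -
    have X: "(-1) *\<^sub>R reparam 1 (-1) \<gamma> \<in> X" by (intro O.X_scaleR rep g) auto
    have "O.evo (O.evo 1 \<gamma> 1) ((-1) *\<^sub>R reparam 1 (-1) \<gamma>) = reparam 1 (-1) (O.evo 1 \<gamma>)"
      by (rule re[OF g _ _ refl]) auto
    with left_mult[OF X, of "O.evo 1 \<gamma> 1"]
    have "(\<lambda>t. O.evo 1 \<gamma> 1 * O.evo 1 ((-1) *\<^sub>R reparam 1 (-1) \<gamma>) t) = reparam 1 (-1) (O.evo 1 \<gamma>)"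
      by (rule trans[OF sym])
    then have "O.evo 1 \<gamma> 1 * O.evo 1 ((-1) *\<^sub>R reparam 1 (-1) \<gamma>) 1 = reparam 1 (-1) (O.evo 1 \<gamma>) 1"
      by (rule fun_cong)
    also have "\<dots> = 1" by (simp add: reparam_def O.evo_0 g)
    finally show ?thesis .
  qed
  define \<delta> where "\<delta> = T *\<^sub>R reparam 0 T \<gamma>"
  have dX: "\<delta> \<in> X" unfolding \<delta>_def using T by (intro O.X_scaleR rep g) auto
  define \<delta>' where "\<delta>' = (-1) *\<^sub>R reparam 1 (-1) \<delta>"
  have d'X: "\<delta>' \<in> X" unfolding \<delta>'_def by (intro O.X_scaleR rep dX) auto
  \<comment> \<open>Reversal is an involution, so the right inverse has itself a right inverse,
    namely the original value. This makes the inverse two-sided.\<close>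
  have "(-1) *\<^sub>R reparam 1 (-1) \<delta>' = \<delta>"
  proof
    fix s
    show "((-1) *\<^sub>R reparam 1 (-1) \<delta>') s = \<delta> s"
      using C_curves_outside[OF O.X_C0[OF dX], of s]
      by (cases "s \<in> {0..1}") (auto simp: \<delta>'_def reparam_def scaleR_fun_def)
  qed
  then have inv: "O.evo 1 \<delta> 1 * O.evo 1 \<delta>' 1 = 1" "O.evo 1 \<delta>' 1 * O.evo 1 \<delta> 1 = 1"
    using right_inv[OF dX] right_inv[OF d'X] by (simp_all add: \<delta>'_def)
  have "O.evo (O.evo 1 \<gamma> 0) \<delta> = reparam 0 T (O.evo 1 \<gamma>)"
    unfolding \<delta>_def by (rule re[OF g _ _ refl]) (use T in auto)
  then have "O.evo 1 \<gamma> T = O.evo 1 \<delta> 1"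
    by (simp add: O.evo_0 g reparam_def)
  then show ?thesis using inv unfolding unit_group_def by auto
qed

section \<open>The submultiplicative estimate and the evolution map of the unit group\<close>

context continuous_inverse_algebra
begin

lemma continuous_on_mult_left: "continuous_on UNIV ((*) (a::'a))"
proof -
  have "continuous_on UNIV (\<lambda>x::'a. (\<lambda>(x, y). x * y) (a, x))"
    by (rule continuous_on_compose2[OF continuous_mult])
      (auto intro: continuous_on_Pair continuous_on_const continuous_on_id)
  then show ?thesis by simp
qed

lemma has_dir_deriv_mult: "has_dir_deriv euclidean y ((*) a) x (a * y :: 'a)"
proof -
  have "\<forall>\<^sub>F t in at (0::real). a * y = (a * (x + t *\<^sub>R y) - a * x) /\<^sub>R t"
    by (auto simp: eventually_at_filter distrib_left)
  then have "((\<lambda>t. (a * (x + t *\<^sub>R y) - a * x) /\<^sub>R t) \<longlongrightarrow> a * y) (at 0)"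
    by (rule Lim_transform_eventually[OF tendsto_const])
  then show ?thesis by (simp add: has_dir_deriv_def)
qed

lemma dir_deriv_mult: "dir_deriv euclidean y ((*) a) x = (a * y :: 'a)"
  unfolding dir_deriv_def
proof (rule the_equality)
  show "has_dir_deriv euclidean y ((*) a) x (a * y)" by (rule has_dir_deriv_mult)
  fix l assume "has_dir_deriv euclidean y ((*) a) x l"
  then show "l = a * y"
    using has_dir_deriv_mult[of y a x] tendsto_unique[OF trivial_limit_at]
    unfolding has_dir_deriv_def limitin_canonical_iff by blast
qed

text \<open>
  The seminorm \<open>p'\<close> is the supremum of \<open>r\<^sup>k p(x b\<^sub>1 \<dots> b\<^sub>k)\<close> over \<open>k\<close> and over all \<open>b\<^sub>i\<close> with
  \<open>q(b\<^sub>i) \<le> 1\<close>. Finiteness comes from the boundedness of \<open>r\<^sup>n \<parallel>\<mu>\<^sub>n\<parallel>\<close>; multiplying by one more factor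
  shifts \<open>k\<close> by one.
\<close>

lemma mult_bound_from_mu_norm:
  assumes K: "K = \<real> \<or> K = UNIV"
    and mu: "\<And>p. continuous_seminorm K cs p \<Longrightarrow>
      \<exists>q r. continuous_seminorm K cs q \<and> r > 0 \<and>
        (\<Sum>n. ennreal (r ^ Suc n) * mu_norm (Suc n) p q) < \<infinity>"
    and p: "cseminorm (p :: 'a \<Rightarrow> real)"
  shows "\<exists>p' q'. cseminorm p' \<and> cseminorm q' \<and> (\<forall>x. p x \<le> p' x) \<and> (\<forall>x y::'a. p' (x * y) \<le> p' x * q' y)"
proof -
  interpret seminormed_space "TYPE('a)" by (rule seminormed_space[OF K])
  have RK: "\<real> \<subseteq> K" using K by auto
  note imp = continuous_seminorm_imp_cseminorm[OF locally_convex_space_axioms RK]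
  obtain P where P: "continuous_seminorm K cs P" "\<And>x. p x \<le> P x"
    using cseminorm_le_continuous_seminorm[OF K p] by blast
  obtain q r where q: "continuous_seminorm K cs q" and r: "r > 0"
    and fin: "(\<Sum>n. ennreal (r ^ Suc n) * mu_norm (Suc n) P q) < \<infinity>"
    using mu[OF P(1)] by blast
  have cP: "cseminorm P" and cq: "cseminorm q" by (rule imp[OF P(1)], rule imp[OF q])
  define C where "C = enn2real (\<Sum>n. ennreal (r ^ Suc n) * mu_norm (Suc n) P q)"
  have C: "r ^ length xs * P (prod_list xs) \<le> C" if xs: "xs \<noteq> []" "\<forall>x\<in>set xs. q x \<le> 1" for xs
  proof -
    obtain n where n: "length xs = Suc n" using xs(1) by (cases xs) auto
    have "ennreal (r ^ length xs * P (prod_list xs)) = ennreal (r ^ Suc n) * ennreal (P (prod_list xs))"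
      using r by (simp add: n ennreal_mult cseminorm_nonneg[OF cP])
    also have "\<dots> \<le> ennreal (r ^ Suc n) * mu_norm (Suc n) P q"
      unfolding mu_norm_def using xs n by (intro mult_left_mono SUP_upper) auto
    also have "\<dots> \<le> (\<Sum>n. ennreal (r ^ Suc n) * mu_norm (Suc n) P q)"
      using sum_le_suminf[OF summableI, of "{n}" "\<lambda>n. ennreal (r ^ Suc n) * mu_norm (Suc n) P q"] by simp
    also have "\<dots> = ennreal C" using fin by (simp add: C_def)
    finally show ?thesis by (simp add: C_def)
  qed
  \<comment> \<open>Passes from a bound on the unit ball of \<open>q\<close> to a multiple of
    \<open>q\<close>. Dividing by \<open>q x + d\<close> instead of \<open>q x\<close> covers
    vectors with \<open>q x = 0\<close>, and \<open>d\<close> is chosen so that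
    \<open>c * d \<le> e\<close>.\<close>
  have hom: "f x \<le> c * q x"
    if f: "\<And>a x. f (a *\<^sub>R x) = \<bar>a\<bar> * f x" and c: "c \<ge> 0" and le: "\<And>x. q x \<le> 1 \<Longrightarrow> f x \<le> c" for f c x
  proof (rule field_le_epsilon)
    fix e :: real assume e: "e > 0"
    define d where "d = e / (c + 1)"
    have d: "d > 0" "c * d \<le> e" using e c by (auto simp: d_def field_simps)
    have qd: "q x + d > 0" using cseminorm_nonneg[OF cq, of x] d by linarith
    have "f (inverse (q x + d) *\<^sub>R x) \<le> c"
      using qd d by (intro le) (simp add: cseminorm_scale[OF cq] field_simps)
    then have "f x \<le> c * (q x + d)" using qd by (simp add: f field_simps)
    then show "f x \<le> c * q x + e" using d(2) by (simp add: algebra_simps)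
  qed
  define B where "B = {bs :: 'a list. \<forall>b\<in>set bs. q b \<le> 1}"
  define g where "g x bs = r ^ length bs * P (x * prod_list bs)" for x and bs :: "'a list"
  have gs: "g (a *\<^sub>R x) bs = \<bar>a\<bar> * g x bs" for a x bs
    by (simp add: g_def cseminorm_scale[OF cP])
  have C0: "C \<ge> 0" by (simp add: C_def)
  \<comment> \<open>\<open>x\<close> itself counts as one more factor with
    \<open>q x \<le> 1\<close>, which accounts for the division by \<open>r\<close>.\<close>
  have gle: "g x bs \<le> C / r * q x" if bs: "bs \<in> B" for x bs
  proof (rule hom[of "\<lambda>x. g x bs", OF gs])
    show "C / r \<ge> 0" using C0 r by simp
    fix x assume "q x \<le> 1"
    then have "r ^ length (x # bs) * P (prod_list (x # bs)) \<le> C" using bs by (intro C) (auto simp: B_def)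
    then show "g x bs \<le> C / r" using r by (simp add: g_def field_simps)
  qed
  define p' where "p' x = (SUP bs\<in>B. g x bs)" for x
  have Bne: "[] \<in> B" by (simp add: B_def)
  have bdd: "bdd_above (g x ` B)" for x using gle by (intro bdd_aboveI2) auto
  have up: "g x bs \<le> p' x" if "bs \<in> B" for x bs
    unfolding p'_def by (rule cSUP_upper[OF that bdd])
  have least: "p' x \<le> c" if "\<And>bs. bs \<in> B \<Longrightarrow> g x bs \<le> c" for x c
    unfolding p'_def using Bne that by (intro cSUP_least) auto
  have Pp': "P x \<le> p' x" for x using up[OF Bne, of x] by (simp add: g_def)
  have nonneg: "0 \<le> p' x" for x using Pp'[of x] cseminorm_nonneg[OF cP, of x] by linarith
  have "seminorm_on UNIV p'"
  proof (rule seminorm_onI)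
    fix x y and a :: real
    show "p' (x + y) \<le> p' x + p' y"
    proof (rule least)
      fix bs assume bs: "bs \<in> B"
      have "P ((x + y) * prod_list bs) \<le> P (x * prod_list bs) + P (y * prod_list bs)"
        unfolding distrib_right by (rule cseminorm_add[OF cP])
      then have "g (x + y) bs \<le> g x bs + g y bs"
        unfolding g_def distrib_left[symmetric] using r by (intro mult_left_mono) auto
      then show "g (x + y) bs \<le> p' x + p' y" using up[OF bs, of x] up[OF bs, of y] by linarith
    qed
    show "p' (a *\<^sub>R x) \<le> \<bar>a\<bar> * p' x"
      unfolding gs[symmetric] using up by (intro least) (simp add: gs mult_left_mono)
    show "0 \<le> p' x" by (rule nonneg)
  qed simp
  \<comment> \<open>The members of the supremum are infinitely many; continuity is obtained from
    domination by a multiple of \<open>q\<close>.\<close>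
  then have "cseminorm p'"
  proof (intro cseminorm_dominated[of p' "\<lambda>x. C / r * q x"])
    show "cseminorm (\<lambda>x. C / r * q x)" using C0 r by (intro cseminorm_mult cq) simp
    show "p' x \<le> C / r * q x" for x by (rule least[OF gle])
  qed (auto simp: seminorm_on_def)
  moreover have "cseminorm (\<lambda>y. 1 / r * q y)" using r by (intro cseminorm_mult cq) simp
  moreover have "p x \<le> p' x" for x using P(2) Pp' order_trans by blast
  moreover have "p' (x * y) \<le> p' x * (1 / r * q y)" for x y
  proof (rule least)
    fix bs assume bs: "bs \<in> B"
    have "g (x * y) bs \<le> p' x / r * q y"
    proof (rule hom[of "\<lambda>y. g (x * y) bs"])
      show "g (x * (a *\<^sub>R z)) bs = \<bar>a\<bar> * g (x * z) bs" for a z by (simp add: gs)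
      show "0 \<le> p' x / r" using nonneg r by simp
      fix z assume "q z \<le> 1"
      then have "g x (z # bs) \<le> p' x" using bs by (intro up) (auto simp: B_def)
      then show "g (x * z) bs \<le> p' x / r" using r by (simp add: g_def field_simps mult.assoc)
    qed
    then show "g (x * y) bs \<le> p' x * (1 / r * q y)" by simp
  qed
  ultimately show ?thesis by (intro exI[of _ p'] exI[of _ "\<lambda>y. 1 / r * q y"]) blast
qed

lemma linear_cs:
  assumes "\<real> \<subseteq> K" "c \<in> K"
  shows "linear (cs c)"
proof -
  have "cs c (r *\<^sub>R x) = r *\<^sub>R cs c x" for r x
  proof -
    have "of_real r \<in> K" using assms(1) by auto
    then show ?thesis
      using cs_mult[of c "of_real r" x] cs_mult[of "of_real r" c x] assms(2)
      by (simp add: cs_of_real mult.commute)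
  qed
  then show ?thesis using cs_add_right[OF assms(2)] by (simp add: linear_iff)
qed

text \<open>The conclusions of both completeness cases at once, for any admissible space of curves.
  Closure under affine changes of time yields invertibility, closure under scalars yields complex
  linearity of the Taylor terms.\<close>

lemma evolutions_on_curve_space:
  fixes X :: "(real \<Rightarrow> 'a) set"
  assumes K: "K = \<real> \<or> K = UNIV"
    and ode: "curve_ode (*) X TE TF"
    and rep: "\<forall>\<gamma>\<in>X. \<forall>a b. a \<in> {0..1} \<longrightarrow> a + b \<in> {0..1} \<longrightarrow> reparam a b \<gamma> \<in> X"
    and scale: "\<forall>\<gamma>\<in>X. \<forall>c\<in>K. pointwise_scale cs c \<gamma> \<in> X"
  shows "\<gamma> \<in> X \<Longrightarrow> \<exists>\<eta>. is_evolution unit_group times 1 \<gamma> \<eta>"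
    and "Evol unit_group times 1 ` X \<subseteq> C_curves_into 1 unit_group"
    and "analytic_map K (pointwise_scale cs) TE (pointwise_scale cs) TF X (Evol unit_group times 1)"
    and "continuous_map TX TE (\<lambda>\<gamma>. \<gamma>) \<Longrightarrow>
      smooth_map TX euclidean (topspace TX) (\<lambda>\<gamma>. Evol unit_group times 1 \<gamma> 1)"
proof -
  interpret O: curve_ode "TYPE('a)" "(*)" X TE TF by (rule ode)
  have ev: "is_evolution unit_group times 1 \<gamma> (O.evo 1 \<gamma>)" if g: "\<gamma> \<in> X" for \<gamma>
    unfolding is_evolution_def C_curves_into_def
  proof (intro conjI ballI CollectI image_subsetI)
    show "O.evo 1 \<gamma> \<in> C_curves 1" "O.evo 1 \<gamma> 0 = 1" by (rule O.evo_C1[OF g], rule O.evo_0[OF g])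
    fix t assume t: "t \<in> {0..1::real}"
    show "O.evo 1 \<gamma> t \<in> unit_group" 
      by (rule evo_invertible[OF ode continuous_on_mult_left _ g t]) (use rep in blast)
    show "curve_deriv (O.evo 1 \<gamma>) t = dir_deriv euclidean (\<gamma> t) ((*) (O.evo 1 \<gamma> t)) 1"
      unfolding dir_deriv_mult by (rule O.curve_deriv_eq[OF O.has_curve_deriv_evo[OF g t] t])
  qed
  \<comment> \<open>Uniqueness makes the description \<open>Evol\<close> equal to
    \<open>O.evo 1\<close>, to which the analytic results apply.\<close>
  have uniq: "\<eta> = O.evo 1 \<gamma>" if g: "\<gamma> \<in> X" and e: "is_evolution unit_group times 1 \<gamma> \<eta>" for \<gamma> \<eta>
  proof (rule O.evo_eqI[OF g, symmetric])
    show C: "\<eta> \<in> C_curves 1" and "\<eta> 0 = 1" using e by (auto simp: is_evolution_def C_curves_into_def)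
    show "has_curve_deriv \<eta> (\<eta> t * \<gamma> t) t" if t: "t \<in> {0..1}" for t
      using O.C_curves_1D(1)[OF C t] e t by (simp add: is_evolution_def dir_deriv_mult)
  qed
  have Evol: "Evol unit_group times 1 \<gamma> = O.evo 1 \<gamma>" if g: "\<gamma> \<in> X" for \<gamma>
    unfolding Evol_def
  proof (rule the_equality)
    show "is_evolution unit_group times 1 \<gamma> (O.evo 1 \<gamma>)" by (rule ev[OF g])
  qed (rule uniq[OF g])
  show "\<gamma> \<in> X \<Longrightarrow> \<exists>\<eta>. is_evolution unit_group times 1 \<gamma> \<eta>" using ev by blast
  show "Evol unit_group times 1 ` X \<subseteq> C_curves_into 1 unit_group"
    using ev Evol by (auto simp: is_evolution_def)
  show "continuous_map TX TE (\<lambda>\<gamma>. \<gamma>) \<Longrightarrow>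
      smooth_map TX euclidean (topspace TX) (\<lambda>\<gamma>. Evol unit_group times 1 \<gamma> 1)"
    by (rule O.smooth_evo[where a = 1]) (simp_all add: Evol)
  show "analytic_map K (pointwise_scale cs) TE (pointwise_scale cs) TF X (Evol unit_group times 1)"
  proof (cases "K = UNIV")
    case True
    have RK: "\<real> \<subseteq> K" and cK: "c \<in> K" for c using True by auto
    have "complex_analytic_map (pointwise_scale cs) TE (pointwise_scale cs) TF X (Evol unit_group times 1)"
      by (rule O.complex_analytic_evo[where \<Phi> = "\<lambda>\<gamma>. \<gamma>" and \<Psi> = "\<lambda>\<gamma>. \<gamma>" and cs = cs and a = 1])
        (simp_all add: O.topspace_TE O.subspace_X linear_cs[OF RK cK] continuous_on_cs[OF cK]
          cs_mult_left[OF cK] cs_mult_right[OF cK] scale cK Evol)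
    then show ?thesis using True by (simp add: analytic_map_def)
  next
    case False
    have "openin TE X" using openin_topspace[of TE] O.topspace_TE by simp
    have "real_analytic_map TE TF X (Evol unit_group times 1)"
      using O.real_analytic_evo[of 1] Evol unfolding real_analytic_map_def by (simp cong: conj_cong)
    then show ?thesis using False by (simp add: analytic_map_def)
  qed
qed

end

section \<open>The sequentially complete and the Mackey-complete case\<close>

theorem proposition3p4:
  fixes K :: "complex set"
    and cs :: "complex \<Rightarrow> 'a::{real_algebra,monoid_mult,t2_space} \<Rightarrow> 'a"
  assumes K: "K = \<real> \<or> K = UNIV"
    and A: "continuous_inverse_algebra K cs"
    and mu: "\<And>p. continuous_seminorm K cs p \<Longrightarrow>
      \<exists>q r. continuous_seminorm K cs q \<and> r > 0 \<and>
        (\<Sum>n. ennreal (r ^ Suc n) * mu_norm (Suc n) p q) < \<infinity>"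
  shows "(sequentially_complete TYPE('a) \<longrightarrow>
      strongly_regular K cs 0 unit_group times (1::'a) \<and>
      Evol unit_group times 1 ` C_curves 0 \<subseteq> C_curves_into 1 (unit_group :: 'a set) \<and>
      analytic_map K (pointwise_scale cs) (C_topology K cs 0)
        (pointwise_scale cs) (C_topology K cs 1) (C_curves 0) (Evol unit_group times 1))
    \<and> (mackey_complete K cs \<longrightarrow>
      regular K cs 0 unit_group times (1::'a) \<and>
      strongly_regular K cs 1 unit_group times (1::'a) \<and>
      (\<forall>\<gamma>\<in>Lip K cs. \<exists>\<eta>. is_evolution unit_group times 1 \<gamma> \<eta>) \<and>
      Evol unit_group times 1 ` Lip K cs \<subseteq> C_curves_into 1 unit_group \<and>
      analytic_map K (pointwise_scale cs) (subtopology (C_topology K cs 0) (Lip K cs))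
        (pointwise_scale cs) (C_topology K cs 1) (Lip K cs) (Evol unit_group times 1))"
proof -
  interpret continuous_inverse_algebra K cs by (rule A)
  interpret S: seminormed_space "TYPE('a)" by (rule seminormed_space[OF K])
  interpret M: bounded_mult "TYPE('a)" "(*)"
    by (intro bounded_mult.intro bounded_mult_axioms.intro S.seminormed_space_axioms distrib_right
        distrib_left mult_scaleR_left mult_scaleR_right mult_bound_from_mu_norm[OF K mu])
  have RK: "\<real> \<subseteq> K" using K by auto
  interpret T0: seminorm_topology "C_topology K cs 0" "C_curves 0" "curve_sup ` {p :: 'a \<Rightarrow> real. cseminorm p}"
    by (rule seminorm_topology_C_topology[OF K]) simp
  interpret T1: seminorm_topology "C_topology K cs 1" "C_curves 1" "curve_sup1 ` {p :: 'a \<Rightarrow> real. cseminorm p}"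
    by (rule seminorm_topology_C_topology[OF K]) simp
  have scale0: "\<forall>\<gamma>\<in>C_curves 0. \<forall>c\<in>K. pointwise_scale cs c \<gamma> \<in> C_curves 0"
    unfolding pointwise_scale_def
    using linear_comp_C_curves_0[OF _ linear_cs[OF RK] continuous_on_cs] by blast
  have scaleL: "\<forall>\<gamma>\<in>lipschitz_curves. \<forall>c\<in>K. pointwise_scale cs c \<gamma> \<in> lipschitz_curves"
    unfolding pointwise_scale_def
    using linear_comp_lipschitz_curves[OF _ linear_cs[OF RK] continuous_on_cs] by blast
  have rep0: "\<forall>\<gamma>\<in>C_curves 0. \<forall>a b. a \<in> {0..1} \<longrightarrow> a + b \<in> {0..1} \<longrightarrow>
      reparam a b \<gamma> \<in> (C_curves 0 :: (real \<Rightarrow> 'a) set)"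
    using S.reparam_C_curves_0 by blast
  have repL: "\<forall>\<gamma>\<in>lipschitz_curves. \<forall>a b. a \<in> {0..1} \<longrightarrow> a + b \<in> {0..1} \<longrightarrow>
      reparam a b \<gamma> \<in> (lipschitz_curves :: (real \<Rightarrow> 'a) set)"
    using S.reparam_lipschitz by blast
  show ?thesis
  proof (intro conjI impI)
    assume sc: "sequentially_complete TYPE('a)"
    have ode: "curve_ode (*) (C_curves 0 :: (real \<Rightarrow> 'a) set) (C_topology K cs 0) (C_topology K cs 1)"
      by unfold_locales
        (use S.subspace_C_curves_0 S.lipschitz_curves_subset_C_curves_0 M.mult_C_curves_0
          S.antiderivative_continuous[OF sc] T0.seminorm_topology_axioms T1.seminorm_topology_axioms in auto)
    note main = evolutions_on_curve_space[OF K ode rep0 scale0]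
    show "strongly_regular K cs 0 unit_group times (1::'a)"
      unfolding strongly_regular_def
      using main(1) main(4)[of "C_topology K cs 0"] T0.topspace_eq continuous_map_id[of "C_topology K cs 0"]
      by (simp add: id_def)
    show "Evol unit_group times 1 ` C_curves 0 \<subseteq> C_curves_into 1 (unit_group :: 'a set)"
      by (rule main(2))
    show "analytic_map K (pointwise_scale cs) (C_topology K cs 0)
        (pointwise_scale cs) (C_topology K cs 1) (C_curves 0) (Evol unit_group times 1)"
      using main(3) .
  next
    assume mc: "mackey_complete K cs"
    have Lip: "Lip K cs = lipschitz_curves" by (rule Lip_eq_lipschitz_curves[OF K])
    let ?TE = "subtopology (C_topology K cs 0) (Lip K cs)"
    have TE: "seminorm_topology ?TE lipschitz_curves (curve_sup ` {p :: 'a \<Rightarrow> real. cseminorm p})"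
      unfolding Lip by (rule T0.seminorm_topology_subtopology[OF S.subspace_lipschitz_curves S.lipschitz_curves_subset_C_curves_0])
    have ode: "curve_ode (*) (Lip K cs) ?TE (C_topology K cs 1)"
      unfolding Lip
      by (intro curve_ode.intro M.bounded_mult_axioms curve_ode_axioms.intro S.subspace_lipschitz_curves
          S.lipschitz_curves_subset_C_curves_0 M.mult_lipschitz_curves antiderivative_Lip[OF K mc]
          TE[unfolded Lip] T1.seminorm_topology_axioms order_refl)
    interpret O: curve_ode "TYPE('a)" "(*)" "Lip K cs" ?TE "C_topology K cs 1" by (rule ode)
    note main = evolutions_on_curve_space[OF K ode repL[folded Lip] scaleL[folded Lip]]
    have inf: "C_curves \<infinity> \<subseteq> Lip K cs"
      using C_curves_infinity_subset S.C_curves_1_subset_lipschitz_curves Lip by blast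
    have one: "C_curves 1 \<subseteq> Lip K cs"
      using S.C_curves_1_subset_lipschitz_curves Lip by blast
    have inf0: "C_curves \<infinity> \<subseteq> (C_curves 0 :: (real \<Rightarrow> 'a) set)"
      using inf S.lipschitz_curves_subset_C_curves_0 Lip by blast
    let ?TX = "subtopology (C_topology K cs 0) (C_curves \<infinity>)"
    \<comment> \<open>Smooth curves carry the topology of uniform convergence here, as in the
      definition of regularity. They are Lipschitz, so the inclusion is continuous and smoothness is
      inherited through it.\<close>
    have "continuous_map ?TX ?TE (\<lambda>\<gamma>. \<gamma>)"
      unfolding continuous_map_in_subtopology
      using inf continuous_map_from_subtopology[OF continuous_map_id[unfolded id_def]] by auto
    from main(4)[OF this]
    show "regular K cs 0 unit_group times (1::'a)"
      unfolding regular_def using main(1) inf inf0 T0.topspace_eq by (auto simp: Int_absorb1)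
    \<comment> \<open>\<open>C\<^sup>1\<close> convergence implies uniform convergence, so strong
      regularity of order 1 is inherited from the Lipschitz curves.\<close>
    have "continuous_map (C_topology K cs 1) ?TE (\<lambda>\<gamma>. \<gamma>)"
      unfolding continuous_map_atin
    proof
      fix \<gamma> assume "\<gamma> \<in> topspace (C_topology K cs 1)"
      then have "limitin (C_topology K cs 1) (\<lambda>\<gamma>. \<gamma>) \<gamma> (atin (C_topology K cs 1) \<gamma>)"
        by (rule bspec[OF continuous_map_id[of "C_topology K cs 1", unfolded continuous_map_atin id_def]])
      then show "limitin ?TE (\<lambda>\<gamma>. \<gamma>) \<gamma> (atin (C_topology K cs 1) \<gamma>)"
        by (rule O.limitin_TF_imp_TE)
    qed
    from main(4)[OF this]
    show "strongly_regular K cs 1 unit_group times (1::'a)"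
      unfolding strongly_regular_def using main(1) one T1.topspace_eq by auto
    show "\<forall>\<gamma>\<in>Lip K cs. \<exists>\<eta>. is_evolution unit_group times 1 \<gamma> \<eta>" using main(1) by blast
    show "Evol unit_group times 1 ` Lip K cs \<subseteq> C_curves_into 1 unit_group"
      "analytic_map K (pointwise_scale cs) ?TE (pointwise_scale cs) (C_topology K cs 1) (Lip K cs)
        (Evol unit_group times 1)"
      by (fact main(2), fact main(3))
  qed
qed

end
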